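(* Let $0<k<n$. For any finite subset $S=\{E_i\}_{i=1}^N\subset\mathrm{Gr}_k(\mathbb R^n)$ of (distinct) $k$-dimensional linear subspaces, and any choice of densities $\mu_i\in\mathrm{Dens}(E_i)$, $1\le i\le N$, there is a valuation $\phi\in\mathrm{Val}_k^{+,\infty}(\mathbb R^n)$ with $\phi|_{E_i}=\mu_i$ for all $i$.
   Context: $\mathrm{Dens}(E)$ is the one-dimensional space of real multiples of Lebesgue measure on $E$. $\mathrm{Val}_k^{+,\infty}(\mathbb R^n)$ is the space of $k$-homogeneous, even ($\phi(-K)=\phi(K)$) valuations in $\mathrm{Val}^\infty(\mathbb R^n)$, where $\mathrm{Val}^\infty(\mathbb R^n)$ is the space of smooth vectors of the $\mathrm{GL}_n(\mathbb R)$-action $(g\cdot\phi)(K)=\phi(g^{-1}K)$ on the Banach space of Hausdorff-continuous translation-invariant valuations on convex bodies in $\mathbb R^n$. For $\dim E=k$, the restriction $\phi|_E$ of a $k$-homogeneous such valuation is an element of $\mathrm{Dens}(E)$ by Hadwiger's theorem. *)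

theory Defs
  imports "HOL-Complex_Analysis.Great_Picard"
begin

section \<open>Convex bodies and the Hausdorff metric\<close>

typedef (overloaded) ('a::euclidean_space) convex_body =
    "{K :: 'a set. convex K \<and> compact K \<and> K \<noteq> {}}"
  morphisms body_set Convex_Body
  by (rule exI[of _ "{0}"]) auto

lemma convex_body_set [simp]: "convex (body_set K)"
  and compact_body_set [simp]: "compact (body_set K)"
  and body_set_nonempty [simp]: "body_set K \<noteq> {}"
  and closed_body_set [simp]: "closed (body_set K)"
  and bounded_body_set [simp]: "bounded (body_set K)"
  using body_set[of K] by (auto intro: compact_imp_closed compact_imp_bounded)

lemma body_set_Convex_Body:
  "convex K \<Longrightarrow> compact K \<Longrightarrow> K \<noteq> {} \<Longrightarrow> body_set (Convex_Body K) = K"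
  by (simp add: Convex_Body_inverse)

lemma body_set_subset_cball: "\<exists>R. body_set K \<subseteq> cball 0 R"
  using bounded_body_set[of K] by (auto simp: bounded_iff subset_iff)

lemma bdd_above_infdist_body: "bdd_above ((\<lambda>a. infdist a A) ` body_set K)"
  by (intro bounded_imp_bdd_above compact_imp_bounded compact_continuous_image
      continuous_intros compact_body_set)

instantiation convex_body :: (euclidean_space) metric_space
begin

definition dist_convex_body :: "'a convex_body \<Rightarrow> 'a convex_body \<Rightarrow> real" where
  "dist_convex_body K L =
     max (SUP a\<in>body_set K. infdist a (body_set L)) (SUP b\<in>body_set L. infdist b (body_set K))"

definition uniformity_convex_body :: "('a convex_body \<times> 'a convex_body) filter"
  where "uniformity_convex_body = (INF e\<in>{0 <..}. principal {(x, y). dist x y < e})"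

definition open_convex_body :: "'a convex_body set \<Rightarrow> bool"
  where "open_convex_body S = (\<forall>x\<in>S. \<forall>\<^sub>F (x', y) in uniformity. x' = x \<longrightarrow> y \<in> S)"

lemma dist_convex_body_le_iff:
  fixes K L :: "'a convex_body"
  shows "dist K L \<le> e \<longleftrightarrow> (\<forall>a\<in>body_set K. infdist a (body_set L) \<le> e) \<and>
                         (\<forall>b\<in>body_set L. infdist b (body_set K) \<le> e)"
  unfolding dist_convex_body_def
  by (simp add: cSUP_le_iff bdd_above_infdist_body)

lemma infdist_le_dist_convex_body:
  fixes K L :: "'a convex_body"
  assumes "a \<in> body_set K"
  shows "infdist a (body_set L) \<le> dist K L" "infdist a (body_set L) \<le> dist L K"
  using assms dist_convex_body_le_iff[of K L "dist K L"] dist_convex_body_le_iff[of L K "dist L K"]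
  by auto

lemma infdist_body_trans:
  fixes K L M :: "'a convex_body"
  assumes "a \<in> body_set K"
  shows "infdist a (body_set L) \<le> dist K M + dist L M"
proof -
  obtain m where m: "m \<in> body_set M" "infdist a (body_set M) = dist a m"
    using infdist_attains_inf[of "body_set M" a] by auto
  have "infdist a (body_set L) \<le> infdist m (body_set L) + dist a m"
    by (rule infdist_triangle)
  also have "infdist m (body_set L) \<le> dist L M"
    using infdist_le_dist_convex_body(2)[OF m(1)] .
  also have "dist a m \<le> dist K M"
    using infdist_le_dist_convex_body(1)[OF assms, of M] m(2) by simp
  finally show ?thesis by simp
qed

instance
proof
  fix K L M :: "'a convex_body"
  show "dist K L = 0 \<longleftrightarrow> K = L"
  proof
    assume eq: "dist K L = 0"
    have "infdist a (body_set L) = 0" if "a \<in> body_set K" for a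
      using infdist_le_dist_convex_body(1)[OF that, of L] eq infdist_nonneg[of a "body_set L"] by simp
    moreover have "infdist a (body_set K) = 0" if "a \<in> body_set L" for a
      using infdist_le_dist_convex_body(2)[OF that, of K] eq infdist_nonneg[of a "body_set K"] by simp
    ultimately have "body_set K = body_set L"
      using in_closed_iff_infdist_zero[OF closed_body_set body_set_nonempty] by blast
    then show "K = L" by (simp add: body_set_inject)
  next
    assume "K = L"
    then show "dist K L = 0" by (simp add: dist_convex_body_def)
  qed
  show "dist K L \<le> dist K M + dist L M"
    unfolding dist_convex_body_le_iff[of K L]
    using infdist_body_trans[of _ K L M] infdist_body_trans[of _ L K M] by (auto simp: add.commute)
qed (rule open_convex_body_def uniformity_convex_body_def)+

end

text \<open>Only used for affine \<open>f\<close>, where the image is again a convex body.\<close>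

definition body_image :: "('a::euclidean_space \<Rightarrow> 'a) \<Rightarrow> 'a convex_body \<Rightarrow> 'a convex_body" where
  "body_image f K = Convex_Body (f ` body_set K)"

lemma body_set_body_image_linear:
  assumes "linear f"
  shows "body_set (body_image f K) = f ` body_set K"
  unfolding body_image_def
  by (rule body_set_Convex_Body)
     (use assms in \<open>auto intro!: convex_linear_image compact_continuous_image linear_continuous_on
        simp: linear_conv_bounded_linear\<close>)

lemma body_set_body_image_translation:
  "body_set (body_image ((+) v) K) = (+) v ` body_set K"
  unfolding body_image_def
  by (rule body_set_Convex_Body) (auto intro: compact_translation)

lemma infdist_convex_combination:
  fixes A :: "'a::euclidean_space set"
  assumes A: "convex A" "closed A" "A \<noteq> {}" and uv: "0 \<le> u" "0 \<le> v" "u + v = (1::real)"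
  shows "infdist (u *\<^sub>R x + v *\<^sub>R y) A \<le> u * infdist x A + v * infdist y A"
proof -
  obtain a b where a: "a \<in> A" "infdist x A = dist x a" and b: "b \<in> A" "infdist y A = dist y b"
    using infdist_attains_inf[OF A(2,3)] by metis
  have "u *\<^sub>R a + v *\<^sub>R b \<in> A"
    using A(1) a b uv by (auto simp: convex_def)
  then have "infdist (u *\<^sub>R x + v *\<^sub>R y) A \<le> dist (u *\<^sub>R x + v *\<^sub>R y) (u *\<^sub>R a + v *\<^sub>R b)"
    by (rule infdist_le)
  also have "\<dots> = norm (u *\<^sub>R (x - a) + v *\<^sub>R (y - b))"
    by (simp add: dist_norm algebra_simps)
  also have "\<dots> \<le> u * dist x a + v * dist y b"
    using norm_triangle_ineq[of "u *\<^sub>R (x - a)" "v *\<^sub>R (y - b)"] uv by (simp add: dist_norm)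
  finally show ?thesis using a b by simp
qed

lemma Blaschke_selection:
  fixes X :: "nat \<Rightarrow> 'a::euclidean_space convex_body"
  assumes sub: "\<And>m. body_set (X m) \<subseteq> cball 0 1"
  obtains K r where "strict_mono (r :: nat \<Rightarrow> nat)" "(X \<circ> r) \<longlonglongrightarrow> K"
proof -
  let ?B = "cball (0::'a) 1"
  define F where "F m x = infdist x (body_set (X m))" for m x
  have lip: "\<bar>F m x - F m y\<bar> \<le> dist x y" for m x y
    unfolding F_def by (rule infdist_triangle_abs)
  have bd: "norm (F m x) \<le> 2" if "x \<in> ?B" for m x
  proof -
    obtain a where a: "a \<in> body_set (X m)" using body_set_nonempty[of "X m"] by blast
    then have "F m x \<le> dist x a" unfolding F_def by (rule infdist_le)
    also have "\<dots> \<le> dist x 0 + dist 0 a" by (rule dist_triangle)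
    also have "\<dots> \<le> 2" using that a sub[of m] by (auto simp: subset_iff)
    finally show ?thesis using infdist_nonneg[of x] by (auto simp: F_def)
  qed
  have equi: "\<exists>d>0. \<forall>n y. y \<in> ?B \<and> norm (x - y) < d \<longrightarrow> norm (F n x - F n y) < e"
    if "x \<in> ?B" "0 < e" for x e
    using that by (intro exI[of _ e]) (auto simp: dist_norm[symmetric] intro: le_less_trans[OF lip])
  obtain g r where g: "continuous_on ?B g" and r: "strict_mono (r :: nat \<Rightarrow> nat)"
    and unif: "\<And>e. 0 < e \<Longrightarrow> \<exists>N. \<forall>n x. n \<ge> N \<and> x \<in> ?B \<longrightarrow> norm (F (r n) x - g x) < e"
    using Arzela_Ascoli[of ?B F 2, OF compact_cball bd equi] by blast
  have ptw: "(\<lambda>n. F (r n) x) \<longlonglongrightarrow> g x" if "x \<in> ?B" for x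
    unfolding LIMSEQ_iff using unif that by blast
  have g0: "0 \<le> g x" if "x \<in> ?B" for x
    by (rule LIMSEQ_le_const[OF ptw[OF that]]) (auto simp: F_def infdist_nonneg)
  define C where "C = {x \<in> ?B. g x = 0}"
  have "C = ?B \<inter> g -` {0}" by (auto simp: C_def)
  then have "closed C"
    using continuous_closed_preimage[OF g closed_cball, of "{0}"] by simp
  then have C: "compact C"
    using compact_Int_closed[OF compact_cball[of "0::'a" 1], of C]
    by (simp add: C_def Int_absorb1 inf.absorb2 subset_iff)
  have Cne: "C \<noteq> {}"
  proof (rule ccontr)
    assume "\<not> C \<noteq> {}"
    then have pos: "\<forall>x\<in>?B. 0 < g x" using g0 by (force simp: C_def)
    obtain x0 where x0: "x0 \<in> ?B" "\<forall>y\<in>?B. g x0 \<le> g y"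
      using continuous_attains_inf[OF compact_cball _ g] by fastforce
    obtain N where N: "\<forall>n x. n \<ge> N \<and> x \<in> ?B \<longrightarrow> norm (F (r n) x - g x) < g x0"
      using unif[of "g x0"] pos x0 by blast
    obtain a where a: "a \<in> body_set (X (r N))" using body_set_nonempty by blast
    then have "a \<in> ?B" "F (r N) a = 0" using sub[of "r N"] by (auto simp: F_def)
    with N x0 show False by force
  qed
  have Ccvx: "convex C"
  proof (rule convexI)
    fix x y u v assume xy: "x \<in> C" "y \<in> C" and uv: "0 \<le> u" "0 \<le> v" "u + v = (1::real)"
    let ?z = "u *\<^sub>R x + v *\<^sub>R y"
    have zB: "?z \<in> ?B" using xy uv convex_cball[of "0::'a" 1] by (auto simp: C_def convex_def simp del: mem_cball)
    have lim: "(\<lambda>n. u * F (r n) x + v * F (r n) y) \<longlonglongrightarrow> u * g x + v * g y"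
      using xy by (intro tendsto_intros ptw) (auto simp: C_def)
    have "g ?z \<le> u * g x + v * g y"
      by (rule LIMSEQ_le[OF ptw[OF zB] lim]) (auto simp: F_def infdist_convex_combination uv)
    then have "g ?z = 0" using g0[OF zB] xy by (simp add: C_def)
    with zB show "?z \<in> C" by (simp add: C_def)
  qed
  define K where "K = Convex_Body C"
  have K: "body_set K = C"
    unfolding K_def by (rule body_set_Convex_Body) fact+
  have "(X \<circ> r) \<longlonglongrightarrow> K"
    unfolding metric_LIMSEQ_I lim_sequentially
  proof (intro allI impI)
    fix e :: real assume e: "0 < e"
    obtain N1 where N1: "\<forall>n x. n \<ge> N1 \<and> x \<in> ?B \<longrightarrow> norm (F (r n) x - g x) < e/2"
      using unif[of "e/2"] e by auto
    define D where "D = {x \<in> ?B. infdist x C \<ge> e/2}"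
    have D_eq: "D = ?B \<inter> (\<lambda>x. infdist x C) -` {e/2..}" by (auto simp: D_def)
    have "closed D"
      unfolding D_eq by (rule continuous_closed_preimage) (auto intro: continuous_intros)
    then have D: "compact D"
      using compact_Int_closed[OF compact_cball[of "0::'a" 1], of D]
      by (simp add: D_def Int_absorb1 inf.absorb2 subset_iff)
    have Dpos: "0 < g x" if "x \<in> D" for x
    proof -
      have "x \<notin> C" using that e by (auto simp: D_def)
      then show ?thesis using that g0[of x] by (force simp: D_def C_def)
    qed
    have "\<exists>d>0. \<forall>x\<in>D. d \<le> g x"
    proof (cases "D = {}")
      case False
      have "continuous_on D g" by (rule continuous_on_subset[OF g]) (auto simp: D_def)
      then obtain x0 where "x0 \<in> D" "\<forall>y\<in>D. g x0 \<le> g y"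
        using continuous_attains_inf[OF D False] by blast
      then show ?thesis using Dpos by blast
    qed (auto intro: exI[of _ 1])
    then obtain d where d: "d > 0" "\<forall>x\<in>D. d \<le> g x" by blast
    obtain N2 where N2: "\<forall>n x. n \<ge> N2 \<and> x \<in> ?B \<longrightarrow> norm (F (r n) x - g x) < d"
      using unif[OF d(1)] by auto
    have "dist ((X \<circ> r) n) K < e" if n: "n \<ge> max N1 N2" for n
    proof -
      have "dist ((X \<circ> r) n) K \<le> e/2"
        unfolding dist_convex_body_le_iff K
      proof (intro conjI ballI)
        fix a assume a: "a \<in> body_set ((X \<circ> r) n)"
        then have aB: "a \<in> ?B" and Fa: "F (r n) a = 0" using sub[of "r n"] by (auto simp: F_def)
        show "infdist a C \<le> e/2"
        proof (rule ccontr)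
          assume "\<not> infdist a C \<le> e/2"
          then have "a \<in> D" using aB by (simp add: D_def)
          then have "d \<le> g a" using d by blast
          moreover have "norm (F (r n) a - g a) < d" using N2 n aB by auto
          ultimately show False using Fa by simp
        qed
      next
        fix b assume "b \<in> C"
        then have bB: "b \<in> ?B" "g b = 0" by (auto simp: C_def)
        moreover have "norm (F (r n) b - g b) < e/2" using N1 n bB(1) by (meson max.bounded_iff)
        ultimately have "F (r n) b \<le> e/2" by simp
        then show "infdist b (body_set ((X \<circ> r) n)) \<le> e/2" by (simp add: F_def)
      qed
      then show ?thesis using e by simp
    qed
    then show "\<exists>no. \<forall>n\<ge>no. dist ((X \<circ> r) n) K < e" by blast
  qed
  with r show thesis by (rule that)
qed


section \<open>The Banach space of continuous translation-invariant valuations\<close>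

text \<open>The relational form avoids junk values: if \<open>K\<close>, \<open>L\<close> and \<open>K \<union> L\<close> are convex bodies, then
  \<open>K \<inter> L\<close> is nonempty because \<open>K \<union> L\<close> is connected, so \<open>M\<close> determines \<open>N\<close>.\<close>

definition is_valuation :: "('a::euclidean_space convex_body \<Rightarrow> real) \<Rightarrow> bool" where
  "is_valuation \<phi> \<longleftrightarrow>
     (\<forall>K L M N. body_set M = body_set K \<union> body_set L \<longrightarrow> body_set N = body_set K \<inter> body_set L \<longrightarrow>
        \<phi> M + \<phi> N = \<phi> K + \<phi> L)"

lemma is_valuationI:
  assumes "\<And>K L M N. body_set M = body_set K \<union> body_set L \<Longrightarrow>
      body_set N = body_set K \<inter> body_set L \<Longrightarrow> \<phi> M + \<phi> N = \<phi> K + \<phi> L"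
  shows "is_valuation \<phi>"
  using assms unfolding is_valuation_def by blast

lemma is_valuationD:
  assumes "is_valuation \<phi>" "body_set M = body_set K \<union> body_set L"
    "body_set N = body_set K \<inter> body_set L"
  shows "\<phi> M + \<phi> N = \<phi> K + \<phi> L"
  using assms unfolding is_valuation_def by blast

definition translation_invariant :: "('a::euclidean_space convex_body \<Rightarrow> real) \<Rightarrow> bool" where
  "translation_invariant \<phi> \<longleftrightarrow> (\<forall>v K. \<phi> (body_image ((+) v) K) = \<phi> K)"

typedef (overloaded) ('a::euclidean_space) val =
    "{\<phi> :: 'a convex_body \<Rightarrow> real.
        is_valuation \<phi> \<and> translation_invariant \<phi> \<and> continuous_on UNIV \<phi>}"
  morphisms apply_val Val
  by (rule exI[of _ "\<lambda>_. 0"]) (auto simp: is_valuation_def translation_invariant_def)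

setup_lifting type_definition_val

lemma is_valuation_apply_val: "is_valuation (apply_val \<phi>)"
  and translation_invariant_apply_val: "translation_invariant (apply_val \<phi>)"
  and continuous_on_apply_val: "continuous_on S (apply_val \<phi>)"
  using apply_val[of \<phi>] by (auto intro: continuous_on_subset)

lemma val_eqI: "(\<And>K. apply_val \<phi> K = apply_val \<psi> K) \<Longrightarrow> \<phi> = \<psi>"
  by transfer auto

instantiation val :: (euclidean_space) real_vector
begin

lift_definition zero_val :: "'a val" is "\<lambda>_. 0"
  by (auto simp: is_valuation_def translation_invariant_def)

lift_definition plus_val :: "'a val \<Rightarrow> 'a val \<Rightarrow> 'a val" is "\<lambda>\<phi> \<psi> K. \<phi> K + \<psi> K"
proof (intro conjI)
  fix \<phi> \<psi> :: "'a convex_body \<Rightarrow> real"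
  assume a: "is_valuation \<phi> \<and> translation_invariant \<phi> \<and> continuous_on UNIV \<phi>"
    "is_valuation \<psi> \<and> translation_invariant \<psi> \<and> continuous_on UNIV \<psi>"
  show "is_valuation (\<lambda>K. \<phi> K + \<psi> K)"
  proof (rule is_valuationI)
    fix K L M N :: "'a convex_body"
    assume "body_set M = body_set K \<union> body_set L" "body_set N = body_set K \<inter> body_set L"
    from is_valuationD[OF _ this, of \<phi>] is_valuationD[OF _ this, of \<psi>]
    show "\<phi> M + \<psi> M + (\<phi> N + \<psi> N) = \<phi> K + \<psi> K + (\<phi> L + \<psi> L)"
      using a by simp
  qed
  show "translation_invariant (\<lambda>K. \<phi> K + \<psi> K)"
    using a by (simp add: translation_invariant_def)
  show "continuous_on UNIV (\<lambda>K. \<phi> K + \<psi> K)"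
    using a by (intro continuous_intros) auto
qed

lift_definition uminus_val :: "'a val \<Rightarrow> 'a val" is "\<lambda>\<phi> K. - \<phi> K"
proof (intro conjI)
  fix \<phi> :: "'a convex_body \<Rightarrow> real"
  assume a: "is_valuation \<phi> \<and> translation_invariant \<phi> \<and> continuous_on UNIV \<phi>"
  show "is_valuation (\<lambda>K. - \<phi> K)"
  proof (rule is_valuationI)
    fix K L M N :: "'a convex_body"
    assume "body_set M = body_set K \<union> body_set L" "body_set N = body_set K \<inter> body_set L"
    from is_valuationD[OF _ this, of \<phi>]
    show "- \<phi> M + - \<phi> N = - \<phi> K + - \<phi> L"
      using a by simp
  qed
  show "translation_invariant (\<lambda>K. - \<phi> K)"
    using a by (simp add: translation_invariant_def)
  show "continuous_on UNIV (\<lambda>K. - \<phi> K)"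
    using a by (intro continuous_intros) auto
qed

lift_definition minus_val :: "'a val \<Rightarrow> 'a val \<Rightarrow> 'a val" is "\<lambda>\<phi> \<psi> K. \<phi> K - \<psi> K"
proof (intro conjI)
  fix \<phi> \<psi> :: "'a convex_body \<Rightarrow> real"
  assume a: "is_valuation \<phi> \<and> translation_invariant \<phi> \<and> continuous_on UNIV \<phi>"
    "is_valuation \<psi> \<and> translation_invariant \<psi> \<and> continuous_on UNIV \<psi>"
  show "is_valuation (\<lambda>K. \<phi> K - \<psi> K)"
  proof (rule is_valuationI)
    fix K L M N :: "'a convex_body"
    assume "body_set M = body_set K \<union> body_set L" "body_set N = body_set K \<inter> body_set L"
    from is_valuationD[OF _ this, of \<phi>] is_valuationD[OF _ this, of \<psi>]
    show "\<phi> M - \<psi> M + (\<phi> N - \<psi> N) = \<phi> K - \<psi> K + (\<phi> L - \<psi> L)"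
      using a by simp
  qed
  show "translation_invariant (\<lambda>K. \<phi> K - \<psi> K)"
    using a by (simp add: translation_invariant_def)
  show "continuous_on UNIV (\<lambda>K. \<phi> K - \<psi> K)"
    using a by (intro continuous_intros) auto
qed

lift_definition scaleR_val :: "real \<Rightarrow> 'a val \<Rightarrow> 'a val" is "\<lambda>c \<phi> K. c * \<phi> K"
proof (intro conjI)
  fix \<phi> :: "'a convex_body \<Rightarrow> real" and c :: real
  assume a: "is_valuation \<phi> \<and> translation_invariant \<phi> \<and> continuous_on UNIV \<phi>"
  show "is_valuation (\<lambda>K. c * \<phi> K)"
  proof (rule is_valuationI)
    fix K L M N :: "'a convex_body"
    assume "body_set M = body_set K \<union> body_set L" "body_set N = body_set K \<inter> body_set L"
    from is_valuationD[OF _ this, of \<phi>] a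
    show "c * \<phi> M + c * \<phi> N = c * \<phi> K + c * \<phi> L"
      by (metis distrib_left)
  qed
  show "translation_invariant (\<lambda>K. c * \<phi> K)"
    using a by (simp add: translation_invariant_def)
  show "continuous_on UNIV (\<lambda>K. c * \<phi> K)"
    using a by (intro continuous_intros) auto
qed

instance
  by standard (transfer; simp add: fun_eq_iff algebra_simps)+

end

lemma apply_val_zero [simp]: "apply_val 0 K = 0"
  by transfer simp
lemma apply_val_add [simp]: "apply_val (\<phi> + \<psi>) K = apply_val \<phi> K + apply_val \<psi> K"
  by transfer simp
lemma apply_val_uminus [simp]: "apply_val (- \<phi>) K = - apply_val \<phi> K"
  by transfer simp
lemma apply_val_diff [simp]: "apply_val (\<phi> - \<psi>) K = apply_val \<phi> K - apply_val \<psi> K"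
  by transfer simp
lemma apply_val_scaleR [simp]: "apply_val (c *\<^sub>R \<phi>) K = c * apply_val \<phi> K"
  by transfer simp

abbreviation unit_ball_bodies :: "'a::euclidean_space convex_body set" where
  "unit_ball_bodies \<equiv> {K. body_set K \<subseteq> cball 0 1}"

lemma unit_ball_bodies_nonempty: "unit_ball_bodies \<noteq> {}"
proof -
  have "body_set (Convex_Body {0::'a}) = {0}" by (rule body_set_Convex_Body) auto
  then show ?thesis by (intro ex_in_conv[THEN iffD1] exI[of _ "Convex_Body {0}"]) simp
qed

lemma bdd_above_unit_ball_bodies:
  fixes \<phi> :: "'a::euclidean_space val"
  shows "bdd_above ((\<lambda>K. \<bar>apply_val \<phi> K\<bar>) ` unit_ball_bodies)"
proof (rule ccontr)
  assume "\<not> ?thesis"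
  then have "\<forall>m::nat. \<exists>K\<in>unit_ball_bodies. \<bar>apply_val \<phi> K\<bar> > real m"
    by (auto simp: bdd_above_def not_le) 
  then obtain X where X: "\<And>m. body_set (X m) \<subseteq> cball 0 1" "\<And>m::nat. \<bar>apply_val \<phi> (X m)\<bar> > real m"
    by (simp add: Bex_def) metis
  obtain K r where r: "strict_mono (r :: nat \<Rightarrow> nat)" and lim: "(X \<circ> r) \<longlonglongrightarrow> K"
    using Blaschke_selection[OF X(1)] .
  have "isCont (apply_val \<phi>) K"
    using continuous_on_apply_val[of UNIV \<phi>] by (simp add: continuous_on_eq_continuous_at)
  then have "(\<lambda>n. apply_val \<phi> ((X \<circ> r) n)) \<longlonglongrightarrow> apply_val \<phi> K"
    using lim by (rule isCont_tendsto_compose)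
  then have "Bseq (\<lambda>n. apply_val \<phi> ((X \<circ> r) n))"
    using convergentI convergent_imp_Bseq by blast
  then obtain c where c: "\<And>n. \<bar>apply_val \<phi> (X (r n))\<bar> \<le> c"
    by (auto simp: Bseq_def)
  obtain n :: nat where n: "c < real n" using reals_Archimedean2 by blast
  have "real n \<le> real (r n)" using seq_suble[OF r] by simp
  with X(2)[of "r n"] c[of n] n show False by linarith
qed

text \<open>Cutting a body by a hyperplane bounds a valuation on large boxes by its values on small ones;
  this makes the supremum over bodies in the unit ball a definite norm.\<close>

definition box_bound :: "('a::euclidean_space convex_body \<Rightarrow> real) \<Rightarrow> 'a \<Rightarrow> real \<Rightarrow> bool" where
  "box_bound \<phi> b c \<longleftrightarrow> (\<forall>a K. body_set K \<subseteq> cbox a (a + b) \<longrightarrow> \<bar>\<phi> K\<bar> \<le> c)"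

lemma box_bound_step:
  fixes \<phi> :: "'a::euclidean_space convex_body \<Rightarrow> real"
  assumes val: "is_valuation \<phi>" and bb: "box_bound \<phi> b c" and i: "i \<in> Basis"
    and b: "0 \<le> b \<bullet> i"
  shows "box_bound \<phi> (b + (b \<bullet> i) *\<^sub>R i) (3 * c)"
  unfolding box_bound_def
proof (intro allI impI)
  fix a K assume K: "body_set K \<subseteq> cbox a (a + (b + (b \<bullet> i) *\<^sub>R i))"
  define m where "m = a \<bullet> i + b \<bullet> i"
  define P where "P = body_set K \<inter> {x. i \<bullet> x \<le> m}"
  define Q where "Q = body_set K \<inter> {x. i \<bullet> x \<ge> m}"
  have PQ: "P \<union> Q = body_set K" by (auto simp: P_def Q_def)
  have coord: "a \<bullet> j \<le> x \<bullet> j \<and> x \<bullet> j \<le> a \<bullet> j + b \<bullet> j + (if j = i then b \<bullet> i else 0)"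
    if "x \<in> body_set K" "j \<in> Basis" for x j
    proof -
    have "x \<in> cbox a (a + (b + (b \<bullet> i) *\<^sub>R i))" using K that by blast
    then have "a \<bullet> j \<le> x \<bullet> j \<and> x \<bullet> j \<le> (a + (b + (b \<bullet> i) *\<^sub>R i)) \<bullet> j"
      using that(2) by (simp add: mem_box)
    then show ?thesis using i that(2) by (auto simp: inner_simps inner_Basis)
  qed
  have Psub: "P \<subseteq> cbox a (a + b)"
  proof
    fix x assume x: "x \<in> P"
    show "x \<in> cbox a (a + b)" unfolding mem_box
    proof (intro ballI)
      fix j :: 'a assume "j \<in> Basis"
      then show "a \<bullet> j \<le> x \<bullet> j \<and> x \<bullet> j \<le> (a + b) \<bullet> j"
        using coord[of x j] x by (auto simp: P_def m_def inner_simps inner_commute split: if_splits)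
    qed
  qed
  have Qsub: "Q \<subseteq> cbox (a + (b \<bullet> i) *\<^sub>R i) (a + (b \<bullet> i) *\<^sub>R i + b)"
  proof
    fix x assume x: "x \<in> Q"
    show "x \<in> cbox (a + (b \<bullet> i) *\<^sub>R i) (a + (b \<bullet> i) *\<^sub>R i + b)" unfolding mem_box
    proof (intro ballI)
      fix j :: 'a assume "j \<in> Basis"
      then show "(a + (b \<bullet> i) *\<^sub>R i) \<bullet> j \<le> x \<bullet> j \<and> x \<bullet> j \<le> (a + (b \<bullet> i) *\<^sub>R i + b) \<bullet> j"
        using coord[of x j] x i
        by (auto simp: Q_def m_def inner_simps inner_Basis inner_commute split: if_splits)
    qed
  qed
  have small: "\<bar>\<phi> L\<bar> \<le> c" if "body_set L \<subseteq> P \<or> body_set L \<subseteq> Q" for L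
    using that Psub Qsub bb unfolding box_bound_def by (meson order_trans)
  show "\<bar>\<phi> K\<bar> \<le> 3 * c"
  proof (cases "P = {} \<or> Q = {}")
    case True
    then have "\<bar>\<phi> K\<bar> \<le> c" using PQ by (intro small) auto
    then show ?thesis by linarith
  next
    case False
    have cv: "convex P" "convex Q" "compact P" "compact Q"
      unfolding P_def Q_def
      by (auto intro!: convex_Int convex_halfspace_le convex_halfspace_ge compact_Int_closed
          closed_halfspace_le closed_halfspace_ge)
    have "connected (body_set K)" by (simp add: convex_connected)
    then have ne: "P \<inter> Q \<noteq> {}"
      unfolding connected_closed using compact_imp_closed[OF cv(3)] compact_imp_closed[OF cv(4)]
        False PQ by blast
    have sets: "body_set (Convex_Body P) = P" "body_set (Convex_Body Q) = Q"
      "body_set (Convex_Body (P \<inter> Q)) = P \<inter> Q"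
      using cv False ne by (simp_all add: body_set_Convex_Body convex_Int compact_Int)
    have "\<phi> K + \<phi> (Convex_Body (P \<inter> Q)) = \<phi> (Convex_Body P) + \<phi> (Convex_Body Q)"
      by (rule is_valuationD[OF val]) (simp_all add: sets PQ)
    moreover have "\<bar>\<phi> (Convex_Body (P \<inter> Q))\<bar> \<le> c" "\<bar>\<phi> (Convex_Body P)\<bar> \<le> c"
      "\<bar>\<phi> (Convex_Body Q)\<bar> \<le> c"
      by (auto intro!: small simp: sets)
    ultimately show ?thesis by linarith
  qed
qed

lemma box_bound_double:
  fixes \<phi> :: "'a::euclidean_space convex_body \<Rightarrow> real"
  assumes val: "is_valuation \<phi>" and bb: "box_bound \<phi> b c" and b: "\<And>i. i \<in> Basis \<Longrightarrow> 0 \<le> b \<bullet> i"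
  shows "box_bound \<phi> (2 *\<^sub>R b) (3 ^ DIM('a) * c)"
proof -
  have "box_bound \<phi> (b + (\<Sum>i\<in>T. (b \<bullet> i) *\<^sub>R i)) (3 ^ card T * c)"
    if "finite T" "T \<subseteq> Basis" for T
    using that
  proof (induction T rule: finite_induct)
    case empty
    then show ?case using bb by simp
  next
    case (insert j T)
    let ?b = "b + (\<Sum>i\<in>T. (b \<bullet> i) *\<^sub>R i)"
    have "(\<Sum>i\<in>T. (b \<bullet> i) * (i \<bullet> j)) = 0"
      by (rule sum.neutral) (use insert in \<open>auto simp: inner_Basis subset_iff\<close>)
    then have bj: "?b \<bullet> j = b \<bullet> j" by (simp add: inner_add_left inner_sum_left)
    have "box_bound \<phi> (?b + (?b \<bullet> j) *\<^sub>R j) (3 * (3 ^ card T * c))"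
      using insert b[of j] bj by (intro box_bound_step val) auto
    then show ?case using insert bj by (simp add: algebra_simps)
  qed
  from this[OF finite_Basis order_refl] show ?thesis
    by (simp add: euclidean_representation scaleR_2)
qed

lemma box_bound_power:
  fixes \<phi> :: "'a::euclidean_space convex_body \<Rightarrow> real"
  assumes val: "is_valuation \<phi>" and bb: "box_bound \<phi> b c" and b: "\<And>i. i \<in> Basis \<Longrightarrow> 0 \<le> b \<bullet> i"
  shows "box_bound \<phi> (2 ^ m *\<^sub>R b) ((3 ^ DIM('a)) ^ m * c)"
proof (induction m)
  case 0
  then show ?case using bb by simp
next
  case (Suc m)
  have "box_bound \<phi> (2 *\<^sub>R (2 ^ m *\<^sub>R b)) (3 ^ DIM('a) * ((3 ^ DIM('a)) ^ m * c))"
    by (rule box_bound_double[OF val Suc]) (use b in auto)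
  then show ?case by (simp add: mult.assoc)
qed

definition val_norm :: "'a::euclidean_space val \<Rightarrow> real" where
  "val_norm \<phi> = (SUP K\<in>unit_ball_bodies. \<bar>apply_val \<phi> K\<bar>)"

lemma abs_apply_val_le_val_norm:
  "body_set K \<subseteq> cball 0 1 \<Longrightarrow> \<bar>apply_val \<phi> K\<bar> \<le> val_norm \<phi>"
  unfolding val_norm_def by (intro cSUP_upper bdd_above_unit_ball_bodies) simp

lemma val_norm_le:
  "(\<And>K. body_set K \<subseteq> cball 0 1 \<Longrightarrow> \<bar>apply_val \<phi> K\<bar> \<le> c) \<Longrightarrow> val_norm \<phi> \<le> c"
  unfolding val_norm_def by (intro cSUP_least unit_ball_bodies_nonempty) simp

lemma apply_val_bound_cball:
  "\<exists>C. \<forall>(\<phi> :: 'a::euclidean_space val) K. body_set K \<subseteq> cball 0 R \<longrightarrow> \<bar>apply_val \<phi> K\<bar> \<le> C * val_norm \<phi>"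
proof -
  define r where "r = 1 / real DIM('a)"
  have r: "r > 0" by (simp add: r_def)
  define b where "b = r *\<^sub>R (One :: 'a)"
  have bi: "b \<bullet> i = r" if "i \<in> Basis" for i using that by (simp add: b_def)
  have sub: "cbox 0 b \<subseteq> cball 0 1"
  proof
    fix x assume x: "x \<in> cbox 0 b"
    have "norm x \<le> (\<Sum>i\<in>Basis. \<bar>x \<bullet> i\<bar>)" by (rule norm_le_l1)
    also have "\<dots> \<le> (\<Sum>i\<in>(Basis::'a set). r)"
      using x bi by (intro sum_mono) (auto simp: mem_box)
    also have "\<dots> = 1" by (simp add: r_def)
    finally show "x \<in> cball 0 1" by simp
  qed
  have base: "box_bound (apply_val \<phi>) b (val_norm \<phi>)" for \<phi>
    unfolding box_bound_def
  proof (intro allI impI)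
    fix a K assume K: "body_set K \<subseteq> cbox a (a + b)"
    have "body_set (body_image ((+) (- a)) K) = (+) (- a) ` body_set K"
      by (rule body_set_body_image_translation)
    also have "\<dots> \<subseteq> cbox 0 b"
      using K by (auto simp: subset_iff mem_box inner_simps algebra_simps)
    also note sub
    finally have "\<bar>apply_val \<phi> (body_image ((+) (- a)) K)\<bar> \<le> val_norm \<phi>"
      by (rule abs_apply_val_le_val_norm)
    then show "\<bar>apply_val \<phi> K\<bar> \<le> val_norm \<phi>"
      using translation_invariant_apply_val[of \<phi>] by (simp add: translation_invariant_def)
  qed
  obtain m :: nat where "2 * R / r < 2 ^ m" using real_arch_pow[of 2 "2 * R / r"] by auto
  then have m: "2 * R \<le> 2 ^ m * r" using r by (simp add: field_simps)
  have "\<bar>apply_val \<phi> K\<bar> \<le> (3 ^ DIM('a)) ^ m * val_norm \<phi>" if K: "body_set K \<subseteq> cball 0 R" for \<phi> :: "'a val" and K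
  proof -
    have "box_bound (apply_val \<phi>) (2 ^ m *\<^sub>R b) ((3 ^ DIM('a)) ^ m * val_norm \<phi>)"
      by (rule box_bound_power[OF is_valuation_apply_val base]) (use bi r in auto)
    moreover have "body_set K \<subseteq> cbox (- R *\<^sub>R One) (- R *\<^sub>R One + 2 ^ m *\<^sub>R b)"
    proof
      fix x assume "x \<in> body_set K"
      then have x: "norm x \<le> R" using K by auto
      show "x \<in> cbox (- R *\<^sub>R One) (- R *\<^sub>R One + 2 ^ m *\<^sub>R b)"
        unfolding mem_box
      proof (intro ballI)
        fix i :: 'a assume i: "i \<in> Basis"
        have "\<bar>x \<bullet> i\<bar> \<le> R" using Basis_le_norm[OF i, of x] x by linarith
        then show "(- R *\<^sub>R One) \<bullet> i \<le> x \<bullet> i \<and> x \<bullet> i \<le> (- R *\<^sub>R One + 2 ^ m *\<^sub>R b) \<bullet> i"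
          using i bi[OF i] m by (auto simp: inner_add_left inner_diff_left abs_le_iff)
      qed
    qed
    ultimately show ?thesis unfolding box_bound_def by blast
  qed
  then show ?thesis by blast
qed

instantiation val :: (euclidean_space) real_normed_vector
begin

definition norm_val :: "'a val \<Rightarrow> real" where
  "norm_val \<phi> = (SUP K\<in>unit_ball_bodies. \<bar>apply_val \<phi> K\<bar>)"

definition dist_val :: "'a val \<Rightarrow> 'a val \<Rightarrow> real" where
  "dist_val \<phi> \<psi> = norm (\<phi> - \<psi>)"

definition sgn_val :: "'a val \<Rightarrow> 'a val" where
  "sgn_val \<phi> = \<phi> /\<^sub>R norm \<phi>"

definition uniformity_val :: "('a val \<times> 'a val) filter"
  where "uniformity_val = (INF e\<in>{0 <..}. principal {(x, y). dist x y < e})"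

definition open_val :: "'a val set \<Rightarrow> bool"
  where "open_val S = (\<forall>x\<in>S. \<forall>\<^sub>F (x', y) in uniformity. x' = x \<longrightarrow> y \<in> S)"

lemma norm_val_eq: "norm (\<phi> :: 'a val) = val_norm \<phi>"
  by (simp add: norm_val_def val_norm_def)

instance
proof
  fix \<phi> \<psi> :: "'a val" and c :: real
  show "norm \<phi> = 0 \<longleftrightarrow> \<phi> = 0"
  proof
    assume n0: "norm \<phi> = 0"
    show "\<phi> = 0"
    proof (rule val_eqI)
      fix K :: "'a convex_body"
      obtain R where "body_set K \<subseteq> cball 0 R"
        using body_set_subset_cball by blast
      moreover obtain C where "\<And>(\<phi> :: 'a val) K. body_set K \<subseteq> cball 0 R \<Longrightarrow> \<bar>apply_val \<phi> K\<bar> \<le> C * val_norm \<phi>"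
        using apply_val_bound_cball[where 'a='a, of R] by blast
      ultimately have "\<bar>apply_val \<phi> K\<bar> \<le> C * val_norm \<phi>" by blast
      then show "apply_val \<phi> K = apply_val 0 K" using n0 by (simp add: norm_val_eq)
    qed
  next
    assume "\<phi> = 0"
    then show "norm \<phi> = 0"
      using unit_ball_bodies_nonempty[where 'a='a] by (simp add: norm_val_def)
  qed
  show "norm (\<phi> + \<psi>) \<le> norm \<phi> + norm \<psi>"
    unfolding norm_val_eq
  proof (rule val_norm_le)
    fix K :: "'a convex_body" assume "body_set K \<subseteq> cball 0 1"
    then show "\<bar>apply_val (\<phi> + \<psi>) K\<bar> \<le> val_norm \<phi> + val_norm \<psi>"
      using abs_apply_val_le_val_norm[of K \<phi>] abs_apply_val_le_val_norm[of K \<psi>] by simp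
  qed
  have scale: "val_norm (c *\<^sub>R \<phi>) \<le> \<bar>c\<bar> * val_norm \<phi>" for c and \<phi> :: "'a val"
    by (rule val_norm_le) (simp add: abs_mult abs_apply_val_le_val_norm mult_left_mono)
  show "norm (c *\<^sub>R \<phi>) = \<bar>c\<bar> * norm \<phi>"
    unfolding norm_val_eq
  proof (rule antisym[OF scale])
    show "\<bar>c\<bar> * val_norm \<phi> \<le> val_norm (c *\<^sub>R \<phi>)"
    proof (cases "c = 0")
      case True
      then show ?thesis
        using unit_ball_bodies_nonempty[where 'a='a] by (simp add: val_norm_def)
    next
      case False
      then show ?thesis
        using scale[of "inverse c" "c *\<^sub>R \<phi>"] by (simp add: field_simps abs_inverse)
    qed
  qed
qed (rule dist_val_def sgn_val_def open_val_def uniformity_val_def)+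

end

instance val :: (euclidean_space) banach
proof
  fix X :: "nat \<Rightarrow> 'a val" assume X: "Cauchy X"
  define L where "L K = lim (\<lambda>n. apply_val (X n) K)" for K
  have unif: "\<exists>N. \<forall>m\<ge>N. \<forall>n\<ge>N. \<forall>K. body_set K \<subseteq> cball 0 R \<longrightarrow> \<bar>apply_val (X m) K - apply_val (X n) K\<bar> < e"
    if e: "e > 0" for R e
  proof -
    obtain C where C: "\<And>(\<phi>::'a val) K. body_set K \<subseteq> cball 0 R \<Longrightarrow> \<bar>apply_val \<phi> K\<bar> \<le> C * norm \<phi>"
      using apply_val_bound_cball[where 'a='a, of R] by (auto simp: norm_val_eq)
    define D where "D = max C 1"
    have D: "D > 0" by (simp add: D_def)
    obtain N where N: "\<And>m n. m \<ge> N \<Longrightarrow> n \<ge> N \<Longrightarrow> norm (X m - X n) < e / D"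
      using CauchyD[OF X, of "e / D"] e D by auto
    have "\<bar>apply_val (X m) K - apply_val (X n) K\<bar> < e"
      if "m \<ge> N" "n \<ge> N" "body_set K \<subseteq> cball 0 R" for m n K
    proof -
      have "\<bar>apply_val (X m) K - apply_val (X n) K\<bar> \<le> C * norm (X m - X n)"
        using C[OF that(3), of "X m - X n"] by simp
      also have "\<dots> \<le> D * norm (X m - X n)"
        by (intro mult_right_mono) (auto simp: D_def)
      also have "\<dots> < D * (e / D)"
        using N[OF that(1,2)] D by (intro mult_strict_left_mono)
      finally show ?thesis using D by simp
    qed
    then show ?thesis by blast
  qed
  have ptw: "(\<lambda>n. apply_val (X n) K) \<longlonglongrightarrow> L K" for K
  proof -
    obtain R where R: "body_set K \<subseteq> cball 0 R"
      using body_set_subset_cball by blast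
    have "Cauchy (\<lambda>n. apply_val (X n) K)"
      by (rule CauchyI) (use unif[of _ R] R in \<open>force\<close>)
    then show ?thesis
      unfolding L_def by (simp add: Cauchy_convergent convergent_LIMSEQ_iff[symmetric])
  qed
  have close: "\<exists>N. \<forall>n\<ge>N. \<forall>K. body_set K \<subseteq> cball 0 R \<longrightarrow> \<bar>apply_val (X n) K - L K\<bar> \<le> e"
    if e: "e > 0" for R e
  proof -
    obtain N where N: "\<And>m n K. m \<ge> N \<Longrightarrow> n \<ge> N \<Longrightarrow> body_set K \<subseteq> cball 0 R \<Longrightarrow>
        \<bar>apply_val (X m) K - apply_val (X n) K\<bar> < e"
      using unif[OF e] by metis
    have "\<bar>apply_val (X n) K - L K\<bar> \<le> e" if "n \<ge> N" "body_set K \<subseteq> cball 0 R" for n K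
    proof (rule LIMSEQ_le_const2)
      show "(\<lambda>m. \<bar>apply_val (X n) K - apply_val (X m) K\<bar>) \<longlonglongrightarrow> \<bar>apply_val (X n) K - L K\<bar>"
        by (intro tendsto_intros ptw)
      show "\<exists>M. \<forall>m\<ge>M. \<bar>apply_val (X n) K - apply_val (X m) K\<bar> \<le> e"
        using N that by (intro exI[of _ N]) (auto intro: less_imp_le)
    qed
    then show ?thesis by blast
  qed
  have val: "is_valuation L"
    unfolding is_valuation_def
  proof (intro allI impI)
    fix A B M N :: "'a convex_body"
    assume *: "body_set M = body_set A \<union> body_set B" "body_set N = body_set A \<inter> body_set B"
    have "apply_val (X n) M + apply_val (X n) N = apply_val (X n) A + apply_val (X n) B" for n
      using is_valuation_apply_val[of "X n"] * unfolding is_valuation_def by blast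
    then have "(\<lambda>n. apply_val (X n) A + apply_val (X n) B) \<longlonglongrightarrow> L M + L N"
      using tendsto_add[OF ptw[of M] ptw[of N]] by simp
    then show "L M + L N = L A + L B"
      using tendsto_add[OF ptw[of A] ptw[of B]] LIMSEQ_unique by blast
  qed
  have tr: "translation_invariant L"
    using translation_invariant_apply_val[of "X _"]
    by (simp add: translation_invariant_def L_def)
  have cont: "continuous_on UNIV L"
    unfolding continuous_on_iff
  proof (intro ballI allI impI)
    fix K :: "'a convex_body" and e :: real assume e: "e > 0"
    obtain R where R: "body_set K \<subseteq> cball 0 R"
      using body_set_subset_cball by blast
    have near: "body_set A \<subseteq> cball 0 (R + 1)" if "dist A K < 1" for A
    proof
      fix a assume a: "a \<in> body_set A"
      obtain b where b: "b \<in> body_set K" "infdist a (body_set K) = dist a b"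
        using infdist_attains_inf[of "body_set K" a] by auto
      have "dist a b \<le> 1" using infdist_le_dist_convex_body(1)[OF a, of K] b that by simp
      moreover have "norm b \<le> R" using R b by auto
      ultimately show "a \<in> cball 0 (R + 1)"
        using norm_triangle_sub[of a b] by (simp add: dist_norm)
    qed
    obtain N where N: "\<And>A. body_set A \<subseteq> cball 0 (R + 1) \<Longrightarrow> \<bar>apply_val (X N) A - L A\<bar> \<le> e/4"
      using close[of "e/4" "R + 1"] e by fastforce
    obtain d where d: "d > 0" "\<And>A. dist A K < d \<Longrightarrow> dist (apply_val (X N) A) (apply_val (X N) K) < e/4"
      using continuous_on_apply_val[of UNIV "X N"] e unfolding continuous_on_iff
      by (metis UNIV_I zero_less_divide_iff zero_less_numeral)
    have "dist (L A) (L K) < e" if "dist A K < min d 1" for A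
      proof -
      have "\<bar>apply_val (X N) A - L A\<bar> \<le> e/4" "\<bar>apply_val (X N) K - L K\<bar> \<le> e/4"
        using that N[OF near[of A]] N[OF near[of K]] by simp_all
      moreover have "\<bar>apply_val (X N) A - apply_val (X N) K\<bar> < e/4"
        using d(2)[of A] that by (simp add: dist_real_def)
      ultimately show ?thesis using e unfolding dist_real_def by arith
    qed
    then show "\<exists>d>0. \<forall>A\<in>UNIV. dist A K < d \<longrightarrow> dist (L A) (L K) < e"
      using d by (intro exI[of _ "min d 1"]) auto
  qed
  define l where "l = Val L"
  have l: "apply_val l K = L K" for K
    using val tr cont by (simp add: l_def Val_inverse)
  have "X \<longlonglongrightarrow> l"
    unfolding LIMSEQ_iff
  proof (intro allI impI)
    fix e :: real assume e: "e > 0"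
    obtain N where N: "\<And>n K. n \<ge> N \<Longrightarrow> body_set K \<subseteq> cball 0 1 \<Longrightarrow> \<bar>apply_val (X n) K - L K\<bar> \<le> e/2"
      using close[of "e/2" 1] e by fastforce
    have "norm (X n - l) \<le> e/2" if "n \<ge> N" for n
      unfolding norm_val_eq by (rule val_norm_le) (use N that l in auto)
    then show "\<exists>N. \<forall>n\<ge>N. norm (X n - l) < e"
      using e by (intro exI[of _ N]) force
  qed
  then show "convergent X" by (rule convergentI)
qed


section \<open>The general linear group action and smooth vectors\<close>

lemma infdist_linear_image_le:
  fixes f :: "'a::euclidean_space \<Rightarrow> 'a"
  assumes f: "linear f" and B: "closed B" "B \<noteq> {}"
  shows "infdist (f a) (f ` B) \<le> onorm f * infdist a B"
proof -
  obtain b where b: "b \<in> B" "infdist a B = dist a b" using infdist_attains_inf[OF B] by blast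
  have "infdist (f a) (f ` B) \<le> dist (f a) (f b)" using b by (intro infdist_le) auto
  also have "\<dots> = norm (f (a - b))" by (simp add: dist_norm linear_diff[OF f])
  also have "\<dots> \<le> onorm f * norm (a - b)"
    by (rule onorm) (use f in \<open>simp add: linear_conv_bounded_linear\<close>)
  finally show ?thesis using b by (simp add: dist_norm)
qed

lemma continuous_on_body_image:
  fixes f :: "'a::euclidean_space \<Rightarrow> 'a"
  assumes f: "linear f"
  shows "continuous_on UNIV (body_image f)"
proof -
  have o: "0 \<le> onorm f" using f by (simp add: linear_conv_bounded_linear onorm_pos_le)
  have "dist (body_image f K) (body_image f L) \<le> onorm f * dist K L" for K L
  proof -
    have "infdist (f a) (f ` body_set M) \<le> onorm f * dist K L"
      if "infdist a (body_set M) \<le> dist K L" for a M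
      using infdist_linear_image_le[OF f closed_body_set body_set_nonempty, of a M]
        mult_left_mono[OF that o] by linarith
    then show ?thesis
      unfolding dist_convex_body_le_iff body_set_body_image_linear[OF f]
      using infdist_le_dist_convex_body by blast
  qed
  then have "(onorm f)-lipschitz_on UNIV (body_image f)"
    using o by (intro lipschitz_onI) auto
  then show ?thesis by (rule lipschitz_on_continuous_on)
qed

lemma linear_image_Int_of_convex_Un:
  fixes f :: "'a::euclidean_space \<Rightarrow> 'a"
  assumes f: "linear f" and A: "closed A" and B: "closed B" and AB: "convex (A \<union> B)"
  shows "f ` (A \<inter> B) = f ` A \<inter> f ` B"
proof
  show "f ` A \<inter> f ` B \<subseteq> f ` (A \<inter> B)"
  proof
    fix y assume "y \<in> f ` A \<inter> f ` B"
    then obtain a b where ab: "a \<in> A" "b \<in> B" "f a = y" "f b = y" by (auto simp: image_iff)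
    have seg: "closed_segment a b \<subseteq> A \<union> B"
      using AB ab by (simp add: closed_segment_subset)
    have "A \<inter> B \<inter> closed_segment a b \<noteq> {}"
      using connected_segment(1)[of a b] seg A B ab unfolding connected_closed by blast
    then obtain c where c: "c \<in> A \<inter> B" "c \<in> closed_segment a b" by blast
    then obtain u where "c = (1 - u) *\<^sub>R a + u *\<^sub>R b" by (auto simp: in_segment)
    then have "f c = (1 - u) *\<^sub>R y + u *\<^sub>R y"
      using ab by (simp add: linear_add[OF f] linear_scale[OF f])
    then have "f c = y" by (simp add: scaleR_left_distrib[symmetric])
    then show "y \<in> f ` (A \<inter> B)" using c by blast
  qed
qed blast

lift_definition val_pullback :: "real^'n^'n \<Rightarrow> (real^'n) val \<Rightarrow> (real^'n) val"
  is "\<lambda>A \<phi> K. \<phi> (body_image ((*v) A) K)"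
proof (intro conjI)
  fix A :: "real^'n^'n" and \<phi> :: "(real^'n) convex_body \<Rightarrow> real"
  assume a: "is_valuation \<phi> \<and> translation_invariant \<phi> \<and> continuous_on UNIV \<phi>"
  have lin: "linear ((*v) A)" by simp
  note bs = body_set_body_image_linear[OF lin]
  show "is_valuation (\<lambda>K. \<phi> (body_image ((*v) A) K))"
    unfolding is_valuation_def
  proof (intro allI impI)
    fix K L M N :: "(real^'n) convex_body"
    assume M: "body_set M = body_set K \<union> body_set L" and N: "body_set N = body_set K \<inter> body_set L"
    have "convex (body_set K \<union> body_set L)" using convex_body_set[of M] M by simp
    then have "(*v) A ` (body_set K \<inter> body_set L) = (*v) A ` body_set K \<inter> (*v) A ` body_set L"
      by (intro linear_image_Int_of_convex_Un lin) auto
    then show "\<phi> (body_image ((*v) A) M) + \<phi> (body_image ((*v) A) N)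
        = \<phi> (body_image ((*v) A) K) + \<phi> (body_image ((*v) A) L)"
      using a M N unfolding is_valuation_def by (auto simp: bs image_Un)
  qed
  have "body_image ((*v) A) (body_image ((+) v) K) = body_image ((+) (A *v v)) (body_image ((*v) A) K)" for v K
    unfolding body_set_inject[symmetric]
    by (simp add: bs body_set_body_image_translation image_image matrix_vector_right_distrib)
  then show "translation_invariant (\<lambda>K. \<phi> (body_image ((*v) A) K))"
    using a by (simp add: translation_invariant_def)
  show "continuous_on UNIV (\<lambda>K. \<phi> (body_image ((*v) A) K))"
    using continuous_on_compose2[of UNIV \<phi> UNIV "body_image ((*v) A)"] a
      continuous_on_body_image[OF lin] by auto
qed

text \<open>Pullback is defined along all matrices; the action \<open>(g \<cdot> \<phi>)(K) = \<phi>(g\<inverse> K)\<close> is only used for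
  \<open>g\<close> in the open set \<open>GL\<close>.\<close>

definition GL :: "(real^'n^'n) set" where
  "GL = {g. invertible g}"

definition gl_act :: "real^'n^'n \<Rightarrow> (real^'n) val \<Rightarrow> (real^'n) val" where
  "gl_act g \<phi> = val_pullback (matrix_inv g) \<phi>"

lemma apply_val_gl_act:
  "apply_val (gl_act g \<phi>) K = apply_val \<phi> (body_image ((*v) (matrix_inv g)) K)"
  unfolding gl_act_def by transfer simp

text \<open>\<open>f\<close> is \<open>C\<^sup>\<infinity>\<close> on the open set \<open>S\<close> of a finite-dimensional space when all iterated directional
  derivatives exist as Frechet derivatives; differentiability at each order already gives
  continuity of the derivatives of the preceding orders.\<close>

primrec times_differentiable_on ::
    "nat \<Rightarrow> 'a::euclidean_space set \<Rightarrow> ('a \<Rightarrow> 'b::real_normed_vector) \<Rightarrow> bool" where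
  "times_differentiable_on 0 S f \<longleftrightarrow> continuous_on S f"
| "times_differentiable_on (Suc m) S f \<longleftrightarrow>
     (\<forall>x\<in>S. f differentiable (at x)) \<and>
     (\<forall>v. times_differentiable_on m S (\<lambda>x. frechet_derivative f (at x) v))"

definition smooth_on :: "'a::euclidean_space set \<Rightarrow> ('a \<Rightarrow> 'b::real_normed_vector) \<Rightarrow> bool" where
  "smooth_on S f \<longleftrightarrow> (\<forall>m. times_differentiable_on m S f)"

definition Val_smooth :: "(real^'n) val set" where
  "Val_smooth = {\<phi>. smooth_on GL (\<lambda>g. gl_act g \<phi>)}"

definition homogeneous :: "nat \<Rightarrow> 'a::euclidean_space val \<Rightarrow> bool" where
  "homogeneous k \<phi> \<longleftrightarrow>
     (\<forall>t>0. \<forall>K. apply_val \<phi> (body_image ((*\<^sub>R) t) K) = t ^ k * apply_val \<phi> K)"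

definition even_val :: "'a::euclidean_space val \<Rightarrow> bool" where
  "even_val \<phi> \<longleftrightarrow> (\<forall>K. apply_val \<phi> (body_image uminus K) = apply_val \<phi> K)"

definition Val_even_smooth :: "nat \<Rightarrow> (real^'n) val set" where
  "Val_even_smooth k = {\<phi> \<in> Val_smooth. homogeneous k \<phi> \<and> even_val \<phi>}"


section \<open>Grassmannians and densities\<close>

definition Gr :: "nat \<Rightarrow> 'a::euclidean_space set set" where
  "Gr k = {E. subspace E \<and> dim E = k}"

definition orthonormal_basis_of :: "'a::euclidean_space set \<Rightarrow> 'a set \<Rightarrow> bool" where
  "orthonormal_basis_of E B \<longleftrightarrow>
     pairwise orthogonal B \<and> (\<forall>b\<in>B. norm b = 1) \<and> span B = E"

lemma orthonormal_basis_of_exists: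
  assumes "subspace E"
  shows "orthonormal_basis_of E (SOME B. orthonormal_basis_of E B)"
proof (rule someI_ex)
  show "\<exists>B. orthonormal_basis_of E B"
    unfolding orthonormal_basis_of_def by (rule orthonormal_basis_subspace[OF assms]) blast
qed

text \<open>Same construction as \<^const>\<open>lborel\<close>, with \<^const>\<open>Basis\<close> replaced by an orthonormal basis of
  \<open>E\<close>; by rotation invariance of Lebesgue measure the choice of the basis is immaterial.\<close>

definition lborel_subspace :: "'a::euclidean_space set \<Rightarrow> 'a measure" where
  "lborel_subspace E =
     (let B = (SOME B. orthonormal_basis_of E B)
      in distr (\<Pi>\<^sub>M b\<in>B. lborel) borel (\<lambda>x. \<Sum>b\<in>B. x b *\<^sub>R b))"

text \<open>Densities may be negative, so they are represented by real-valued set functions. The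
  \<^const>\<open>measure\<close> of a set of infinite Lebesgue measure is \<open>0\<close>; densities are only evaluated on
  convex bodies.\<close>

definition Dens :: "'a::euclidean_space set \<Rightarrow> ('a set \<Rightarrow> real) set" where
  "Dens E = {\<mu>. \<exists>c. \<mu> = (\<lambda>A. c * measure (lborel_subspace E) A)}"

text \<open>\<open>\<phi>|\<^sub>E = \<mu>\<close>, as functions of the convex bodies contained in \<open>E\<close>.\<close>

definition restricts_to :: "'a::euclidean_space val \<Rightarrow> 'a set \<Rightarrow> ('a set \<Rightarrow> real) \<Rightarrow> bool" where
  "restricts_to \<phi> E \<mu> \<longleftrightarrow> (\<forall>K. body_set K \<subseteq> E \<longrightarrow> apply_val \<phi> K = \<mu> (body_set K))"

end

theory Submission
  imports Defs
begin

text \<open>For a linear map \<open>T\<close> to \<open>\<real>\<^sup>k\<close>, the functional \<open>\<phi>\<^sub>T(K) = vol\<^sub>k(T K)\<close> is an even \<open>k\<close>-homogeneous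
  continuous valuation, and on a \<open>k\<close>-dimensional subspace \<open>E\<close> it restricts to \<open>\<bar>det (T|\<^sub>E)\<bar> vol\<^sub>E\<close>.
  For a smooth compactly supported weight \<open>w\<close> the average \<open>\<phi> = \<integral> w(T) \<phi>\<^sub>T dT\<close> is a smooth vector, because
  \<open>g \<cdot> \<phi>\<^sub>T = \<phi>\<^bsub>T g\<inverse>\<^esub>\<close>, so that a linear change of variables gives \<open>g \<cdot> \<phi> = \<integral> c(g) w(T g) \<phi>\<^sub>T dT\<close> with
  a smooth Jacobian \<open>c\<close>, and one can differentiate under the integral.

  The possible restrictions to \<open>E\<^sub>1, \<dots>, E\<^sub>N\<close> form a linear space, so it suffices that no nontrivial
  combination \<open>\<Sum> a\<^sub>i \<bar>det (T|\<^bsub>E\<^sub>i\<^esub>)\<bar>\<close> vanishes for all \<open>T\<close>. Pick \<open>v \<in> E\<^sub>1\<close> outside the other subspaces, and a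
  generic \<open>T\<close> with \<open>T v = 0\<close>. On a suitable line through \<open>T\<close> the first determinant has a simple
  zero at \<open>T\<close> while the others do not vanish there; hence \<open>a\<^sub>1 \<bar>s\<bar>\<close> is differentiable at \<open>s = 0\<close>, and
  \<open>a\<^sub>1 = 0\<close>.\<close>


section \<open>Continuity of the volume\<close>

lemma near_point_in_body:
  fixes L :: "'a::euclidean_space convex_body"
  assumes "x \<in> body_set K"
  obtains y where "y \<in> body_set L" "dist x y \<le> dist K L"
proof -
  obtain y where "y \<in> body_set L" "infdist x (body_set L) = dist x y"
    using infdist_attains_inf[of "body_set L" x] by auto
  with infdist_le_dist_convex_body(1)[OF assms, of L] that show thesis by auto
qed

lemma dist_convex_body_leI:
  fixes K L :: "'a::euclidean_space convex_body"
  assumes "\<And>x. x \<in> body_set K \<Longrightarrow> \<exists>y\<in>body_set L. dist x y \<le> e"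
    and "\<And>y. y \<in> body_set L \<Longrightarrow> \<exists>x\<in>body_set K. dist y x \<le> e"
  shows "dist K L \<le> e"
  unfolding dist_convex_body_le_iff
  using assms by (meson infdist_le order_trans)

lemma lmeasurable_body_set [simp]: "body_set K \<in> lmeasurable"
  by (simp add: lmeasurable_compact)

text \<open>If \<open>x\<close> lay outside \<open>L\<close>, a hyperplane would strictly separate
  it from \<open>L\<close>. Moving from \<open>x\<close> away from that hyperplane by less than
  \<open>e\<close> stays in \<open>K\<close>, but can get farther than \<open>dist K L\<close> from
  every point of \<open>L\<close>.\<close>

lemma centre_mem_near_body:
  fixes K L :: "'a::euclidean_space convex_body"
  assumes ball: "ball x e \<subseteq> body_set K" and d: "dist K L < e"
  shows "x \<in> body_set L"
proof (rule ccontr)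
  assume "x \<notin> body_set L"
  then obtain a b where ab: "a \<bullet> x < b" "\<And>y. y \<in> body_set L \<Longrightarrow> b < a \<bullet> y"
    using separating_hyperplane_closed_point[of "body_set L" x] by auto
  have a0: "a \<noteq> 0"
    using ab body_set_nonempty[of L] by fastforce
  \<comment> \<open>Strictly between the two numbers: below \<open>e\<close> so that
    \<open>z\<close> stays in the ball, above \<open>dist K L\<close> for the contradiction.\<close>
  define t where "t = (dist K L + e) / 2"
  have t: "0 \<le> t" "t < e" "dist K L < t"
    using d zero_le_dist[of K L] by (auto simp: t_def simp del: zero_le_dist)
  define z where "z = x - (t / norm a) *\<^sub>R a"
  have "z \<in> body_set K"
    using ball t a0 by (auto simp: z_def dist_norm subset_iff)
  then obtain y where y: "y \<in> body_set L" "dist z y \<le> dist K L"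
    by (rule near_point_in_body)
  have "a \<bullet> y - a \<bullet> z \<le> norm a * dist z y"
    using Cauchy_Schwarz_ineq2[of a "y - z"] by (simp add: inner_diff_right dist_norm norm_minus_commute)
  also have "\<dots> \<le> norm a * dist K L"
    using y by (intro mult_left_mono) auto
  also have "a \<bullet> z = a \<bullet> x - t * norm a"
    using a0 by (simp add: z_def inner_diff_right power2_norm_eq_inner[symmetric] power2_eq_square)
  finally have "a \<bullet> y - a \<bullet> x \<le> norm a * dist K L - t * norm a"
    by simp
  also have "\<dots> < 0"
    using t a0 by (simp add: algebra_simps)
  finally show False
    using ab(1) ab(2)[OF y(1)] by simp
qed

text \<open>Along a convergent sequence the indicators converge off the frontier of the limit, which
  is a null set by convexity, and all the bodies lie in one ball; dominated convergence does the
  rest.\<close>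

lemma continuous_on_measure_body:
  "continuous_on UNIV (\<lambda>K :: 'a::euclidean_space convex_body. measure lebesgue (body_set K))"
  unfolding continuous_on_sequentially
proof (intro allI ballI impI, elim conjE)
  fix X :: "nat \<Rightarrow> 'a convex_body" and K assume X: "X \<longlonglongrightarrow> K"
  obtain D where D: "\<And>n. dist (X n) K \<le> D"
    using convergent_imp_bounded[OF X] by (auto simp: bounded_any_center[of _ K] dist_commute)
  obtain R where R: "body_set K \<subseteq> cball 0 R"
    using body_set_subset_cball by blast
  have sub: "body_set (X n) \<subseteq> cball 0 (R + D)" for n
  proof
    fix x assume "x \<in> body_set (X n)"
    then obtain y where "y \<in> body_set K" "dist x y \<le> dist (X n) K"
      by (rule near_point_in_body)
    then show "x \<in> cball 0 (R + D)"
      using D[of n] R norm_triangle_sub[of x y] by (fastforce simp: dist_norm)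
  qed
  have ptw: "(\<lambda>n. indicat_real (body_set (X n)) x) \<longlonglongrightarrow> indicat_real (body_set K) x"
    if x: "x \<notin> frontier (body_set K)" for x
  proof (rule tendsto_eventually, cases "x \<in> body_set K")
    case True
    then have "x \<in> interior (body_set K)"
      using x by (simp add: frontier_def)
    then obtain e where e: "e > 0" "ball x e \<subseteq> body_set K"
      by (auto simp: mem_interior)
    have "eventually (\<lambda>n. dist K (X n) < e) sequentially"
      using tendstoD[OF X e(1)] by (simp add: dist_commute)
    then show "eventually (\<lambda>n. indicat_real (body_set (X n)) x = indicat_real (body_set K) x) sequentially"
      by eventually_elim (use True centre_mem_near_body[OF e(2)] in auto)
  next
    case False
    then have pos: "infdist x (body_set K) > 0"
      using in_closed_iff_infdist_zero[OF closed_body_set body_set_nonempty] infdist_nonneg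
      by (metis order_less_le)
    show "eventually (\<lambda>n. indicat_real (body_set (X n)) x = indicat_real (body_set K) x) sequentially"
      using tendstoD[OF X pos]
    proof eventually_elim
      case (elim n)
      then have "x \<notin> body_set (X n)"
        using infdist_le_dist_convex_body(1)[of x "X n" K] by auto
      with False show ?case by simp
    qed
  qed
  have "(\<lambda>n. LINT x|lebesgue. indicat_real (body_set (X n)) x) \<longlonglongrightarrow> (LINT x|lebesgue. indicat_real (body_set K) x)"
  proof (rule integral_dominated_convergence[where w = "indicator (cball 0 (R + D))"])
    show "AE x in lebesgue. (\<lambda>n. indicat_real (body_set (X n)) x) \<longlonglongrightarrow> indicat_real (body_set K) x"
      by (rule AE_I'[of "frontier (body_set K)"])
        (use ptw negligible_convex_frontier[of "body_set K"] in \<open>auto simp: negligible_iff_null_sets\<close>)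
    show "AE x in lebesgue. norm (indicat_real (body_set (X n)) x) \<le> indicator (cball 0 (R + D)) x" for n
      using sub[of n] by (intro AE_I2) (auto simp: indicator_def)
    show "integrable lebesgue (indicat_real (cball 0 (R + D) :: 'a set))"
      using lmeasurable_compact[of "cball (0::'a) (R + D)"] by (auto simp: fmeasurable_def)
  qed (auto intro!: borel_measurable_indicator)
  then show "((\<lambda>K. measure lebesgue (body_set K)) \<circ> X) \<longlonglongrightarrow> measure lebesgue (body_set K)"
    by (simp add: o_def)
qed


section \<open>Volumes of linear images\<close>

lemma norm_matrix_vector_mult_le:
  fixes A :: "real^'n^'m"
  shows "norm (A *v x) \<le> real CARD('m) * norm A * norm x"
proof -
  have "norm (A *v x) \<le> (\<Sum>i\<in>UNIV. \<bar>(A *v x) $ i\<bar>)"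
    by (rule norm_le_l1_cart)
  also have "\<dots> \<le> (\<Sum>i\<in>(UNIV::'m set). norm A * norm x)"
  proof (rule sum_mono)
    fix i
    have "\<bar>(A *v x) $ i\<bar> \<le> norm (A $ i) * norm x"
      by (simp add: matrix_vector_mul_component Cauchy_Schwarz_ineq2)
    also have "\<dots> \<le> norm A * norm x"
      by (intro mult_right_mono Finite_Cartesian_Product.norm_nth_le) auto
    finally show "\<bar>(A *v x) $ i\<bar> \<le> norm A * norm x" .
  qed
  finally show ?thesis by simp
qed

text \<open>As \<open>k\<close> is not a type, \<open>\<real>\<^sup>k\<close> is the space of coordinates in \<open>J\<close>, where \<open>card J = k\<close>; taking the
  product with the unit cube in the remaining coordinates turns \<open>k\<close>-dimensional into full volume.\<close>

definition glue :: "'m set \<Rightarrow> real^'m \<Rightarrow> real^'m \<Rightarrow> real^'m" where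
  "glue J x q = (\<chi> i. if i \<in> J then x $ i else q $ i)"

definition cyl_map :: "'m set \<Rightarrow> real^'n^'m \<Rightarrow> (real^'n) \<times> (real^'m) \<Rightarrow> real^'m" where
  "cyl_map J T = (\<lambda>(x, q). glue J (T *v x) q)"

definition cyl :: "'m set \<Rightarrow> real^'n^'m \<Rightarrow> (real^'n) convex_body \<Rightarrow> (real^'m) convex_body" where
  "cyl J T K = Convex_Body (cyl_map J T ` (body_set K \<times> cbox 0 1))"

lemma linear_cyl_map: "linear (cyl_map J T)"
  by (rule linearI)
     (auto simp: cyl_map_def glue_def vec_eq_iff matrix_vector_right_distrib
       scaleR_matrix_vector_assoc[symmetric] matrix_vector_mult_scaleR)

lemma cube_nonempty: "cbox (0::real^'m) 1 \<noteq> {}"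
  using zero_le_one by (auto simp: set_eq_iff mem_box_cart intro!: exI[of _ 0])

lemma body_set_cyl: "body_set (cyl J T K) = cyl_map J T ` (body_set K \<times> cbox 0 1)"
  unfolding cyl_def
proof (rule body_set_Convex_Body)
  show "convex (cyl_map J T ` (body_set K \<times> cbox 0 1))"
    by (intro convex_linear_image linear_cyl_map convex_Times convex_box) simp
  show "compact (cyl_map J T ` (body_set K \<times> cbox 0 1))"
    by (intro compact_continuous_image linear_continuous_on compact_Times compact_cbox)
       (simp_all add: linear_cyl_map linear_conv_bounded_linear[symmetric])
qed (use cube_nonempty in auto)

lemma mem_cyl_iff:
  "y \<in> body_set (cyl J T K) \<longleftrightarrow>
     (\<exists>x\<in>body_set K. \<forall>i\<in>J. y $ i = (T *v x) $ i) \<and> (\<forall>i. i \<notin> J \<longrightarrow> 0 \<le> y $ i \<and> y $ i \<le> 1)"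
  (is "_ \<longleftrightarrow> ?r")
proof
  assume ?r
  then obtain x where x: "x \<in> body_set K" "\<forall>i\<in>J. y $ i = (T *v x) $ i"
    and y: "\<forall>i. i \<notin> J \<longrightarrow> 0 \<le> y $ i \<and> y $ i \<le> 1" by blast
  have "y = cyl_map J T (x, \<chi> i. if i \<in> J then 0 else y $ i)"
    using x by (simp add: cyl_map_def glue_def vec_eq_iff)
  moreover have "(\<chi> i. if i \<in> J then 0 else y $ i) \<in> cbox 0 1"
    using y by (auto simp: mem_box_cart)
  ultimately show "y \<in> body_set (cyl J T K)"
    unfolding body_set_cyl using x(1) by blast
qed (fastforce simp: body_set_cyl cyl_map_def glue_def mem_box_cart)

text \<open>Points are matched with the same cube coordinate \<open>q\<close>, so only
  \<open>T x - T' x' = T (x - x') + (T - T') x'\<close> matters. The bound controls the matrix and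
  the body at the same time.\<close>

lemma dist_cyl_le:
  fixes T T' :: "real^'n^'m"
  assumes "body_set K' \<subseteq> cball 0 R"
  shows "dist (cyl J T K) (cyl J T' K')
           \<le> real CARD('m) * (norm T * dist K K' + norm (T - T') * R)" (is "_ \<le> ?b")
proof -
  have near: "dist (cyl_map J T (x, q)) (cyl_map J T' (x', q)) \<le> ?b"
    if "x' \<in> body_set K'" "dist x x' \<le> dist K K'" for x x' q
  proof -
    have "dist (cyl_map J T (x, q)) (cyl_map J T' (x', q)) \<le> dist (T *v x) (T' *v x')"
      unfolding dist_norm by (rule norm_le_componentwise_cart) (auto simp: cyl_map_def glue_def)
    also have "\<dots> \<le> norm (T *v (x - x')) + norm ((T - T') *v x')"
      unfolding dist_norm
      using norm_triangle_ineq[of "T *v (x - x')" "(T - T') *v x'"]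
      by (simp add: matrix_vector_mult_diff_distrib matrix_vector_mult_diff_rdistrib)
    also have "\<dots> \<le> real CARD('m) * norm T * norm (x - x') + real CARD('m) * norm (T - T') * norm x'"
      by (intro add_mono norm_matrix_vector_mult_le)
    also have "\<dots> \<le> real CARD('m) * norm T * dist K K' + real CARD('m) * norm (T - T') * R"
      using that assms by (intro add_mono mult_left_mono) (auto simp: dist_norm)
    finally show ?thesis by (simp add: algebra_simps)
  qed
  show ?thesis
  proof (rule dist_convex_body_leI)
    fix y assume "y \<in> body_set (cyl J T K)"
    then obtain x q where y: "y = cyl_map J T (x, q)" "x \<in> body_set K" "q \<in> cbox 0 1"
      by (auto simp: body_set_cyl)
    obtain x' where "x' \<in> body_set K'" "dist x x' \<le> dist K K'"
      using near_point_in_body[OF y(2)] by blast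
    then show "\<exists>z\<in>body_set (cyl J T' K'). dist y z \<le> ?b"
      using near[of x' x q] y by (auto simp: body_set_cyl)
  next
    fix y assume "y \<in> body_set (cyl J T' K')"
    then obtain x' q where y: "y = cyl_map J T' (x', q)" "x' \<in> body_set K'" "q \<in> cbox 0 1"
      by (auto simp: body_set_cyl)
    obtain x where "x \<in> body_set K" "dist x' x \<le> dist K' K"
      using near_point_in_body[OF y(2)] by blast
    then show "\<exists>z\<in>body_set (cyl J T K). dist y z \<le> ?b"
      using near[of x' x q] y by (auto simp: body_set_cyl dist_commute intro!: bexI[of _ "(x, q)"])
  qed
qed

lemma tendsto_cyl:
  fixes T :: "real^'n^'m"
  assumes X: "(X \<longlongrightarrow> T) F" and Y: "(Y \<longlongrightarrow> K) F"
  shows "((\<lambda>n. cyl J (X n) (Y n)) \<longlongrightarrow> cyl J T K) F"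
proof -
  obtain R where R: "body_set K \<subseteq> cball 0 R"
    using body_set_subset_cball by blast
  have "((\<lambda>n. real CARD('m) * (norm (X n) * dist (Y n) K + norm (X n - T) * R))
      \<longlongrightarrow> real CARD('m) * (norm T * dist K K + norm (T - T) * R)) F"
    by (intro tendsto_intros X Y)
  then have lim: "((\<lambda>n. real CARD('m) * (norm (X n) * dist (Y n) K + norm (X n - T) * R)) \<longlongrightarrow> 0) F"
    by simp
  show ?thesis
    by (subst tendsto_dist_iff, rule tendsto_sandwich[OF _ _ tendsto_const lim]) (auto intro!: always_eventually dist_cyl_le[OF R])
qed

text \<open>The functional \<open>vol\<^sub>k(T K)\<close> of the overview, where only the rows of
  \<open>T\<close> in \<open>J\<close> count.\<close>

lift_definition cyl_val :: "'m::{finite,wellorder} set \<Rightarrow> real^'n^('m::{finite,wellorder}) \<Rightarrow> (real^'n) val"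
  is "\<lambda>J T K. measure lebesgue (body_set (cyl J T K))"
proof (intro conjI)
  fix J :: "'m::{finite,wellorder} set" and T :: "real^'n^('m::{finite,wellorder})"
  show "is_valuation (\<lambda>K. measure lebesgue (body_set (cyl J T K)))"
  proof (rule is_valuationI)
    fix K L M N :: "(real^'n) convex_body"
    assume M: "body_set M = body_set K \<union> body_set L" and N: "body_set N = body_set K \<inter> body_set L"
    have U: "body_set (cyl J T M) = body_set (cyl J T K) \<union> body_set (cyl J T L)"
      unfolding body_set_cyl M by blast
    \<comment> \<open>As \<open>T\<close> need not be injective, this uses the convexity of
      \<open>K \<union> L\<close>: the segment between a preimage of \<open>y\<close> in
      \<open>K\<close> and one in \<open>L\<close> lies in the union, so by connectedness it meets
      \<open>K \<inter> L\<close>, and the \<open>J\<close>-coordinates of \<open>T\<close> are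
      constant along it.\<close>
    have "body_set (cyl J T K) \<inter> body_set (cyl J T L) \<subseteq> body_set (cyl J T N)"
    proof
      fix y assume y: "y \<in> body_set (cyl J T K) \<inter> body_set (cyl J T L)"
      then obtain a b where ab: "a \<in> body_set K" "b \<in> body_set L"
        and J: "\<forall>i\<in>J. y $ i = (T *v a) $ i" "\<forall>i\<in>J. y $ i = (T *v b) $ i"
        and q: "\<forall>i. i \<notin> J \<longrightarrow> 0 \<le> y $ i \<and> y $ i \<le> 1"
        by (auto simp: mem_cyl_iff)
      have "closed_segment a b \<subseteq> body_set K \<union> body_set L"
        using ab convex_body_set[of M] unfolding M by (simp add: closed_segment_subset)
      then have "body_set K \<inter> body_set L \<inter> closed_segment a b \<noteq> {}"
        using connected_segment(1)[of a b] ab closed_body_set[of K] closed_body_set[of L]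
        unfolding connected_closed by blast
      then obtain c u where c: "c \<in> body_set N" "c = (1 - u) *\<^sub>R a + u *\<^sub>R b"
        unfolding N by (fastforce simp: in_segment)
      have "y $ i = (T *v c) $ i" if "i \<in> J" for i
      proof -
        have "(T *v c) $ i = (1 - u) * (T *v a) $ i + u * (T *v b) $ i"
          unfolding c(2) by (simp add: matrix_vector_right_distrib matrix_vector_mult_scaleR)
        also have "\<dots> = (1 - u) * y $ i + u * y $ i"
          using J that by simp
        finally show ?thesis by (simp add: algebra_simps)
      qed
      then show "y \<in> body_set (cyl J T N)"
        using c(1) q unfolding mem_cyl_iff by blast
    qed
    moreover have "body_set (cyl J T N) \<subseteq> body_set (cyl J T K) \<inter> body_set (cyl J T L)"
      unfolding body_set_cyl N by blast
    ultimately show "measure lebesgue (body_set (cyl J T M)) + measure lebesgue (body_set (cyl J T N))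
        = measure lebesgue (body_set (cyl J T K)) + measure lebesgue (body_set (cyl J T L))"
      unfolding U by (subst measure_Un3) (auto dest: equalityI)
  qed
  show "translation_invariant (\<lambda>K. measure lebesgue (body_set (cyl J T K)))"
    unfolding translation_invariant_def
  proof (intro allI)
    fix v :: "real^'n" and K
    \<comment> \<open>Only the \<open>J\<close>-coordinates move, by those of \<open>T v\<close>;
      the cube factor stays in place.\<close>
    have "body_set (cyl J T (body_image ((+) v) K)) = (+) (cyl_map J T (v, 0)) ` body_set (cyl J T K)"
      unfolding body_set_cyl body_set_body_image_translation
      by (force simp: image_iff linear_add[OF linear_cyl_map, symmetric])
    then show "measure lebesgue (body_set (cyl J T (body_image ((+) v) K))) = measure lebesgue (body_set (cyl J T K))"
      by (simp add: measure_translation)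
  qed
  show "continuous_on UNIV (\<lambda>K. measure lebesgue (body_set (cyl J T K)))"
    by (rule continuous_on_compose2[OF continuous_on_measure_body])
       (auto simp: continuous_on_def intro!: tendsto_cyl tendsto_intros)
qed

lemmas apply_cyl_val = cyl_val.rep_eq

lemma tendsto_apply_cyl_val:
  fixes T :: "real^'n^('m::{finite,wellorder})"
  assumes "(X \<longlongrightarrow> T) F" "(Y \<longlongrightarrow> K) F"
  shows "((\<lambda>n. apply_val (cyl_val J (X n)) (Y n)) \<longlongrightarrow> apply_val (cyl_val J T) K) F"
  unfolding apply_cyl_val
  using continuous_on_tendsto_compose[OF continuous_on_measure_body tendsto_cyl[OF assms]] by simp

text \<open>Continuity at each single body does not suffice, since the norm is a supremum over
  bodies in the unit ball. Blaschke selection makes a sequence of bad bodies converge along a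
  subsequence, and joint continuity in matrix and body then gives a contradiction.\<close>

lemma continuous_on_cyl_val:
  "continuous_on UNIV (cyl_val J :: real^'n^('m::{finite,wellorder}) \<Rightarrow> (real^'n) val)"
proof (rule ccontr)
  assume "\<not> ?thesis"
  then obtain T :: "real^'n^('m::{finite,wellorder})" and e where e: "e > 0"
    and *: "\<And>d. d > 0 \<Longrightarrow> \<exists>T'. dist T' T < d \<and> \<not> dist (cyl_val J T') (cyl_val J T) < e"
    unfolding continuous_on_iff by blast
  have "\<exists>T' K. dist T' T < inverse (real (Suc m)) \<and> body_set K \<subseteq> cball 0 1 \<and>
      \<not> \<bar>apply_val (cyl_val J T') K - apply_val (cyl_val J T) K\<bar> < e / 2" for m
  proof -
    obtain T' where T': "dist T' T < inverse (real (Suc m))" "\<not> dist (cyl_val J T') (cyl_val J T) < e"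
      using *[of "inverse (real (Suc m))"] by auto
    have "\<exists>K. body_set K \<subseteq> cball 0 1 \<and> \<not> \<bar>apply_val (cyl_val J T' - cyl_val J T) K\<bar> \<le> e / 2"
    proof (rule ccontr)
      assume "\<not> ?thesis"
      then have "val_norm (cyl_val J T' - cyl_val J T) \<le> e / 2"
        by (intro val_norm_le) blast
      with T' e show False by (simp add: dist_norm norm_val_eq)
    qed
    with T'(1) show ?thesis by fastforce
  qed
  then obtain X Y where X: "\<And>m. dist (X m) T < inverse (real (Suc m))"
    and Y: "\<And>m. body_set (Y m) \<subseteq> cball 0 1"
    and XY: "\<And>m. \<not> \<bar>apply_val (cyl_val J (X m)) (Y m) - apply_val (cyl_val J T) (Y m)\<bar> < e / 2"
    by metis
  have "X \<longlonglongrightarrow> T"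
    by (subst tendsto_dist_iff, rule tendsto_sandwich[OF _ _ tendsto_const LIMSEQ_inverse_real_of_nat])
       (use X in \<open>auto intro!: always_eventually less_imp_le\<close>)
  moreover obtain K r where r: "strict_mono (r :: nat \<Rightarrow> nat)" and K: "(Y \<circ> r) \<longlonglongrightarrow> K"
    using Blaschke_selection[OF Y] .
  ultimately have X': "(X \<circ> r) \<longlonglongrightarrow> T"
    by (simp add: LIMSEQ_subseq_LIMSEQ)
  have "(\<lambda>m. \<bar>apply_val (cyl_val J ((X \<circ> r) m)) ((Y \<circ> r) m) - apply_val (cyl_val J T) ((Y \<circ> r) m)\<bar>)
      \<longlonglongrightarrow> \<bar>apply_val (cyl_val J T) K - apply_val (cyl_val J T) K\<bar>"
    by (intro tendsto_rabs tendsto_diff tendsto_apply_cyl_val X' K tendsto_const)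
  then have "eventually (\<lambda>m. \<bar>apply_val (cyl_val J ((X \<circ> r) m)) ((Y \<circ> r) m)
      - apply_val (cyl_val J T) ((Y \<circ> r) m)\<bar> < e / 2) sequentially"
    using e by (intro order_tendstoD(2)[where a = "e / 2"]) auto
  then show False
    using XY by (auto simp: eventually_sequentially)
qed

text \<open>Moves a linear change of the body into the parameter \<open>T\<close>; this is what
  turns the group action on averages into a change of variables.\<close>

lemma apply_cyl_val_matrix_image:
  "apply_val (cyl_val J T) (body_image ((*v) A) K) = apply_val (cyl_val J (T ** A)) K"
proof -
  have "cyl J T (body_image ((*v) A) K) = cyl J (T ** A) K"
    unfolding body_set_inject[symmetric] set_eq_iff mem_cyl_iff
    by (auto simp: body_set_body_image_linear matrix_vector_mul_assoc)
  then show ?thesis by (simp add: apply_cyl_val)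
qed

lemma apply_cyl_val_scaleR:
  assumes t: "t \<noteq> 0"
  shows "apply_val (cyl_val J T) (body_image ((*\<^sub>R) t) K) = \<bar>t\<bar> ^ card J * apply_val (cyl_val J T) K"
proof -
  define m where "m i = (if i \<in> J then t else 1)" for i
  have "body_set (cyl J T (body_image ((*\<^sub>R) t) K)) = (\<lambda>y. \<chi> i. m i * y $ i) ` body_set (cyl J T K)"
    unfolding body_set_cyl body_set_body_image_linear[OF linear_scaleR]
    by (force simp: image_iff cyl_map_def glue_def m_def vec_eq_iff matrix_vector_mult_scaleR)
  moreover have "\<bar>prod m UNIV\<bar> = \<bar>t\<bar> ^ card J"
  proof -
    have "prod m UNIV = (\<Prod>i\<in>J. t)"
      unfolding m_def by (subst prod.If_cases) auto
    then show ?thesis by (simp add: power_abs)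
  qed
  ultimately show ?thesis
    unfolding apply_cyl_val by (simp only: measure_stretch lmeasurable_body_set)
qed


section \<open>Smoothness of parameter integrals\<close>

text \<open>On an open set the derivative at a point depends only on values inside the set. This
  permits replacing \<open>frechet_derivative\<close> by explicit formulas that hold on
  \<open>S\<close> only.\<close>

lemma times_differentiable_on_cong:
  assumes "open S" "\<And>x. x \<in> S \<Longrightarrow> f x = g x"
  shows "times_differentiable_on m S f \<longleftrightarrow> times_differentiable_on m S g"
  using assms(2)
proof (induction m arbitrary: f g)
  case 0
  then show ?case by (simp cong: continuous_on_cong)
next
  case (Suc m)
  have hd: "(f has_derivative D) (at x) \<longleftrightarrow> (g has_derivative D) (at x)" if "x \<in> S" for x D
    using that Suc.prems \<open>open S\<close> by (metis has_derivative_transform_within_open)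
  then have "f differentiable (at x) \<longleftrightarrow> g differentiable (at x)" if "x \<in> S" for x
    using that by (auto simp: differentiable_def)
  moreover have "frechet_derivative f (at x) = frechet_derivative g (at x)" if "x \<in> S" for x
    unfolding frechet_derivative_def using hd[OF that] by simp
  then have "times_differentiable_on m S (\<lambda>x. frechet_derivative f (at x) v)
      \<longleftrightarrow> times_differentiable_on m S (\<lambda>x. frechet_derivative g (at x) v)" for v
    by (intro Suc.IH) simp
  ultimately show ?case by simp
qed

lemma times_differentiable_on_add_scaleR:
  assumes "open S" "times_differentiable_on m S f" "times_differentiable_on m S g"
  shows "times_differentiable_on m S (\<lambda>x. f x + c *\<^sub>R g x)"
  using assms(2,3)
proof (induction m arbitrary: f g)
  case 0
  then show ?case by (simp add: continuous_intros)
next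
  case (Suc m)
  have fd: "((\<lambda>x. f x + c *\<^sub>R g x) has_derivative
      (\<lambda>v. frechet_derivative f (at x) v + c *\<^sub>R frechet_derivative g (at x) v)) (at x)" if "x \<in> S" for x
    using Suc.prems that frechet_derivative_works
    by (intro has_derivative_add has_derivative_scaleR_right) auto
  then have "(\<lambda>x. f x + c *\<^sub>R g x) differentiable (at x)" if "x \<in> S" for x
    using that by (auto simp: differentiable_def)
  moreover have "times_differentiable_on m S (\<lambda>x. frechet_derivative (\<lambda>x. f x + c *\<^sub>R g x) (at x) v)" for v
  proof -
    have "times_differentiable_on m S
        (\<lambda>x. frechet_derivative f (at x) v + c *\<^sub>R frechet_derivative g (at x) v)"
      using Suc.prems by (intro Suc.IH) auto
    then show ?thesis
      by (subst times_differentiable_on_cong[OF \<open>open S\<close>])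
        (use frechet_derivative_at[OF fd] in \<open>simp_all add: fun_eq_iff\<close>)
  qed
  ultimately show ?case by simp
qed

text \<open>A class of parametrized functions that is visibly closed under differentiation in \<open>g\<close>.\<close>

inductive smooth_family ::
    "'a::euclidean_space set \<Rightarrow> ('a \<Rightarrow> 'p::euclidean_space \<Rightarrow> real) \<Rightarrow> bool" for G where
  parameter: "continuous_on UNIV c \<Longrightarrow> smooth_family G (\<lambda>g t. c t)"
| linear: "bounded_linear l \<Longrightarrow> smooth_family G (\<lambda>g t. l g)"
| sgn: "continuous_on G d \<Longrightarrow> (\<And>g. g \<in> G \<Longrightarrow> d g \<noteq> 0) \<Longrightarrow> smooth_family G (\<lambda>g t. sgn (d g :: real))"
| add: "smooth_family G u \<Longrightarrow> smooth_family G w \<Longrightarrow> smooth_family G (\<lambda>g t. u g t + w g t)"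
| mult: "smooth_family G u \<Longrightarrow> smooth_family G w \<Longrightarrow> smooth_family G (\<lambda>g t. u g t * w g t)"
| compose: "(\<And>m x. (p m has_real_derivative p (Suc m) x) (at x)) \<Longrightarrow> smooth_family G u \<Longrightarrow>
    smooth_family G (\<lambda>g t. p (m :: nat) (u g t))"

lemma smooth_family_const: "smooth_family G (\<lambda>g t. c)"
  by (rule smooth_family.parameter) simp

lemma smooth_family_sum:
  assumes "\<And>i. i \<in> I \<Longrightarrow> smooth_family G (u i)"
  shows "smooth_family G (\<lambda>g t. \<Sum>i\<in>I. u i g t)"
  using assms
  by (induction I rule: infinite_finite_induct) (auto intro: smooth_family_const smooth_family.add)

lemma smooth_family_prod:
  assumes "\<And>i. i \<in> I \<Longrightarrow> smooth_family G (u i)"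
  shows "smooth_family G (\<lambda>g t. \<Prod>i\<in>I. u i g t)"
  using assms
  by (induction I rule: infinite_finite_induct) (auto intro: smooth_family_const smooth_family.mult)

lemma smooth_family_uminus: "smooth_family G u \<Longrightarrow> smooth_family G (\<lambda>g t. - u g t)"
  using smooth_family.mult[OF smooth_family_const[of G "-1"]] by simp

lemma smooth_family_continuous_on:
  assumes "smooth_family G u"
  shows "continuous_on (G \<times> UNIV) (\<lambda>(g, t). u g t)"
  using assms
proof induction
  case (parameter c)
  have "continuous_on (G \<times> UNIV) (\<lambda>x::'a \<times> 'b. c (snd x))"
    by (intro continuous_on_compose2[OF parameter] continuous_intros) auto
  then show ?case by (simp add: case_prod_unfold)
next
  case (linear l)
  have "continuous_on (G \<times> UNIV) (\<lambda>x::'a \<times> 'b. l (fst x))"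
    by (intro bounded_linear.continuous_on[OF linear] continuous_intros)
  then show ?case by (simp add: case_prod_unfold)
next
  case (sgn d)
  have "continuous_on (G \<times> UNIV) (\<lambda>x::'a \<times> 'b. d (fst x))"
    by (rule continuous_on_compose2[OF sgn(1)]) (auto intro!: continuous_intros)
  then show ?case
    using sgn by (auto simp: case_prod_unfold intro!: continuous_on_sgn)
next
  case (compose p u m)
  have "continuous_on UNIV (p m)"
    using compose(1) by (intro DERIV_continuous_on[where D = "p (Suc m)"]) auto
  from continuous_on_compose2[OF this compose(3)] show ?case
    by (simp add: case_prod_unfold)
qed (auto simp: case_prod_unfold intro!: continuous_intros)

text \<open>By induction on the rules. The rule \<open>compose\<close> carries the whole sequence of
  derivatives of the outer function, so differentiating only raises its index by one.\<close>

lemma smooth_family_derivative: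
  assumes "open G" "smooth_family G u"
  shows "\<exists>u'. (\<forall>g\<in>G. \<forall>t. ((\<lambda>g. u g t) has_derivative (\<lambda>v. u' v g t)) (at g)) \<and>
              (\<forall>v. smooth_family G (u' v))"
  using assms(2)
proof induction
  case (parameter c)
  show ?case
    by (intro exI[of _ "\<lambda>v g t. 0"]) (auto intro: smooth_family_const)
next
  case (linear l)
  then show ?case
    by (intro exI[of _ "\<lambda>v g t. l v"])
      (auto intro: smooth_family_const bounded_linear_imp_has_derivative)
next
  case (sgn d)
  have "((\<lambda>g. sgn (d g)) has_derivative (\<lambda>v. 0)) (at g)" if g: "g \<in> G" for g
  proof -
    \<comment> \<open>The points of \<open>G\<close> at which \<open>d\<close> has the sign that it
      has at \<open>g0\<close>; there \<open>sgn\<close> is constant.\<close>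
    define O' where "O' g0 = G \<inter> (\<lambda>g. d g * d g0) -` {0<..}" for g0
    have op: "open (O' g)"
      unfolding O'_def using sgn(1)
      by (intro continuous_open_preimage \<open>open G\<close>) (auto intro!: continuous_intros)
    have "g \<in> O' g"
      using sgn(2)[OF g] g by (auto simp: O'_def zero_less_mult_iff)
    moreover have "sgn (d g) = sgn (d h)" if "h \<in> O' g" for h
      using that by (auto simp: O'_def zero_less_mult_iff sgn_if)
    ultimately show ?thesis
      by (intro has_derivative_transform_within_open[OF has_derivative_const op]) auto
  qed
  then show ?case
    by (intro exI[of _ "\<lambda>v g t. 0"]) (auto intro: smooth_family_const)
next
  case (add u w)
  then obtain u' w' where
    "\<forall>g\<in>G. \<forall>t. ((\<lambda>g. u g t) has_derivative (\<lambda>v. u' v g t)) (at g)" "\<forall>v. smooth_family G (u' v)"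
    "\<forall>g\<in>G. \<forall>t. ((\<lambda>g. w g t) has_derivative (\<lambda>v. w' v g t)) (at g)" "\<forall>v. smooth_family G (w' v)"
    by blast
  then show ?case
    by (intro exI[of _ "\<lambda>v g t. u' v g t + w' v g t"])
      (auto intro: smooth_family.add has_derivative_add)
next
  case (mult u w)
  then obtain u' w' where
    "\<forall>g\<in>G. \<forall>t. ((\<lambda>g. u g t) has_derivative (\<lambda>v. u' v g t)) (at g)" "\<forall>v. smooth_family G (u' v)"
    "\<forall>g\<in>G. \<forall>t. ((\<lambda>g. w g t) has_derivative (\<lambda>v. w' v g t)) (at g)" "\<forall>v. smooth_family G (w' v)"
    by blast
  then show ?case using mult.hyps
    by (intro exI[of _ "\<lambda>v g t. u g t * w' v g t + u' v g t * w g t"])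
      (auto intro!: smooth_family.add smooth_family.mult has_derivative_mult)
next
  case (compose p u m)
  then obtain u' where u':
    "\<forall>g\<in>G. \<forall>t. ((\<lambda>g. u g t) has_derivative (\<lambda>v. u' v g t)) (at g)" "\<forall>v. smooth_family G (u' v)"
    by blast
  have "((\<lambda>g. p m (u g t)) has_derivative (\<lambda>v. p (Suc m) (u g t) * u' v g t)) (at g)" if "g \<in> G" for g t
    using DERIV_compose_FDERIV[OF compose(1) u'(1)[rule_format, OF that]] by (simp add: mult.commute)
  moreover have "smooth_family G (\<lambda>g t. p (Suc m) (u g t) * u' v g t)" for v
    by (intro smooth_family.mult smooth_family.compose[where p = p] compose(1,2) u'(2)[rule_format])
  ultimately show ?case
    by (intro exI[of _ "\<lambda>v g t. p (Suc m) (u g t) * u' v g t"]) blast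
qed

section \<open>Differentiation under the integral sign\<close>

lemma has_derivative_zero_on_ball:
  assumes "(f has_derivative f') (at h)" "h \<in> ball g e" "\<And>x. x \<in> ball g e \<Longrightarrow> f x = 0"
  shows "f' v = 0"
proof -
  have "((\<lambda>x. 0) has_derivative f') (at h)"
    by (rule has_derivative_transform_within_open[OF assms(1) open_ball assms(2)]) (simp add: assms(3))
  then show ?thesis
    using has_derivative_unique[OF _ has_derivative_const] by metis
qed

text \<open>Uniformity over a ball around \<open>g\<close> lets the integral over the whole space be
  replaced near \<open>g\<close> by one over a fixed box.\<close>

definition locally_bounded_support :: "'a::euclidean_space set \<Rightarrow> ('a \<Rightarrow> 'p::euclidean_space \<Rightarrow> real) \<Rightarrow> bool" where
  "locally_bounded_support G u \<longleftrightarrow>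
     (\<forall>g\<in>G. \<exists>e>0. \<exists>R. ball g e \<subseteq> G \<and> (\<forall>h\<in>ball g e. \<forall>t. R < norm t \<longrightarrow> u h t = 0))"

text \<open>The same ball and the same \<open>R\<close> serve: where \<open>u\<close> vanishes on a
  ball of parameters, so do its derivatives.\<close>

lemma locally_bounded_support_derivative:
  assumes u: "locally_bounded_support G u"
    and d: "\<And>g t. g \<in> G \<Longrightarrow> ((\<lambda>g. u g t) has_derivative (\<lambda>v. u' v g t)) (at g)"
  shows "locally_bounded_support G (u' v)"
  unfolding locally_bounded_support_def
proof
  fix g assume "g \<in> G"
  then obtain e R where e: "e > 0" "ball g e \<subseteq> G" "\<And>h t. h \<in> ball g e \<Longrightarrow> R < norm t \<Longrightarrow> u h t = 0"
    using u unfolding locally_bounded_support_def by blast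
  have "u' v h t = 0" if h: "h \<in> ball g e" and t: "R < norm t" for h t
    using has_derivative_zero_on_ball[OF d h e(3)] e(2) h t by blast
  with e show "\<exists>e>0. \<exists>R. ball g e \<subseteq> G \<and> (\<forall>h\<in>ball g e. \<forall>t. R < norm t \<longrightarrow> u' v h t = 0)"
    by blast
qed

lemma integral_eq_integral_cbox:
  fixes f :: "'p::euclidean_space \<Rightarrow> 'b::banach"
  assumes "\<And>t. t \<notin> cbox a b \<Longrightarrow> f t = 0"
  shows "integral UNIV f = integral (cbox a b) f"
proof -
  have "f = (\<lambda>t. if t \<in> cbox a b then f t else 0)"
    using assms by auto
  then show ?thesis by (metis integral_restrict_UNIV)
qed

text \<open>Near \<open>g\<close> the integrand is supported in one box, where the Leibniz rule for
  compact domains applies. Afterwards the integral and its derivative are extended back to the whole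
  space.\<close>

lemma has_derivative_integral_smooth_family:
  fixes \<Phi> :: "'p::euclidean_space \<Rightarrow> 'b::banach"
  assumes "open G" and \<Phi>: "continuous_on UNIV \<Phi>" and u: "smooth_family G u" "locally_bounded_support G u"
    and d: "\<And>g t. g \<in> G \<Longrightarrow> ((\<lambda>g. u g t) has_derivative (\<lambda>v. u' v g t)) (at g)"
    and u': "\<And>v. smooth_family G (u' v)" and g: "g \<in> G"
  shows "((\<lambda>g. integral UNIV (\<lambda>t. u g t *\<^sub>R \<Phi> t)) has_derivative
           (\<lambda>v. integral UNIV (\<lambda>t. u' v g t *\<^sub>R \<Phi> t))) (at g)"
proof -
  obtain e R where e: "e > 0" "ball g e \<subseteq> G" "\<And>h t. h \<in> ball g e \<Longrightarrow> R < norm t \<Longrightarrow> u h t = 0"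
    using u(2) g unfolding locally_bounded_support_def by blast
  have u'0: "u' v g t = 0" if "R < norm t" for v t
    by (rule has_derivative_zero_on_ball[OF d[OF g, of t] _ e(3)[OF _ that]]) (use e(1) in auto)
  obtain b where b: "cball 0 R \<subseteq> cbox (- b) (b :: 'p)"
    using bounded_subset_cbox_symmetric[OF bounded_cball] by blast
  let ?B = "cbox (- b) b"
  have out: "R < norm t" if "t \<notin> ?B" for t
    using that b by (force simp: not_le[symmetric])
  \<comment> \<open>\<open>leibniz_rule\<close> takes the derivative as a continuous map into the
    bounded linear operators; the operator is known to be bounded for
    \<open>h \<in> G\<close>.\<close>
  define fx where "fx h t = Blinfun (\<lambda>v. u' v h t *\<^sub>R \<Phi> t)" for h t
  have fx: "blinfun_apply (fx h t) = (\<lambda>v. u' v h t *\<^sub>R \<Phi> t)" if "h \<in> G" for h t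
  proof -
    have "bounded_linear (\<lambda>v. u' v h t)"
      using d[OF that] by (rule has_derivative_bounded_linear)
    then show ?thesis
      unfolding fx_def by (intro bounded_linear_Blinfun_apply bounded_linear_scaleR_const)
  qed
  have "continuous_on (G \<times> UNIV) (\<lambda>x::'a \<times> 'p. \<Phi> (snd x))"
    by (intro continuous_on_compose2[OF \<Phi>] continuous_intros) auto
  then have cont: "continuous_on (G \<times> UNIV) (\<lambda>(h, t). w h t *\<^sub>R \<Phi> t)" if "smooth_family G w" for w
    using smooth_family_continuous_on[OF that]
    by (auto simp: case_prod_unfold intro!: continuous_intros)
  have cont1: "continuous_on UNIV (\<lambda>t. w h t *\<^sub>R \<Phi> t)" if "smooth_family G w" "h \<in> G" for w h
  proof -
    have "continuous_on UNIV (Pair h :: 'p \<Rightarrow> 'a \<times> 'p)"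
      by (intro continuous_intros)
    from continuous_on_compose2[OF cont[OF that(1)] this] that(2) show ?thesis by auto
  qed
  \<comment> \<open>The parameter space is finite-dimensional, so continuity into operators can be
    tested on basis vectors.\<close>
  have cfx: "continuous_on (G \<times> UNIV) (\<lambda>(h, t). fx h t)"
  proof (rule continuous_on_blinfun_componentwise)
    fix i :: 'a
    show "continuous_on (G \<times> UNIV) (\<lambda>x. blinfun_apply (case x of (h, t) \<Rightarrow> fx h t) i)"
      by (rule continuous_on_eq[OF cont[OF u'[of i]]]) (auto simp: fx)
  qed
  have "((\<lambda>h. integral ?B (\<lambda>t. u h t *\<^sub>R \<Phi> t)) has_derivative integral ?B (fx g)) (at g within ball g e)"
  proof (rule leibniz_rule)
    show "((\<lambda>h. u h t *\<^sub>R \<Phi> t) has_derivative blinfun_apply (fx h t)) (at h within ball g e)"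
      if "h \<in> ball g e" for h t
    proof -
      have "h \<in> G" using that e(2) by blast
      from has_derivative_scaleR_left[OF has_derivative_at_withinI[OF d[OF this, of t]]]
      show ?thesis by (simp only: fx[OF \<open>h \<in> G\<close>])
    qed
    show "(\<lambda>t. u h t *\<^sub>R \<Phi> t) integrable_on ?B" if "h \<in> ball g e" for h
      by (rule integrable_continuous, rule continuous_on_subset[OF cont1[OF u(1)]]) (use that e(2) in blast)+
    show "continuous_on (ball g e \<times> ?B) (\<lambda>(h, t). fx h t)"
      by (rule continuous_on_subset[OF cfx]) (use e(2) in auto)
  qed (use e(1) in simp_all)
  then have "((\<lambda>h. integral ?B (\<lambda>t. u h t *\<^sub>R \<Phi> t)) has_derivative integral ?B (fx g)) (at g)"
    using e(1) by (simp add: at_within_open[OF _ open_ball])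
  moreover have "blinfun_apply (integral ?B (fx g)) = (\<lambda>v. integral UNIV (\<lambda>t. u' v g t *\<^sub>R \<Phi> t))"
  proof
    fix v
    have "continuous_on ?B (Pair g)"
      by (intro continuous_intros)
    from continuous_on_compose2[OF cfx this] have "fx g integrable_on ?B"
      using g by (intro integrable_continuous) auto
    then have "blinfun_apply (integral ?B (fx g)) v = integral ?B (\<lambda>t. blinfun_apply (fx g t) v)"
      by (rule blinfun_apply_integral)
    also have "\<dots> = integral UNIV (\<lambda>t. u' v g t *\<^sub>R \<Phi> t)"
      unfolding fx[OF g]
      by (rule integral_eq_integral_cbox[symmetric]) (use u'0 out in simp)
    finally show "blinfun_apply (integral ?B (fx g)) v = integral UNIV (\<lambda>t. u' v g t *\<^sub>R \<Phi> t)" .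
  qed
  ultimately have "((\<lambda>h. integral ?B (\<lambda>t. u h t *\<^sub>R \<Phi> t)) has_derivative
      (\<lambda>v. integral UNIV (\<lambda>t. u' v g t *\<^sub>R \<Phi> t))) (at g)"
    by simp
  then show ?thesis
  proof (rule has_derivative_transform_within_open[OF _ open_ball[of g e]])
    show "g \<in> ball g e" using e by simp
    show "integral ?B (\<lambda>t. u h t *\<^sub>R \<Phi> t) = integral UNIV (\<lambda>t. u h t *\<^sub>R \<Phi> t)" if "h \<in> ball g e" for h
      by (rule integral_eq_integral_cbox[symmetric]) (use e(3)[OF that] out in simp)
  qed
qed

text \<open>The derivative in direction \<open>v\<close> is an integral of the same form with the
  weight \<open>u' v\<close>, so induction on the order works once it is general in
  \<open>u\<close>.\<close>

lemma smooth_on_integral_smooth_family: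
  fixes \<Phi> :: "'p::euclidean_space \<Rightarrow> 'b::banach"
  assumes G: "open G" and \<Phi>: "continuous_on UNIV \<Phi>"
    and u: "smooth_family G u" "locally_bounded_support G u"
  shows "smooth_on G (\<lambda>g. integral UNIV (\<lambda>t. u g t *\<^sub>R \<Phi> t))"
  unfolding smooth_on_def
proof
  fix m
  show "times_differentiable_on m G (\<lambda>g. integral UNIV (\<lambda>t. u g t *\<^sub>R \<Phi> t))"
    using u
  proof (induction m arbitrary: u)
    case (0 u)
    obtain u' where "\<And>g t. g \<in> G \<Longrightarrow> ((\<lambda>g. u g t) has_derivative (\<lambda>v. u' v g t)) (at g)"
      "\<And>v. smooth_family G (u' v)"
      using smooth_family_derivative[OF G 0(1)] by metis
    from has_derivative_integral_smooth_family[OF G \<Phi> 0 this]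
    show ?case
      by (auto intro!: continuous_at_imp_continuous_on has_derivative_continuous)
  next
    case (Suc m u)
    obtain u' where u': "\<And>g t. g \<in> G \<Longrightarrow> ((\<lambda>g. u g t) has_derivative (\<lambda>v. u' v g t)) (at g)"
      "\<And>v. smooth_family G (u' v)"
      using smooth_family_derivative[OF G Suc.prems(1)] by metis
    note D = has_derivative_integral_smooth_family[OF G \<Phi> Suc.prems u']
    have "times_differentiable_on m G (\<lambda>g. integral UNIV (\<lambda>t. u' v g t *\<^sub>R \<Phi> t))" for v
      by (rule Suc.IH[OF u'(2) locally_bounded_support_derivative[OF Suc.prems(2) u'(1)]])
    then have "times_differentiable_on m G
        (\<lambda>g. frechet_derivative (\<lambda>g. integral UNIV (\<lambda>t. u g t *\<^sub>R \<Phi> t)) (at g) v)" for v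
      by (subst times_differentiable_on_cong[OF G]) (simp_all add: frechet_derivative_at[OF D, symmetric])
    then show ?case
      using D by (auto simp: differentiable_def)
  qed
qed


section \<open>Bump functions\<close>

text \<open>Polynomials in \<open>1 / x\<close> times \<open>exp (- (1 / x))\<close>, extended by
  zero, form a class closed under differentiation on the whole line.\<close>

definition flat :: "real poly \<Rightarrow> real \<Rightarrow> real" where
  "flat q x = (if x > 0 then poly q (1 / x) * exp (- (1 / x)) else 0)"

text \<open>The power \<open>y ^ k\<close> makes the induction on \<open>q\<close> work: splitting
  off the constant coefficient passes one factor \<open>y\<close> to the power.\<close>

lemma tendsto_poly_times_exp_minus: "((\<lambda>y. y ^ k * poly q y * exp (- y :: real)) \<longlongrightarrow> 0) at_top"
proof (induction q arbitrary: k)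
  case 0
  then show ?case by simp
next
  case (pCons a q)
  have "((\<lambda>y. a * (y ^ k / exp y) + y ^ Suc k * poly q y * exp (- y :: real)) \<longlongrightarrow> a * 0 + 0) at_top"
    by (intro tendsto_intros pCons.IH tendsto_power_div_exp_0)
  then show ?case by (simp add: exp_minus field_simps)
qed

text \<open>With \<open>y = 1 / x\<close> the chain rule gives
  \<open>y\<^sup>2 * (q y - q' y) * exp (- y)\<close> for positive \<open>x\<close>. At the origin
  the right difference quotient is \<open>y * q y * exp (- y)\<close>, which tends to zero as
  \<open>y\<close> grows, and the left one is zero.\<close>

lemma flat_has_derivative:
  "(flat q has_real_derivative flat (monom 1 2 * (q - pderiv q)) x) (at x)"
proof -
  consider "x > 0" | "x < 0" | "x = 0" by linarith
  then show ?thesis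
  proof cases
    case 1
    have "((\<lambda>x. poly q (1 / x) * exp (- (1 / x))) has_real_derivative
        flat (monom 1 2 * (q - pderiv q)) x) (at x)"
      using 1 by (auto intro!: derivative_eq_intros simp: flat_def poly_monom field_simps power2_eq_square)
    then show ?thesis
      by (rule DERIV_cong_ev[THEN iffD1, rotated -1])
        (use 1 eventually_nhds_in_open[OF open_greaterThan, of x 0] in \<open>auto simp: flat_def elim: eventually_mono\<close>)
  next
    case 2
    have "((\<lambda>x. 0) has_real_derivative flat (monom 1 2 * (q - pderiv q)) x) (at x)"
      using 2 by (auto simp: flat_def)
    then show ?thesis
      by (rule DERIV_cong_ev[THEN iffD1, rotated -1])
        (use 2 eventually_nhds_in_open[OF open_lessThan, of x 0] in \<open>auto simp: flat_def elim: eventually_mono\<close>)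
  next
    case 3
    have "((\<lambda>h. flat q h / h) \<longlongrightarrow> 0) (at_right 0)"
    proof -
      have "((\<lambda>h::real. (inverse h) ^ 1 * poly q (inverse h) * exp (- inverse h)) \<longlongrightarrow> 0) (at_right 0)"
        by (rule filterlim_compose[OF tendsto_poly_times_exp_minus filterlim_inverse_at_top_right])
      then show ?thesis
        by (rule Lim_transform_eventually)
          (auto simp: eventually_at_right_field flat_def field_simps intro!: exI[of _ 1])
    qed
    moreover have "((\<lambda>h. flat q h / h) \<longlongrightarrow> 0) (at_left 0)"
      by (rule Lim_transform_eventually[OF tendsto_const])
        (auto simp: eventually_at_left_field flat_def intro!: exI[of _ "-1"])
    ultimately have "((\<lambda>h. flat q h / h) \<longlongrightarrow> 0) (at 0)"
      by (simp add: filterlim_split_at)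
    then show ?thesis
      using 3 by (simp add: has_field_derivative_iff flat_def)
  qed
qed

text \<open>The \<open>m\<close>-th derivative of \<open>exp (- 1 / x)\<close> is \<open>flat (flat_poly m)\<close>.\<close>

primrec flat_poly :: "nat \<Rightarrow> real poly" where
  "flat_poly 0 = 1"
| "flat_poly (Suc m) = monom 1 2 * (flat_poly m - pderiv (flat_poly m))"

lemma flat_flat_poly_derivative:
  "(flat (flat_poly m) has_real_derivative flat (flat_poly (Suc m)) x) (at x)"
  by (simp add: flat_has_derivative)

text \<open>Squares are used so that the argument of \<open>flat\<close> is polynomial in the
  coordinates of \<open>t\<close>. For \<open>r > 0\<close> the function is positive exactly on the
  open ball of radius \<open>r\<close> about \<open>t0\<close>.\<close>

definition bump :: "'a::euclidean_space \<Rightarrow> real \<Rightarrow> 'a \<Rightarrow> real" where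
  "bump t0 r t = flat 1 (r\<^sup>2 - (norm (t - t0))\<^sup>2)"

lemma bump_nonneg: "0 \<le> bump t0 r t"
  by (simp add: bump_def flat_def)

lemma bump_pos: "r \<noteq> 0 \<Longrightarrow> 0 < bump t0 r t0"
  by (simp add: bump_def flat_def)

lemma bump_eq_0:
  assumes "0 \<le> r" "r \<le> dist t t0"
  shows "bump t0 r t = 0"
  using power_mono[OF assms(2,1), of 2] by (simp add: bump_def flat_def dist_norm)

lemma bump_eq_0_norm:
  assumes "0 \<le> r" "norm t0 + r < norm t"
  shows "bump t0 r t = 0"
  using assms norm_triangle_sub[of t t0] by (intro bump_eq_0) (auto simp: dist_norm)

lemma continuous_on_bump: "continuous_on S (bump t0 r)"
proof -
  have "continuous_on UNIV (flat 1)"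
    using flat_has_derivative by (intro DERIV_continuous_on) auto
  then show ?thesis
    unfolding bump_def by (rule continuous_on_compose2) (auto intro!: continuous_intros)
qed


section \<open>Restriction to subspaces\<close>

text \<open>An orthonormal basis indexed by \<open>J\<close>, so that its coordinates match the
  coordinates in \<open>J\<close> of the cylinders; values of \<open>\<beta>\<close> outside
  \<open>J\<close> are arbitrary.\<close>

definition frame :: "'m set \<Rightarrow> ('m \<Rightarrow> 'a::euclidean_space) \<Rightarrow> 'a set \<Rightarrow> bool" where
  "frame J \<beta> E \<longleftrightarrow> (\<forall>i\<in>J. \<forall>j\<in>J. \<beta> i \<bullet> \<beta> j = (if i = j then 1 else 0)) \<and> span (\<beta> ` J) = E"

lemma frame_inner_sum:
  assumes "frame J \<beta> E" "i \<in> J" "finite J"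
  shows "\<beta> i \<bullet> (\<Sum>j\<in>J. c j *\<^sub>R \<beta> j) = c i"
proof -
  have "\<beta> i \<bullet> (\<Sum>j\<in>J. c j *\<^sub>R \<beta> j) = (\<Sum>j\<in>J. if j = i then c i else 0)"
    unfolding inner_sum_right using assms by (intro sum.cong) (auto simp: frame_def)
  then show ?thesis using assms by simp
qed

lemma frame_mem: "frame J \<beta> E \<Longrightarrow> i \<in> J \<Longrightarrow> \<beta> i \<in> E"
  unfolding frame_def using span_base by blast

lemma frame_expand:
  assumes "frame J \<beta> E" "finite J" "x \<in> E"
  shows "(\<Sum>j\<in>J. (\<beta> j \<bullet> x) *\<^sub>R \<beta> j) = x"
proof -
  have "x \<in> span (\<beta> ` J)" using assms by (simp add: frame_def)
  then show ?thesis
  proof (induction rule: span_induct_alt)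
    case (step c y z)
    then obtain i where i: "i \<in> J" "y = \<beta> i" by blast
    have "(\<Sum>j\<in>J. (\<beta> j \<bullet> (c *\<^sub>R y + z)) *\<^sub>R \<beta> j)
        = (\<Sum>j\<in>J. (c * (\<beta> j \<bullet> y)) *\<^sub>R \<beta> j) + (\<Sum>j\<in>J. (\<beta> j \<bullet> z) *\<^sub>R \<beta> j)"
      by (simp add: inner_add_right scaleR_add_left sum.distrib)
    also have "(\<Sum>j\<in>J. (c * (\<beta> j \<bullet> y)) *\<^sub>R \<beta> j) = (\<Sum>j\<in>J. if j = i then c *\<^sub>R y else 0)"
      using assms(1) i by (intro sum.cong) (auto simp: frame_def)
    finally show ?case using step i assms(2) by simp
  qed simp
qed

lemma orthonormal_basis_ofD:
  assumes "orthonormal_basis_of E B"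
  shows "finite B" "independent B" "card B = dim E"
proof -
  have "0 \<notin> B" using assms by (auto simp: orthonormal_basis_of_def)
  then show "independent B"
    using assms by (simp add: orthonormal_basis_of_def pairwise_orthogonal_independent)
  then show "finite B" "card B = dim E"
    using assms by (auto simp: orthonormal_basis_of_def independent_imp_finite dim_span dim_eq_card_independent)
qed

text \<open>The frame enumerates the very basis chosen in \<open>lborel_subspace\<close>, so that
  the measure on \<open>E\<close> can be compared coordinate by coordinate.\<close>

lemma frame_exists:
  fixes E :: "'a::euclidean_space set" and J :: "'m::finite set"
  assumes "E \<in> Gr (card J)"
  shows "\<exists>\<beta>. frame J \<beta> E \<and> bij_betw \<beta> J (SOME B. orthonormal_basis_of E B)"
proof -
  let ?B = "SOME B. orthonormal_basis_of E B"
  have B: "orthonormal_basis_of E ?B"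
    using assms by (intro orthonormal_basis_of_exists) (simp add: Gr_def)
  then obtain \<beta> where \<beta>: "bij_betw \<beta> J ?B"
    using finite_same_card_bij[of J ?B] orthonormal_basis_ofD[OF B] assms by (auto simp: Gr_def)
  have "\<beta> i \<bullet> \<beta> j = (if i = j then 1 else 0)" if "i \<in> J" "j \<in> J" for i j
  proof -
    have mem: "\<beta> i \<in> ?B" "\<beta> j \<in> ?B" using \<beta> that by (auto simp: bij_betw_def)
    have "\<beta> i = \<beta> j \<longleftrightarrow> i = j"
      using that \<beta> by (auto simp: bij_betw_def dest: inj_onD)
    moreover have "b \<bullet> c = (if b = c then 1 else 0)" if "b \<in> ?B" "c \<in> ?B" for b c
    proof (cases "b = c")
      case True
      then show ?thesis using B that by (simp add: orthonormal_basis_of_def norm_eq_1)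
    next
      case False
      with B that have "orthogonal b c"
        unfolding orthonormal_basis_of_def by (blast dest: pairwiseD)
      with False show ?thesis by (simp add: orthogonal_def)
    qed
    ultimately show ?thesis using mem by simp
  qed
  moreover have "span (\<beta> ` J) = E"
    using B \<beta> by (simp add: orthonormal_basis_of_def bij_betw_def)
  ultimately have "frame J \<beta> E" by (simp add: frame_def)
  with \<beta> show ?thesis by blast
qed

text \<open>The matrix of \<open>T|\<^sub>E\<close> in the frame \<open>\<beta>\<close>, extended by the identity outside \<open>J\<close>.\<close>

definition frame_matrix :: "'m set \<Rightarrow> ('m \<Rightarrow> real^'n) \<Rightarrow> real^'n^'m \<Rightarrow> real^'m^'m" where
  "frame_matrix J \<beta> T = (\<chi> i j. if i \<in> J \<and> j \<in> J then T $ i \<bullet> \<beta> j else if i = j then 1 else 0)"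

lemma frame_matrix_mult:
  "(frame_matrix J \<beta> T *v y) $ i = (if i \<in> J then T $ i \<bullet> (\<Sum>j\<in>J. y $ j *\<^sub>R \<beta> j) else y $ i)"
proof (cases "i \<in> J")
  case True
  have "(frame_matrix J \<beta> T *v y) $ i = (\<Sum>j\<in>UNIV. if j \<in> J then y $ j * (T $ i \<bullet> \<beta> j) else 0)"
    unfolding matrix_vector_mult_def frame_matrix_def using True
    by (auto intro!: sum.cong)
  also have "\<dots> = (\<Sum>j\<in>J. y $ j * (T $ i \<bullet> \<beta> j))"
    by (simp add: sum.If_cases)
  finally show ?thesis using True by (simp add: inner_sum_right)
next
  case False
  then have "(frame_matrix J \<beta> T *v y) $ i = (\<Sum>j\<in>UNIV. (if i = j then 1 else 0) * y $ j)"
    unfolding matrix_vector_mult_def frame_matrix_def by simp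
  also have "\<dots> = (\<Sum>j\<in>UNIV. if j = i then y $ i else 0)"
    by (rule sum.cong) auto
  finally show ?thesis using False by simp
qed

text \<open>The indicator of a rectangle is a product of functions of one coordinate each, so its
  integral factorises.\<close>

lemma emeasure_lborel_vec_rectangle:
  fixes A :: "'m::finite \<Rightarrow> real set"
  assumes A: "\<And>i. A i \<in> sets borel"
  shows "emeasure lborel {y :: real^'m. \<forall>i. y $ i \<in> A i} = (\<Prod>i\<in>UNIV. emeasure lborel (A i))"
proof -
  \<comment> \<open>The product formula is indexed by \<open>Basis\<close>, so the index
    \<open>i\<close> has to be recovered from the vector \<open>axis i 1\<close>.\<close>
  define f where "f b = (\<lambda>t. indicator (A (SOME i. b = axis i 1)) t :: ennreal)" for b :: "real^'m"
  have fax: "f (axis i 1) = indicator (A i)" for i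
    by (simp add: f_def axis_eq_axis fun_eq_iff)
  have basis: "(\<Prod>b\<in>Basis. h b) = (\<Prod>i\<in>UNIV. h (axis i 1))" for h :: "real^'m \<Rightarrow> ennreal"
  proof -
    have "(Basis :: (real^'m) set) = (\<lambda>i. axis i 1) ` UNIV" by (auto simp: Basis_vec_def)
    moreover have "inj (\<lambda>i::'m. axis i (1::real))" by (auto simp: inj_on_def axis_eq_axis)
    ultimately show ?thesis by (metis (no_types) prod.reindex_cong)
  qed
  have [measurable]: "A i \<in> sets borel" for i by (rule A)
  have m: "{y :: real^'m. \<forall>i. y $ i \<in> A i} \<in> sets borel"
  proof -
    have "{y :: real^'m. \<forall>i. y $ i \<in> A i} = (\<Inter>i. (\<lambda>y. y $ i) -` A i \<inter> space borel)" by auto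
    also have "\<dots> \<in> sets borel"
      by (intro sets.countable_INT'' measurable_sets[OF _ A] borel_measurable_continuous_onI continuous_intros) auto
    finally show ?thesis .
  qed
  have "emeasure lborel {y :: real^'m. \<forall>i. y $ i \<in> A i}
      = (\<integral>\<^sup>+y. indicator {y :: real^'m. \<forall>i. y $ i \<in> A i} y \<partial>lborel)"
    using m by simp
  also have "\<dots> = (\<integral>\<^sup>+y. (\<Prod>b\<in>Basis. f b (y \<bullet> b)) \<partial>lborel)"
  proof (rule nn_integral_cong)
    fix y :: "real^'m"
    show "indicator {y. \<forall>i. y $ i \<in> A i} y = (\<Prod>b\<in>Basis. f b (y \<bullet> b))"
    proof (cases "\<forall>i. y $ i \<in> A i")
      case True
      then show ?thesis by (simp add: basis fax inner_axis)
    next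
      case False
      then obtain i where "y $ i \<notin> A i" by blast
      then have "f (axis i 1) (y \<bullet> axis i 1) = 0"
        by (simp add: fax inner_axis)
      then have "\<exists>i\<in>UNIV. f (axis i 1) (y \<bullet> axis i 1) = 0" by blast
      then show ?thesis using False by (simp add: basis)
    qed
  qed
  also have "\<dots> = (\<Prod>b\<in>Basis. (\<integral>\<^sup>+x. f b x \<partial>lborel))"
    by (rule nn_integral_lborel_prod) (auto simp: f_def intro: borel_measurable_indicator A)
  also have "\<dots> = (\<Prod>i\<in>UNIV. emeasure lborel (A i))"
    unfolding basis fax by simp
  finally show ?thesis .
qed

text \<open>Restrict Lebesgue measure to the slab \<open>H\<close>, where the coordinates outside
  \<open>J\<close> lie in the unit interval, and push it forward to the coordinates in
  \<open>J\<close>. This gives the product measure behind \<open>lborel_subspace\<close>, and the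
  cylinder is the corresponding preimage of \<open>K\<close>.\<close>

lemma measure_cyl_frame:
  fixes E :: "(real^'n) set" and J :: "'m::{finite,wellorder} set"
  assumes \<beta>: "frame J \<beta> E" "bij_betw \<beta> J (SOME B. orthonormal_basis_of E B)"
    and K: "body_set K \<subseteq> E"
  shows "measure lebesgue (body_set (cyl J (\<chi> i. \<beta> i) K)) = measure (lborel_subspace E) (body_set K)"
proof -
  define B where "B = (SOME B. orthonormal_basis_of E B)"
  have bij: "bij_betw \<beta> J B" using \<beta>(2) by (simp add: B_def)
  define \<gamma> where "\<gamma> = the_inv_into J \<beta>"
  have \<gamma>: "\<gamma> b \<in> J" "\<beta> (\<gamma> b) = b" if "b \<in> B" for b
    using that bij unfolding \<gamma>_def bij_betw_def
    by (auto intro: the_inv_into_into f_the_inv_into_f)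
  have \<gamma>\<beta>: "\<gamma> (\<beta> i) = i" if "i \<in> J" for i
    using that bij unfolding \<gamma>_def bij_betw_def by (auto intro: the_inv_into_f_f)
  have finB: "finite B" using bij by (metis bij_betw_finite finite)
  define H where "H = {y :: real^('m::{finite,wellorder}). \<forall>i. i \<notin> J \<longrightarrow> 0 \<le> y $ i \<and> y $ i \<le> 1}"
  define \<rho> where "\<rho> = (\<lambda>y :: real^('m::{finite,wellorder}). \<lambda>b\<in>B. y $ \<gamma> b)"
  have H: "H \<in> sets borel"
  proof -
    have "closed H" unfolding H_def
      by (intro closed_Collect_all closed_Collect_imp closed_Collect_conj closed_Collect_le
        continuous_intros) auto
    then show ?thesis by (rule borel_closed)
  qed
  have \<rho>[measurable]: "\<rho> \<in> measurable borel (PiM B (\<lambda>_. lborel))"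
    unfolding \<rho>_def
    by (rule measurable_restrict) (auto intro!: borel_measurable_continuous_onI continuous_intros)
  define N where "N = distr (restrict_space lborel H) (PiM B (\<lambda>_. lborel)) \<rho>"
  have \<rho>': "\<rho> \<in> measurable (restrict_space lborel H) (PiM B (\<lambda>_. lborel))"
    by (rule measurable_restrict_space1) simp
  have emN: "emeasure N X = emeasure lborel (\<rho> -` X \<inter> H)" if "X \<in> sets (PiM B (\<lambda>_. lborel))" for X
    unfolding N_def using that H
    by (simp add: emeasure_distr \<rho>' space_restrict_space emeasure_restrict_space)
  interpret product_sigma_finite "\<lambda>_ :: real^'n. lborel :: real measure" by standard
  have NPi: "N = PiM B (\<lambda>_. lborel)"
  proof (rule PiM_eqI[OF finB])
    fix A :: "real^'n \<Rightarrow> real set" assume A: "\<And>i. i \<in> B \<Longrightarrow> A i \<in> sets lborel"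
    \<comment> \<open>The coordinates outside \<open>J\<close> contribute unit intervals, hence
      factors one.\<close>
    define A' where "A' i = (if i \<in> J then A (\<beta> i) else {0..1})" for i
    have "\<rho> -` Pi\<^sub>E B A \<inter> H = {y. \<forall>i. y $ i \<in> A' i}"
    proof (intro set_eqI iffI)
      fix y assume y: "y \<in> \<rho> -` Pi\<^sub>E B A \<inter> H"
      have "y $ i \<in> A' i" for i
      proof (cases "i \<in> J")
        case True
        then have "\<beta> i \<in> B" using bij by (auto simp: bij_betw_def)
        with y have "\<rho> y (\<beta> i) \<in> A (\<beta> i)" by auto
        with True \<open>\<beta> i \<in> B\<close> show ?thesis by (simp add: \<rho>_def A'_def \<gamma>\<beta>)
      qed (use y in \<open>auto simp: A'_def H_def\<close>)
      then show "y \<in> {y. \<forall>i. y $ i \<in> A' i}" by simp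
    next
      fix y assume y: "y \<in> {y. \<forall>i. y $ i \<in> A' i}"
      then have "y $ \<gamma> b \<in> A b" if "b \<in> B" for b
        using \<gamma>[OF that] by (auto simp: A'_def dest: spec[of _ "\<gamma> b"])
      moreover have "0 \<le> y $ i \<and> y $ i \<le> 1" if "i \<notin> J" for i
        using y that by (auto simp: A'_def dest: spec[of _ i])
      ultimately show "y \<in> \<rho> -` Pi\<^sub>E B A \<inter> H"
        by (auto simp: \<rho>_def H_def)
    qed
    moreover have "A' i \<in> sets borel" for i
      using A bij by (auto simp: A'_def bij_betw_def)
    ultimately have "emeasure N (Pi\<^sub>E B A) = (\<Prod>i\<in>UNIV. emeasure lborel (A' i))"
      using emeasure_lborel_vec_rectangle[of A'] emN[OF sets_PiM_I_finite[OF finB A]] by simp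
    also have "\<dots> = (\<Prod>i\<in>J. emeasure lborel (A (\<beta> i)))"
      by (rule prod.mono_neutral_cong_right) (auto simp: A'_def)
    also have "\<dots> = (\<Prod>b\<in>B. emeasure lborel (A b))"
      by (rule prod.reindex_bij_betw[OF bij])
    finally show "emeasure N (Pi\<^sub>E B A) = (\<Prod>b\<in>B. emeasure lborel (A b))" .
  qed (simp add: N_def)
  define comb where "comb = (\<lambda>x. \<Sum>b\<in>B. x b *\<^sub>R b)"
  have comb: "comb \<in> measurable (PiM B (\<lambda>_. lborel)) borel"
    unfolding comb_def by (intro borel_measurable_sum borel_measurable_scaleR) auto
  have bK: "body_set K \<in> sets borel" by (simp add: borel_compact)
  have "emeasure (lborel_subspace E) (body_set K)
      = emeasure (PiM B (\<lambda>_. lborel)) (comb -` body_set K \<inter> space (PiM B (\<lambda>_. lborel)))"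
    unfolding lborel_subspace_def Let_def B_def[symmetric] comb_def[symmetric]
    by (rule emeasure_distr[OF comb bK])
  also have "\<dots> = emeasure lborel (\<rho> -` (comb -` body_set K \<inter> space (PiM B (\<lambda>_. lborel))) \<inter> H)"
    using emN[OF measurable_sets[OF comb bK]] NPi by simp
  also have "\<rho> -` (comb -` body_set K \<inter> space (PiM B (\<lambda>_. lborel))) \<inter> H = body_set (cyl J (\<chi> i. \<beta> i) K)"
  proof -
    have comb\<rho>: "comb (\<rho> y) = (\<Sum>i\<in>J. y $ i *\<^sub>R \<beta> i)" for y
    proof -
      have "comb (\<rho> y) = (\<Sum>b\<in>B. y $ \<gamma> b *\<^sub>R b)" by (simp add: comb_def \<rho>_def)
      also have "\<dots> = (\<Sum>i\<in>J. y $ \<gamma> (\<beta> i) *\<^sub>R \<beta> i)"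
        by (rule sum.reindex_bij_betw[OF bij, symmetric])
      finally show ?thesis by (simp add: \<gamma>\<beta>)
    qed
    \<comment> \<open>A point of \<open>E\<close> is the combination of its frame coordinates, so
      membership in \<open>K\<close> can be read off the coordinates in \<open>J\<close>.\<close>
    have "comb (\<rho> y) \<in> body_set K \<longleftrightarrow> (\<exists>x\<in>body_set K. \<forall>i\<in>J. y $ i = ((\<chi> i. \<beta> i) *v x) $ i)" for y
    proof
      assume "comb (\<rho> y) \<in> body_set K"
      then show "\<exists>x\<in>body_set K. \<forall>i\<in>J. y $ i = ((\<chi> i. \<beta> i) *v x) $ i"
        by (rule bexI[rotated])
          (auto simp: comb\<rho> matrix_vector_mul_component frame_inner_sum[OF \<beta>(1)])
    next
      assume "\<exists>x\<in>body_set K. \<forall>i\<in>J. y $ i = ((\<chi> i. \<beta> i) *v x) $ i"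
      then obtain x where x: "x \<in> body_set K" "\<And>i. i \<in> J \<Longrightarrow> y $ i = \<beta> i \<bullet> x"
        by (auto simp: matrix_vector_mul_component)
      then have "comb (\<rho> y) = x"
        using frame_expand[OF \<beta>(1), of x] K by (auto simp: comb\<rho> subset_iff)
      with x show "comb (\<rho> y) \<in> body_set K" by simp
    qed
    moreover have "\<rho> y \<in> space (PiM B (\<lambda>_. lborel))" for y
      by (simp add: space_PiM \<rho>_def)
    ultimately show ?thesis
      by (auto simp: mem_cyl_iff H_def)
  qed
  finally show ?thesis
    by (simp add: measure_def borel_compact)
qed

text \<open>On \<open>E\<close> the map \<open>T\<close> factors through frame coordinates, so the
  cylinder for \<open>T\<close> is the image of the cylinder for the frame under
  \<open>frame_matrix J \<beta> T\<close>; the volume scales by the absolute determinant.\<close>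

lemma apply_cyl_val_frame:
  fixes E :: "(real^'n) set" and J :: "'m::{finite,wellorder} set"
  assumes \<beta>: "frame J \<beta> E" "bij_betw \<beta> J (SOME B. orthonormal_basis_of E B)"
    and K: "body_set K \<subseteq> E"
  shows "apply_val (cyl_val J T) K = \<bar>det (frame_matrix J \<beta> T)\<bar> * measure (lborel_subspace E) (body_set K)"
proof -
  have "body_set (cyl J T K) = (*v) (frame_matrix J \<beta> T) ` body_set (cyl J (\<chi> i. \<beta> i) K)"
    (is "?L = ?M ` ?R")
  proof (intro set_eqI iffI)
    fix y assume "y \<in> ?L"
    then obtain x where x: "x \<in> body_set K" "\<And>i. i \<in> J \<Longrightarrow> y $ i = T $ i \<bullet> x"
      and y: "\<And>i. i \<notin> J \<Longrightarrow> 0 \<le> y $ i \<and> y $ i \<le> 1"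
      by (auto simp: mem_cyl_iff matrix_vector_mul_component)
    \<comment> \<open>The preimage of \<open>y\<close>: the frame coordinates of \<open>x\<close> on
      \<open>J\<close>, and \<open>y\<close> itself where the matrix is the identity.\<close>
    define z where "z = (\<chi> i. if i \<in> J then \<beta> i \<bullet> x else y $ i)"
    have "(\<Sum>j\<in>J. z $ j *\<^sub>R \<beta> j) = (\<Sum>j\<in>J. (\<beta> j \<bullet> x) *\<^sub>R \<beta> j)"
      by (rule sum.cong) (auto simp: z_def)
    also have "\<dots> = x" using frame_expand[OF \<beta>(1)] x(1) K by auto
    finally have zx: "(\<Sum>j\<in>J. z $ j *\<^sub>R \<beta> j) = x" .
    have "y = ?M z"
      unfolding vec_eq_iff frame_matrix_mult zx using x by (simp add: z_def)
    moreover have "z \<in> ?R"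
      using x(1) y by (auto simp: mem_cyl_iff matrix_vector_mul_component z_def)
    ultimately show "y \<in> ?M ` ?R" by blast
  next
    fix y assume "y \<in> ?M ` ?R"
    then obtain z x where z: "y = ?M z" and x: "x \<in> body_set K" "\<And>i. i \<in> J \<Longrightarrow> z $ i = \<beta> i \<bullet> x"
      and zb: "\<And>i. i \<notin> J \<Longrightarrow> 0 \<le> z $ i \<and> z $ i \<le> 1"
      by (auto simp: mem_cyl_iff matrix_vector_mul_component)
    have "(\<Sum>j\<in>J. z $ j *\<^sub>R \<beta> j) = (\<Sum>j\<in>J. (\<beta> j \<bullet> x) *\<^sub>R \<beta> j)"
      by (rule sum.cong) (auto simp: x)
    also have "\<dots> = x" using frame_expand[OF \<beta>(1)] x(1) K by auto
    finally have "y $ i = (if i \<in> J then T $ i \<bullet> x else z $ i)" for i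
      unfolding z frame_matrix_mult by simp
    then show "y \<in> ?L"
      using x(1) zb by (auto simp: mem_cyl_iff matrix_vector_mul_component)
  qed
  then have "apply_val (cyl_val J T) K
      = \<bar>det (matrix (?M))\<bar> * measure lebesgue (body_set (cyl J (\<chi> i. \<beta> i) K))"
    unfolding apply_cyl_val by (simp only: measure_linear_image matrix_vector_mul_linear lmeasurable_body_set)
  then show ?thesis
    unfolding measure_cyl_frame[OF \<beta> K] by simp
qed


section \<open>Independence of the absolute determinants\<close>

text \<open>A substitute for multivariate polynomials.\<close>

definition linewise_poly :: "('a::real_vector \<Rightarrow> real) \<Rightarrow> bool" where
  "linewise_poly f \<longleftrightarrow> (\<forall>x y. \<exists>p. \<forall>s. f (x + s *\<^sub>R y) = poly p s)"

lemma linewise_poly_const: "linewise_poly (\<lambda>x. c)"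
  unfolding linewise_poly_def by (auto intro!: exI[of _ "[:c:]"])

lemma linewise_poly_linear: "linear l \<Longrightarrow> linewise_poly l"
  unfolding linewise_poly_def
  by (auto intro!: exI[of _ "[:l x, l y:]" for x y] simp: linear_add linear_scale)

lemma linewise_poly_add: "linewise_poly f \<Longrightarrow> linewise_poly g \<Longrightarrow> linewise_poly (\<lambda>x. f x + g x)"
  unfolding linewise_poly_def by (metis poly_add)

lemma linewise_poly_mult: "linewise_poly f \<Longrightarrow> linewise_poly g \<Longrightarrow> linewise_poly (\<lambda>x. f x * g x)"
  unfolding linewise_poly_def by (metis poly_mult)

lemma linewise_poly_sum: "(\<And>i. i \<in> I \<Longrightarrow> linewise_poly (f i)) \<Longrightarrow> linewise_poly (\<lambda>x. \<Sum>i\<in>I. f i x)"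
  by (induction I rule: infinite_finite_induct) (auto intro: linewise_poly_const linewise_poly_add)

lemma linewise_poly_prod: "(\<And>i. i \<in> I \<Longrightarrow> linewise_poly (f i)) \<Longrightarrow> linewise_poly (\<lambda>x. \<Prod>i\<in>I. f i x)"
  by (induction I rule: infinite_finite_induct) (auto intro: linewise_poly_const linewise_poly_mult)

lemma linewise_poly_det:
  fixes M :: "'a::real_vector \<Rightarrow> real^'m^'m"
  assumes "\<And>i j. linewise_poly (\<lambda>x. M x $ i $ j)"
  shows "linewise_poly (\<lambda>x. det (M x))"
  unfolding det_def
  by (intro linewise_poly_sum linewise_poly_mult linewise_poly_prod linewise_poly_const assms)

lemma linewise_poly_shift:
  assumes "linewise_poly f"
  shows "linewise_poly (\<lambda>x. f (x + a))"
  unfolding linewise_poly_def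
proof (intro allI)
  fix x y
  show "\<exists>p. \<forall>s. f (x + s *\<^sub>R y + a) = poly p s"
    using assms[unfolded linewise_poly_def, rule_format, of "x + a" y] by (simp add: ac_simps)
qed

text \<open>By induction on \<open>F\<close>, with \<open>x\<close> good for the old functions and
  \<open>y\<close> for the new one. On the line through \<open>x\<close> and \<open>y\<close> each
  function is a nonzero polynomial, so all but finitely many points of the line are good.\<close>

lemma common_nonzero:
  fixes F :: "('a::real_vector \<Rightarrow> real) set"
  assumes "finite F" "subspace U" "\<And>f. f \<in> F \<Longrightarrow> linewise_poly f" "\<And>f. f \<in> F \<Longrightarrow> \<exists>x\<in>U. f x \<noteq> 0"
  shows "\<exists>x\<in>U. \<forall>f\<in>F. f x \<noteq> 0"
  using assms(1,3,4)
proof (induction F)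
  case empty
  then show ?case using subspace_0[OF assms(2)] by auto
next
  case (insert f F)
  obtain x where x: "x \<in> U" "\<And>g. g \<in> F \<Longrightarrow> g x \<noteq> 0"
    using insert by (metis insert_iff)
  obtain y where y: "y \<in> U" "f y \<noteq> 0"
    using insert.prems(2) by blast
  have "\<forall>g\<in>insert f F. \<exists>p. \<forall>s. g (x + s *\<^sub>R (y - x)) = poly p s"
    using insert.prems(1) unfolding linewise_poly_def by blast
  from bchoice[OF this] obtain P
    where P: "\<And>g s. g \<in> insert f F \<Longrightarrow> g (x + s *\<^sub>R (y - x)) = poly (P g) s"
    by blast
  \<comment> \<open>Old functions are nonzero at \<open>s = 0\<close>, which is \<open>x\<close>;
    the new one is nonzero at \<open>s = 1\<close>, which is \<open>y\<close>.\<close>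
  have "P g \<noteq> 0" if "g \<in> insert f F" for g
    using P[OF that, of 0] P[OF that, of 1] that x(2) y(2) by auto
  then have "finite (\<Union>g\<in>insert f F. {s. poly (P g) s = 0})"
    using insert.hyps(1) by (intro finite_UN_I) (auto intro: poly_roots_finite)
  then obtain s where "s \<notin> (\<Union>g\<in>insert f F. {s. poly (P g) s = 0})"
    using ex_new_if_finite infinite_UNIV_char_0 by blast
  then have "\<forall>g\<in>insert f F. g (x + s *\<^sub>R (y - x)) \<noteq> 0"
    using P by auto
  moreover have "x + s *\<^sub>R (y - x) \<in> U"
    using x(1) y(1) assms(2) by (intro subspace_add subspace_scale subspace_diff)
  ultimately show ?case by blast
qed

section \<open>Absolute values and determinants along lines\<close>

lemma abs_poly_differentiable:
  fixes p :: "real poly"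
  assumes "poly p 0 \<noteq> 0"
  shows "(\<lambda>s. \<bar>poly p s\<bar>) differentiable (at 0)"
proof -
  have "((\<lambda>s. sgn (poly p 0) * poly p s) has_real_derivative sgn (poly p 0) * poly (pderiv p) 0) (at 0)"
    by (intro DERIV_cmult poly_DERIV)
  then have "((\<lambda>s. \<bar>poly p s\<bar>) has_derivative (*) (sgn (poly p 0) * poly (pderiv p) 0)) (at 0)"
    unfolding has_field_derivative_def
  proof (rule has_derivative_transform_within_open)
    show "open {s. 0 < poly p 0 * poly p s}"
      by (intro open_Collect_less continuous_intros)
    show "sgn (poly p 0) * poly p s = \<bar>poly p s\<bar>" if "s \<in> {s. 0 < poly p 0 * poly p s}" for s
      using that by (auto simp: zero_less_mult_iff)
  qed (use assms in \<open>auto simp: zero_less_mult_iff\<close>)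
  then show ?thesis by (auto simp: differentiable_def)
qed

text \<open>The one-sided difference quotients at zero are constantly \<open>c\<close> and
  \<open>- c\<close>.\<close>

lemma abs_linear_coefficient_zero:
  fixes c :: real
  assumes "(\<lambda>s. c * \<bar>s\<bar>) differentiable (at 0)"
  shows "c = 0"
proof -
  obtain D where "((\<lambda>s. c * \<bar>s\<bar>) has_real_derivative D) (at 0)"
    using assms by (auto simp: real_differentiable_def)
  then have lim: "((\<lambda>h. c * \<bar>h\<bar> / h) \<longlongrightarrow> D) (at 0)"
    by (simp add: has_field_derivative_iff)
  have "((\<lambda>h. c * \<bar>h\<bar> / h) \<longlongrightarrow> c) (at_right 0)"
    by (rule Lim_transform_eventually[OF tendsto_const])
      (auto simp: eventually_at_right_field intro!: exI[of _ 1])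
  moreover have "((\<lambda>h. c * \<bar>h\<bar> / h) \<longlongrightarrow> - c) (at_left 0)"
    by (rule Lim_transform_eventually[OF tendsto_const])
      (auto simp: eventually_at_left_field intro!: exI[of _ "-1"])
  ultimately have "D = c" "D = - c"
    using lim unfolding filterlim_at_split
    by (auto intro: tendsto_unique[OF trivial_limit_at_right_real] tendsto_unique[OF trivial_limit_at_left_real])
  then show "c = 0" by simp
qed

text \<open>A kernel vector \<open>y\<close> gives a vector of \<open>E\<close> with frame
  coordinates \<open>y\<close>, killed by the rows of \<open>T\<close> in \<open>J\<close> and hence
  zero. So \<open>y\<close> vanishes on \<open>J\<close>, and elsewhere because the matrix is the
  identity there.\<close>

lemma det_frame_matrix_nonzero:
  fixes E :: "(real^'n) set" and J :: "'m::finite set"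
  assumes \<beta>: "frame J \<beta> E" and inj: "\<And>z. z \<in> E \<Longrightarrow> (\<And>i. i \<in> J \<Longrightarrow> T $ i \<bullet> z = 0) \<Longrightarrow> z = 0"
  shows "det (frame_matrix J \<beta> T) \<noteq> 0"
proof -
  have "y = 0" if y: "frame_matrix J \<beta> T *v y = 0" for y
  proof -
    let ?z = "\<Sum>j\<in>J. y $ j *\<^sub>R \<beta> j"
    have c: "(if i \<in> J then T $ i \<bullet> ?z else y $ i) = 0" for i
      using y frame_matrix_mult[of J \<beta> T y i] by simp
    have "?z \<in> E"
      using frame_mem[OF \<beta>] subspace_span[of "\<beta> ` J"] \<beta>
      by (auto simp: frame_def intro!: span_sum span_scale)
    moreover have "T $ i \<bullet> ?z = 0" if "i \<in> J" for i
      using c[of i] that by simp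
    ultimately have "?z = 0" by (rule inj)
    then have "y $ i = 0" if "i \<in> J" for i
      using frame_inner_sum[OF \<beta> that, of "\<lambda>j. y $ j"] by simp
    moreover have "y $ i = 0" if "i \<notin> J" for i
      using c[of i] that by simp
    ultimately show "y = 0" by (simp add: vec_eq_iff) metis
  qed
  then show ?thesis
    unfolding invertible_det_nz[symmetric] invertible_left_inverse matrix_left_invertible_ker by blast
qed

text \<open>The frame coordinates of \<open>v\<close>, padded with zeros outside \<open>J\<close>,
  form a nonzero kernel vector.\<close>

lemma det_frame_matrix_zero:
  fixes E :: "(real^'n) set" and J :: "'m::finite set"
  assumes \<beta>: "frame J \<beta> E" and v: "v \<in> E" "v \<noteq> 0" "\<And>i. i \<in> J \<Longrightarrow> T $ i \<bullet> v = 0"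
  shows "det (frame_matrix J \<beta> T) = 0"
proof (rule ccontr)
  assume "\<not> ?thesis"
  then have ker: "\<And>y. frame_matrix J \<beta> T *v y = 0 \<Longrightarrow> y = 0"
    unfolding invertible_det_nz[symmetric] invertible_left_inverse matrix_left_invertible_ker by blast
  define y where "y = (\<chi> j. if j \<in> J then \<beta> j \<bullet> v else 0)"
  have "(\<Sum>j\<in>J. y $ j *\<^sub>R \<beta> j) = (\<Sum>j\<in>J. (\<beta> j \<bullet> v) *\<^sub>R \<beta> j)"
    by (rule sum.cong) (auto simp: y_def)
  also have "\<dots> = v" using frame_expand[OF \<beta> _ v(1)] by simp
  finally have yv: "(\<Sum>j\<in>J. y $ j *\<^sub>R \<beta> j) = v" .
  have "frame_matrix J \<beta> T *v y = 0"
    unfolding vec_eq_iff frame_matrix_mult yv using v(3) by (simp add: y_def)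
  then have "y = 0" by (rule ker)
  with yv v(2) show False by simp
qed

lemma linewise_poly_det_frame_matrix: "linewise_poly (\<lambda>T. det (frame_matrix J \<beta> T))"
proof (rule linewise_poly_det)
  fix i j
  show "linewise_poly (\<lambda>T. frame_matrix J \<beta> T $ i $ j)"
  proof (cases "i \<in> J \<and> j \<in> J")
    case True
    have "linear (\<lambda>T. T $ i \<bullet> \<beta> j)"
      by (rule linearI) (simp_all add: inner_add_left)
    from linewise_poly_linear[OF this] True show ?thesis by (simp add: frame_matrix_def)
  next
    case False
    then have "(\<lambda>T. frame_matrix J \<beta> T $ i $ j) = (\<lambda>T. if i = j then 1 else 0)"
      by (auto simp: frame_matrix_def)
    then show ?thesis by (simp add: linewise_poly_const)
  qed
qed

text \<open>Only row \<open>i0\<close> changes, and the determinant is affine in each row. This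
  yields the line on which the determinant of the first subspace is linear.\<close>

lemma det_frame_matrix_row:
  fixes J :: "'m::finite set"
  assumes "i0 \<in> J"
  shows "det (frame_matrix J \<beta> (T + s *\<^sub>R (\<chi> i. if i = i0 then v else 0)))
       = det (frame_matrix J \<beta> T) + s * det (\<chi> i. if i = i0 then (\<chi> j. if j \<in> J then v \<bullet> \<beta> j else 0)
                                              else frame_matrix J \<beta> T $ i)"
proof -
  let ?M = "frame_matrix J \<beta> T" and ?r = "\<chi> j. if j \<in> J then v \<bullet> \<beta> j else (0 :: real)"
  have "frame_matrix J \<beta> (T + s *\<^sub>R (\<chi> i. if i = i0 then v else 0))
      = (\<chi> i. if i = i0 then ?M $ i0 + s *s ?r else ?M $ i)"
    using assms by (auto simp: vec_eq_iff frame_matrix_def inner_add_left)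
  moreover have "(\<chi> i. if i = i0 then ?M $ i0 else ?M $ i) = ?M"
    by (simp add: vec_eq_iff)
  ultimately show ?thesis
    using det_row_add[of i0 "\<lambda>i. ?M $ i0" "\<lambda>i. s *s ?r" "\<lambda>i. ?M $ i"]
      det_row_mul[of i0 s "\<lambda>i. ?r" "\<lambda>i. ?M $ i"] by simp
qed

text \<open>Take any \<open>w\<close> in \<open>E\<close> outside \<open>F\<close>, and for
  \<open>q\<close> its component orthogonal to \<open>F\<close>.\<close>

lemma exists_normal_vector:
  fixes E F :: "'a::euclidean_space set"
  assumes "subspace F" "\<not> E \<subseteq> F"
  obtains q w where "w \<in> E" "q \<bullet> w \<noteq> 0" "\<And>x. x \<in> F \<Longrightarrow> q \<bullet> x = 0"
proof -
  obtain w where w: "w \<in> E" "w \<notin> F" using assms(2) by blast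
  have sp: "span F = F" using assms(1) by simp
  obtain p q where pq: "p \<in> span F" "\<And>x. x \<in> span F \<Longrightarrow> orthogonal q x" "w = p + q"
    using orthogonal_subspace_decomp_exists[of F w] by metis
  then have "q \<noteq> 0" using w sp by auto
  moreover have "q \<bullet> w = q \<bullet> q"
    using pq by (simp add: inner_add_right orthogonal_def)
  ultimately show thesis
    using that[OF w(1), of q] pq(2) sp by (auto simp: orthogonal_def)
qed

lemma abs_det_frame_matrix_independent:
  fixes S :: "(real^'n) set set" and J :: "'m::finite set"
  assumes S: "finite S" "S \<subseteq> Gr (card J)" and J: "J \<noteq> {}"
    and \<beta>: "\<And>E. E \<in> S \<Longrightarrow> frame J (\<beta> E) E"
    and zero: "\<And>T. (\<Sum>E\<in>S. a E * \<bar>det (frame_matrix J (\<beta> E) T)\<bar>) = 0"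
    and E0: "E0 \<in> S"
  shows "a E0 = 0"
proof -
  have sub: "subspace E" "dim E = card J" if "E \<in> S" for E
    using S(2) that by (auto simp: Gr_def)
  \<comment> \<open>Each other subspace has a normal vector that is not normal to \<open>E0\<close>;
    a vector not orthogonal to it lies outside that subspace.\<close>
  have "\<exists>q w. w \<in> E0 \<and> q \<bullet> w \<noteq> 0 \<and> (\<forall>x\<in>E. q \<bullet> x = 0)" if E: "E \<in> S - {E0}" for E
  proof -
    have "\<not> E0 \<subseteq> E"
      using subspace_dim_equal[of E0 E] sub E E0 by auto
    with sub(1) E show ?thesis by (metis DiffD1 exists_normal_vector)
  qed
  then obtain q where q: "\<And>E. E \<in> S - {E0} \<Longrightarrow> \<exists>w\<in>E0. q E \<bullet> w \<noteq> 0"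
    "\<And>E x. E \<in> S - {E0} \<Longrightarrow> x \<in> E \<Longrightarrow> q E \<bullet> x = 0"
    by metis
  obtain i1 where i1: "i1 \<in> J" using J by blast
  have b1: "\<beta> E0 i1 \<in> E0" "\<beta> E0 i1 \<bullet> \<beta> E0 i1 = 1"
    using \<beta>[OF E0] i1 frame_mem[of J "\<beta> E0" E0 i1] by (auto simp: frame_def)
  \<comment> \<open>The functional \<open>\<beta> E0 i1\<close> is added so that the vector is
    nonzero even when \<open>E0\<close> is the only subspace.\<close>
  have "\<exists>x\<in>E0. \<forall>f\<in>insert ((\<bullet>) (\<beta> E0 i1)) ((\<lambda>E. (\<bullet>) (q E)) ` (S - {E0})). f x \<noteq> 0"
  proof (rule common_nonzero)
    show "linewise_poly f" if "f \<in> insert ((\<bullet>) (\<beta> E0 i1)) ((\<lambda>E. (\<bullet>) (q E)) ` (S - {E0}))" for f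
      using that by (auto intro!: linewise_poly_linear bounded_linear.linear bounded_linear_inner_right)
    show "\<exists>x\<in>E0. f x \<noteq> 0" if "f \<in> insert ((\<bullet>) (\<beta> E0 i1)) ((\<lambda>E. (\<bullet>) (q E)) ` (S - {E0}))" for f
    proof (cases "f = (\<bullet>) (\<beta> E0 i1)")
      case True
      then show ?thesis using b1 by (intro bexI[of _ "\<beta> E0 i1"]) simp_all
    next
      case False
      then obtain E where "E \<in> S - {E0}" "f = (\<bullet>) (q E)" using \<open>f \<in> _\<close> by blast
      then show ?thesis using q(1)[of E] by blast
    qed
  qed (use S sub(1)[OF E0] in auto)
  then obtain v0 where v0: "v0 \<in> E0" "\<beta> E0 i1 \<bullet> v0 \<noteq> 0" "\<And>E. E \<in> S - {E0} \<Longrightarrow> q E \<bullet> v0 \<noteq> 0"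
    by auto
  define v where "v = v0 /\<^sub>R norm v0"
  have "v0 \<noteq> 0" using v0(2) by auto
  then have "norm v = 1" by (simp add: v_def)
  then have vv: "v \<bullet> v = 1" by (simp only: norm_eq_1)
  have v: "v \<in> E0" "v \<bullet> v = 1" "\<And>E. E \<in> S - {E0} \<Longrightarrow> q E \<bullet> v \<noteq> 0"
    using v0 sub(1)[OF E0] \<open>v0 \<noteq> 0\<close>
    by (auto simp: vv) (auto simp: v_def subspace_scale)
  have vnot: "c = 0" if "E \<in> S - {E0}" "c *\<^sub>R v \<in> E" for E c
    using q(2)[OF that] v(3)[OF that(1)] by simp
  \<comment> \<open>Row \<open>i0\<close> is the one that will be perturbed, by multiples of
    \<open>v\<close>.\<close>
  have "\<exists>i0\<in>J. \<beta> E0 i0 \<bullet> v \<noteq> 0"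
  proof (rule ccontr)
    assume "\<not> ?thesis"
    then have "v = 0" using frame_expand[OF \<beta>[OF E0] _ v(1)] by simp
    with v(2) show False by simp
  qed
  then obtain i0 where i0: "i0 \<in> J" "\<beta> E0 i0 \<bullet> v \<noteq> 0" by blast
  define V :: "real^'n^'m" where "V = (\<chi> i. if i = i0 then v else 0)"
  define U where "U = {T :: real^'n^'m. \<forall>i\<in>J. T $ i \<bullet> v = 0}"
  define p where "p x = x - (x \<bullet> v) *\<^sub>R v" for x
  have pv: "p x \<bullet> v = 0" for x using v(2) by (simp add: p_def inner_diff_left)
  \<comment> \<open>Genericity on \<open>U\<close>: the determinants of the other subspaces must not
    vanish at \<open>T\<close>, and that of \<open>E0\<close> must not vanish at
    \<open>T + V\<close>, where its value is the slope along the line.\<close>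
  define F where "F = insert (\<lambda>T. det (frame_matrix J (\<beta> E0) (T + V)))
    ((\<lambda>E T. det (frame_matrix J (\<beta> E) T)) ` (S - {E0}))"
  have "\<exists>T\<in>U. \<forall>f\<in>F. f T \<noteq> 0"
  proof (rule common_nonzero)
    show "finite F" using S by (simp add: F_def)
    show "subspace U"
      unfolding U_def by (auto simp: subspace_def inner_add_left)
    show "linewise_poly f" if "f \<in> F" for f
      using that linewise_poly_shift[OF linewise_poly_det_frame_matrix[of J "\<beta> E0"], of V]
      by (auto simp: F_def linewise_poly_det_frame_matrix)
    show "\<exists>T\<in>U. f T \<noteq> 0" if f: "f \<in> F" for f
    proof (cases "f = (\<lambda>T. det (frame_matrix J (\<beta> E0) (T + V)))")
      case True
      \<comment> \<open>In \<open>T + V\<close> row \<open>i0\<close> becomes \<open>v\<close> and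
        the others are frame vectors projected off \<open>v\<close>. A kernel vector in
        \<open>E0\<close> is thus orthogonal to \<open>v\<close> and to all frame vectors but
        \<open>\<beta> E0 i0\<close>, so the choice of \<open>i0\<close> forces it to be
        zero.\<close>
      define T where "T = (\<chi> i. if i = i0 then 0 else p (\<beta> E0 i))"
      have TV: "(T + V) $ i = (if i = i0 then v else p (\<beta> E0 i))" for i
        by (simp add: T_def V_def)
      have "det (frame_matrix J (\<beta> E0) (T + V)) \<noteq> 0"
      proof (rule det_frame_matrix_nonzero[OF \<beta>[OF E0]])
        fix z assume z: "z \<in> E0" "\<And>i. i \<in> J \<Longrightarrow> (T + V) $ i \<bullet> z = 0"
        have zv: "z \<bullet> v = 0" using z(2)[OF i0(1)] unfolding TV by (simp add: inner_commute)
        have "\<beta> E0 i \<bullet> z = 0" if "i \<in> J" "i \<noteq> i0" for i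
          using z(2)[OF that(1)] that(2) zv unfolding TV
          by (simp add: p_def inner_diff_left inner_commute[of v z])
        then have "(\<Sum>j\<in>J. (\<beta> E0 j \<bullet> z) *\<^sub>R \<beta> E0 j) = (\<Sum>j\<in>J. if j = i0 then (\<beta> E0 i0 \<bullet> z) *\<^sub>R \<beta> E0 i0 else 0)"
          by (intro sum.cong) auto
        then have ze: "z = (\<beta> E0 i0 \<bullet> z) *\<^sub>R \<beta> E0 i0"
          using frame_expand[OF \<beta>[OF E0] _ z(1)] i0(1) by simp
        have "(\<beta> E0 i0 \<bullet> z) * (\<beta> E0 i0 \<bullet> v) = 0"
          using zv by (subst (asm) ze) simp
        then show "z = 0" using i0(2) ze by simp
      qed
      moreover have "T \<in> U" by (simp add: U_def T_def pv)
      ultimately show ?thesis using True by blast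
    next
      case False
      then obtain E where E: "E \<in> S - {E0}" and fE: "f = (\<lambda>T. det (frame_matrix J (\<beta> E) T))"
        using f by (auto simp: F_def)
      have \<beta>E: "frame J (\<beta> E) E" using \<beta> E by blast
      \<comment> \<open>On \<open>E\<close> this has the same kernel as the projection
        \<open>p\<close>: if all rows kill \<open>z\<close>, then \<open>p z\<close> is orthogonal
        to \<open>z\<close>, hence zero, so \<open>z\<close> is a multiple of \<open>v\<close> in
        \<open>E\<close> and vanishes.\<close>
      define T where "T = (\<chi> i. p (\<beta> E i))"
      have plin: "p (\<Sum>j\<in>J. c j *\<^sub>R x j) = (\<Sum>j\<in>J. c j *\<^sub>R p (x j))" for c x
        by (simp add: p_def inner_sum_left scaleR_sum_left scaleR_diff_right sum_subtractf)
      have "det (frame_matrix J (\<beta> E) T) \<noteq> 0"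
      proof (rule det_frame_matrix_nonzero[OF \<beta>E])
        fix z assume z: "z \<in> E" "\<And>i. i \<in> J \<Longrightarrow> T $ i \<bullet> z = 0"
        have ze: "z = (\<Sum>j\<in>J. (\<beta> E j \<bullet> z) *\<^sub>R \<beta> E j)"
          using frame_expand[OF \<beta>E _ z(1)] by simp
        have "p z \<bullet> z = (\<Sum>j\<in>J. (\<beta> E j \<bullet> z) *\<^sub>R p (\<beta> E j)) \<bullet> z"
          using plin[of "\<lambda>j. \<beta> E j \<bullet> z" "\<beta> E"] ze by simp
        also have "\<dots> = 0" using z(2) by (simp add: inner_sum_left T_def)
        finally have "p z \<bullet> z = 0" .
        moreover have "p z \<bullet> z = p z \<bullet> p z"
          using arg_cong[OF p_def[of z], of "(\<bullet>) (p z)"] by (simp add: inner_diff_right pv)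
        ultimately have "p z = 0" by simp
        then have "z = (z \<bullet> v) *\<^sub>R v" by (simp add: p_def)
        then show "z = 0" using vnot[OF E, of "z \<bullet> v"] z(1) by auto
      qed
      moreover have "T \<in> U" by (simp add: U_def T_def pv)
      ultimately show ?thesis using fE by blast
    qed
  qed
  then obtain T where T: "T \<in> U" "\<And>f. f \<in> F \<Longrightarrow> f T \<noteq> 0" by blast
  define c where "c = det (frame_matrix J (\<beta> E0) (T + V))"
  have c: "c \<noteq> 0"
    using T(2)[of "\<lambda>T. det (frame_matrix J (\<beta> E0) (T + V))"] by (simp add: F_def c_def)
  have "v \<noteq> 0" using v(2) by auto
  then have "det (frame_matrix J (\<beta> E0) T) = 0"
    using T(1) by (intro det_frame_matrix_zero[OF \<beta>[OF E0] v(1)]) (auto simp: U_def)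
  \<comment> \<open>The determinant is affine in \<open>s\<close>, with value \<open>0\<close> at
    \<open>s = 0\<close> and \<open>c\<close> at \<open>s = 1\<close>.\<close>
  then have E0s: "det (frame_matrix J (\<beta> E0) (T + s *\<^sub>R V)) = s * c" for s
    using det_frame_matrix_row[OF i0(1), of "\<beta> E0" T s v] det_frame_matrix_row[OF i0(1), of "\<beta> E0" T 1 v]
    by (simp add: V_def c_def)
  have diff: "(\<lambda>s. \<bar>det (frame_matrix J (\<beta> E) (T + s *\<^sub>R V))\<bar>) differentiable (at 0)" if E: "E \<in> S - {E0}" for E
  proof -
    obtain P where P: "\<And>s. det (frame_matrix J (\<beta> E) (T + s *\<^sub>R V)) = poly P s"
      using linewise_poly_det_frame_matrix[of J "\<beta> E"] unfolding linewise_poly_def by metis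
    have "det (frame_matrix J (\<beta> E) T) \<noteq> 0"
      using T(2)[of "\<lambda>T. det (frame_matrix J (\<beta> E) T)"] E by (auto simp: F_def)
    then show ?thesis
      using P[of 0] abs_poly_differentiable[of P] by (simp add: P)
  qed
  \<comment> \<open>Isolating the term of \<open>E0\<close> leaves a sum of functions differentiable
    at zero on the other side.\<close>
  have "(\<lambda>s. (- a E0 * \<bar>c\<bar>) * \<bar>s\<bar>) = (\<lambda>s. \<Sum>E\<in>S - {E0}. a E * \<bar>det (frame_matrix J (\<beta> E) (T + s *\<^sub>R V))\<bar>)"
  proof
    fix s
    show "(- a E0 * \<bar>c\<bar>) * \<bar>s\<bar> = (\<Sum>E\<in>S - {E0}. a E * \<bar>det (frame_matrix J (\<beta> E) (T + s *\<^sub>R V))\<bar>)"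
      using zero[of "T + s *\<^sub>R V"] sum.remove[OF S(1) E0, of "\<lambda>E. a E * \<bar>det (frame_matrix J (\<beta> E) (T + s *\<^sub>R V))\<bar>"]
      by (simp add: E0s abs_mult algebra_simps)
  qed
  moreover have "(\<lambda>s. \<Sum>E\<in>S - {E0}. a E * \<bar>det (frame_matrix J (\<beta> E) (T + s *\<^sub>R V))\<bar>) differentiable (at 0)"
    using S(1) diff by (intro differentiable_sum differentiable_mult differentiable_const) auto
  ultimately have "- a E0 * \<bar>c\<bar> = 0"
    by (intro abs_linear_coefficient_zero) simp
  then show ?thesis using c by simp
qed


section \<open>Averages of volumes of linear images\<close>

text \<open>The change of variables theorems of HOL-Analysis are restricted to well-ordered index types;
  this copy of an arbitrary finite type has an arbitrary well-order.\<close>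

datatype 'a wo = Wo (un_Wo: 'a)

lemma bij_Wo: "bij Wo"
  by (rule bijI') (auto intro: wo.exhaust)

instance wo :: (finite) finite
proof
  show "finite (UNIV :: 'a wo set)"
    using bij_Wo[where 'a='a] unfolding bij_def by (metis finite finite_imageI)
qed

lemma CARD_wo: "CARD('a wo) = CARD('a)"
  using bij_betw_same_card[OF bij_Wo[where 'a='a]] by simp

instantiation wo :: (finite) wellorder
begin

definition wo_rank :: "'a wo \<Rightarrow> nat" where
  "wo_rank = (SOME f. inj f)"

definition less_eq_wo :: "'a wo \<Rightarrow> 'a wo \<Rightarrow> bool" where
  "less_eq_wo x y \<longleftrightarrow> wo_rank x \<le> wo_rank y"

definition less_wo :: "'a wo \<Rightarrow> 'a wo \<Rightarrow> bool" where
  "less_wo x y \<longleftrightarrow> wo_rank x < wo_rank y"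

lemma inj_wo_rank: "inj (wo_rank :: 'a wo \<Rightarrow> nat)"
proof -
  obtain f :: "'a wo \<Rightarrow> nat" where "inj f"
    using finite_imp_inj_to_nat_seg[OF finite[of "UNIV::'a wo set"]] by blast
  then show ?thesis unfolding wo_rank_def by (rule someI[of inj])
qed

instance
proof
  fix P :: "'a wo \<Rightarrow> bool" and a :: "'a wo"
  assume *: "\<And>x. (\<And>y. y < x \<Longrightarrow> P y) \<Longrightarrow> P x"
  show "P a"
  proof (induction "wo_rank a" arbitrary: a rule: less_induct)
    case less
    show ?case by (rule *) (use less in \<open>simp add: less_wo_def\<close>)
  qed
next
  fix x y z :: "'a wo"
  show "x < y \<longleftrightarrow> x \<le> y \<and> \<not> y \<le> x" "x \<le> x" "x \<le> y \<or> y \<le> x"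
    unfolding less_eq_wo_def less_wo_def by linarith+
  show "x \<le> z" if "x \<le> y" "y \<le> z"
    using that unfolding less_eq_wo_def by linarith
  show "x = y" if "x \<le> y" "y \<le> x"
    using that unfolding less_eq_wo_def by (intro injD[OF inj_wo_rank]) linarith
qed

end

text \<open>The change of variables theorem needs vectors rather than matrices as integration variables.\<close>

definition to_mat :: "real^(('m::finite \<times> 'n::finite) wo) \<Rightarrow> real^'n^'m" where
  "to_mat t = (\<chi> i j. t $ Wo (i, j))"

definition of_mat :: "real^'n^'m \<Rightarrow> real^(('m::finite \<times> 'n::finite) wo)" where
  "of_mat T = (\<chi> a. T $ fst (un_Wo a) $ snd (un_Wo a))"

lemma to_mat_of_mat [simp]: "to_mat (of_mat T) = T"
  and of_mat_to_mat [simp]: "of_mat (to_mat t) = t"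
  by (simp_all add: to_mat_def of_mat_def vec_eq_iff)

lemma linear_to_mat: "linear to_mat"
  by (rule linearI) (simp_all add: to_mat_def vec_eq_iff)

section \<open>Right multiplication of matrices and its Jacobian\<close>

definition rmul :: "real^'n^'n \<Rightarrow> real^(('m::finite \<times> 'n::finite) wo) \<Rightarrow> real^(('m \<times> 'n) wo)" where
  "rmul g t = of_mat (to_mat t ** g)"

lemma to_mat_rmul [simp]: "to_mat (rmul g t) = to_mat t ** g"
  by (simp add: rmul_def)

lemma rmul_nth: "rmul g t $ a = (\<Sum>l\<in>UNIV. t $ Wo (fst (un_Wo a), l) * g $ l $ snd (un_Wo a))"
  by (simp add: rmul_def of_mat_def to_mat_def matrix_matrix_mult_def)

lemma bilinear_rmul: "bilinear rmul"
  unfolding bilinear_def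
  by (auto intro!: linearI simp: vec_eq_iff rmul_nth sum.distrib sum_distrib_left algebra_simps)

lemma linear_rmul: "linear (rmul g)"
  by (rule bilinear_rmul[unfolded bilinear_def, THEN conjunct1, THEN spec])

lemma rmul_matrix_inv:
  assumes "g \<in> GL"
  shows "rmul g (rmul (matrix_inv g) t) = t" "rmul (matrix_inv g) (rmul g t) = t"
proof -
  have "g ** matrix_inv g = mat 1" "matrix_inv g ** g = mat 1"
    using assms someI_ex[of "\<lambda>A'. g ** A' = mat 1 \<and> A' ** g = mat 1"]
    by (auto simp: GL_def invertible_def matrix_inv_def)
  then show "rmul g (rmul (matrix_inv g) t) = t" "rmul (matrix_inv g) (rmul g t) = t"
    by (simp_all add: rmul_def matrix_mul_assoc[symmetric])
qed

lemma det_rmul_nonzero: "g \<in> GL \<Longrightarrow> det (matrix (rmul g)) \<noteq> 0"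
  unfolding det_nz_iff_inj[OF linear_rmul] by (metis inj_onI rmul_matrix_inv(2))

lemma open_GL: "open (GL :: (real^'n^'n) set)"
proof -
  have "GL = {g :: real^'n^'n. det g \<noteq> 0}" by (simp add: GL_def invertible_det_nz)
  moreover have "open {g :: real^'n^'n. det g \<noteq> 0}"
    unfolding det_def by (intro open_Collect_neq continuous_intros)
  ultimately show ?thesis by simp
qed

lemma smooth_family_rmul_nth:
  assumes "continuous_on UNIV (\<lambda>t. x t)"
  shows "smooth_family G (\<lambda>g t. rmul g (x t) $ a)"
  unfolding rmul_nth
  by (intro smooth_family_sum smooth_family.mult smooth_family.parameter smooth_family.linear
      continuous_intros assms bounded_linear_compose[OF bounded_linear_vec_nth bounded_linear_vec_nth])

text \<open>The Jacobian is polynomial in the entries of \<open>g\<close>, as the expansion of the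
  determinant over permutations shows.\<close>

lemma smooth_family_det_rmul: "smooth_family G (\<lambda>g t. det (matrix (rmul g)))"
proof -
  show ?thesis
    unfolding det_def matrix_def vec_lambda_beta
    by (intro smooth_family_sum smooth_family.mult smooth_family_const smooth_family_prod
        smooth_family_rmul_nth continuous_intros)
qed

text \<open>Right multiplication by an invertible \<open>g\<close> expands norms by at least some
  \<open>B > 0\<close>, and nearby \<open>h\<close> still do by \<open>B / 2\<close>. Hence
  \<open>rmul h t\<close> leaves the support of \<open>w\<close> as soon as
  \<open>norm t > 2 * R / B\<close>.\<close>

lemma locally_bounded_support_rmul:
  fixes w :: "real^(('m::finite \<times> 'n::finite) wo) \<Rightarrow> real"
  assumes w: "\<And>t. R < norm t \<Longrightarrow> w t = 0"
  shows "locally_bounded_support GL (\<lambda>g t. d g * w (rmul g t))"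
  unfolding locally_bounded_support_def
proof
  fix g :: "real^'n^'n" assume g: "g \<in> GL"
  then have "inj (rmul g :: _ \<Rightarrow> real^(('m \<times> 'n) wo))"
    by (metis inj_onI rmul_matrix_inv(2))
  then obtain B where B: "B > 0" "\<And>t :: real^(('m \<times> 'n) wo). B * norm t \<le> norm (rmul g t)"
    using linear_inj_bounded_below_pos[OF linear_rmul] by metis
  obtain K where K: "K > 0" "\<And>h (t :: real^(('m \<times> 'n) wo)). norm (rmul h t) \<le> norm h * norm t * K"
    using bounded_bilinear.pos_bounded[OF bilinear_conv_bounded_bilinear[THEN iffD1, OF bilinear_rmul]] by blast
  obtain e where e: "e > 0" "ball g e \<subseteq> GL"
    using open_GL g openE by blast
  \<comment> \<open>Small enough that \<open>rmul (g - h) t\<close> has norm at most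
    \<open>B / 2 * norm t\<close>.\<close>
  define d' where "d' = min e (B / (2 * K))"
  have "d' > 0" using e B K by (simp add: d'_def)
  moreover have "ball g d' \<subseteq> GL" using e(2) by (auto simp: d'_def)
  moreover have "d h * w (rmul h t) = 0" if h: "h \<in> ball g d'" and t: "2 * R / B < norm t" for h t
  proof -
    have "norm (g - h) * K \<le> B / 2"
      using h K(1) by (auto simp: d'_def dist_norm field_simps)
    then have "norm (g - h) * norm t * K \<le> B / 2 * norm t"
      using mult_right_mono[of "norm (g - h) * K" "B / 2" "norm t"] by (simp add: mult_ac)
    then have "norm (rmul (g - h) t) \<le> B / 2 * norm t"
      using K(2)[of "g - h" t] by linarith
    moreover have "rmul g t = rmul h t + rmul (g - h) t"
      by (simp add: bilinear_lsub[OF bilinear_rmul])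
    then have "norm (rmul g t) \<le> norm (rmul h t) + norm (rmul (g - h) t)"
      by (simp only: norm_triangle_ineq)
    ultimately have "B / 2 * norm t \<le> norm (rmul h t)"
      using B(2)[of t] by linarith
    moreover have "R < B / 2 * norm t" using t B(1) by (simp add: field_simps)
    ultimately show ?thesis using w by simp
  qed
  ultimately show "\<exists>e>0. \<exists>R. ball g e \<subseteq> GL \<and> (\<forall>h\<in>ball g e. \<forall>t. R < norm t \<longrightarrow> d h * w (rmul h t) = 0)"
    by blast
qed

lemma smooth_family_bump_rmul: "smooth_family G (\<lambda>g t. bump t0 r (rmul g t))"
proof -
  \<comment> \<open>The squared norm is spelled out with sums and products only, to fit the rules of
    \<open>smooth_family\<close>.\<close>
  have eq: "r\<^sup>2 - (norm (rmul g t - t0))\<^sup>2 = r\<^sup>2 + - (\<Sum>a\<in>UNIV. (rmul g t $ a + - t0 $ a) * (rmul g t $ a + - t0 $ a))" for g t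
    by (simp add: power2_norm_eq_inner inner_vec_def)
  have "smooth_family G (\<lambda>g t. r\<^sup>2 - (norm (rmul g t - t0))\<^sup>2)"
    unfolding eq
    by (intro smooth_family.add smooth_family_const smooth_family_uminus smooth_family_sum
        smooth_family.mult smooth_family_rmul_nth continuous_intros)
  from smooth_family.compose[of "\<lambda>m. flat (flat_poly m)", OF flat_flat_poly_derivative this, of 0]
  show ?thesis by (simp add: bump_def)
qed

section \<open>Integrals of compactly supported functions and valuation-valued averages\<close>

lemma absolutely_integrable_continuous_compact_support:
  fixes f :: "'a::euclidean_space \<Rightarrow> 'b::euclidean_space"
  assumes "continuous_on UNIV f" "\<And>t. R < norm t \<Longrightarrow> f t = 0"
  shows "f absolutely_integrable_on UNIV"
proof -
  obtain b where b: "cball 0 R \<subseteq> cbox (- b) (b :: 'a)"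
    using bounded_subset_cbox_symmetric[OF bounded_cball] by blast
  have "f = (\<lambda>t. if t \<in> cbox (- b) b then f t else 0)"
    using assms(2) b by (force simp: not_le[symmetric])
  moreover have "f absolutely_integrable_on cbox (- b) b"
    by (intro absolutely_integrable_continuous continuous_on_subset[OF assms(1)]) auto
  ultimately show ?thesis
    by (metis absolutely_integrable_restrict_UNIV)
qed

lemma integrable_continuous_compact_support:
  fixes f :: "'a::euclidean_space \<Rightarrow> 'b::banach"
  assumes "continuous_on UNIV f" "\<And>t. R < norm t \<Longrightarrow> f t = 0"
  shows "f integrable_on UNIV"
proof -
  obtain b where b: "cball 0 R \<subseteq> cbox (- b) (b :: 'a)"
    using bounded_subset_cbox_symmetric[OF bounded_cball] by blast
  have "f = (\<lambda>t. if t \<in> cbox (- b) b then f t else 0)"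
    using assms(2) b by (force simp: not_le[symmetric])
  moreover have "f integrable_on cbox (- b) b"
    by (intro integrable_continuous continuous_on_subset[OF assms(1)]) auto
  ultimately show ?thesis
    by (metis integrable_restrict_UNIV)
qed

lemma integral_linear_substitution:
  fixes f :: "real^('m::{finite,wellorder}) \<Rightarrow> real" and h :: "real^('m::{finite,wellorder}) \<Rightarrow> real^('m::{finite,wellorder})"
  assumes f: "continuous_on UNIV f" "\<And>t. R < norm t \<Longrightarrow> f t = 0" and h: "linear h" "surj h"
  shows "integral UNIV f = \<bar>det (matrix h)\<bar> * integral UNIV (\<lambda>t. f (h t))"
proof -
  \<comment> \<open>The change of variables theorem applied below concerns vector-valued functions,
    so \<open>f\<close> is wrapped as a map into \<open>real^1\<close>.\<close>
  define F :: "real^('m::{finite,wellorder}) \<Rightarrow> real^1" where "F t = (\<chi> i. f t)" for t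
  have F: "F absolutely_integrable_on UNIV"
    by (rule absolutely_integrable_continuous_compact_support[where R = R])
      (use f in \<open>auto simp: F_def vec_eq_iff intro!: continuous_intros\<close>)
  have hU: "h ` UNIV = UNIV" using h(2) .
  have Fh: "(F \<circ> h) absolutely_integrable_on UNIV"
    using absolutely_integrable_on_linear_image[OF h(1), where f = F and S = UNIV] F h
      det_nz_iff_inj[OF h(1)] linear_surj_imp_inj[OF h] unfolding hU by blast
  have comp: "integral UNIV (\<lambda>t. G t $ 1) = integral UNIV G $ 1"
    if "G absolutely_integrable_on UNIV" for G :: "real^('m::{finite,wellorder}) \<Rightarrow> real^1"
    using that by (intro integral_component_eq_cart) (simp add: absolutely_integrable_on_def)
  have "integral UNIV F = \<bar>det (matrix h)\<bar> *\<^sub>R integral UNIV (F \<circ> h)"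
    using integral_change_of_variables_linear[OF h(1), where f = F and S = UNIV] F unfolding hU by blast
  then have "integral UNIV F $ 1 = \<bar>det (matrix h)\<bar> * integral UNIV (F \<circ> h) $ 1"
    by simp
  then show ?thesis
    using comp[OF F] comp[OF Fh] by (simp add: F_def o_def)
qed

text \<open>Lets evaluation at a body commute with integrals of valuation-valued functions.\<close>

lemma bounded_linear_apply_val: "bounded_linear (\<lambda>\<phi> :: 'a::euclidean_space val. apply_val \<phi> K)"
proof -
  obtain R where R: "body_set K \<subseteq> cball 0 R"
    using body_set_subset_cball by blast
  obtain C where "\<And>(\<phi> :: 'a val) K. body_set K \<subseteq> cball 0 R \<Longrightarrow> \<bar>apply_val \<phi> K\<bar> \<le> C * val_norm \<phi>"
    using apply_val_bound_cball[where 'a='a, of R] by blast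
  then show ?thesis
    using R by (intro bounded_linear_intro[of _ C]) (auto simp: norm_val_eq mult.commute)
qed

text \<open>An integral in the Banach space of valuations, so that the result is a continuous
  translation-invariant valuation by construction.\<close>

definition bump_val :: "'m::{finite,wellorder} set \<Rightarrow> real^(('m \<times> 'n::finite) wo) \<Rightarrow> real \<Rightarrow> (real^'n) val" where
  "bump_val J t0 r = integral UNIV (\<lambda>t. bump t0 r t *\<^sub>R cyl_val J (to_mat t))"

lemma continuous_on_cyl_val_to_mat: "continuous_on S (\<lambda>t. cyl_val J (to_mat t))"
  by (rule continuous_on_compose2[OF continuous_on_cyl_val])
     (auto intro!: linear_continuous_on simp: linear_to_mat linear_conv_bounded_linear[symmetric])

lemma apply_bump_val:
  fixes J :: "'m::{finite,wellorder} set" and t0 :: "real^(('m \<times> 'n::finite) wo)"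
  assumes "0 \<le> r"
  shows "apply_val (bump_val J t0 r) K = integral UNIV (\<lambda>t. bump t0 r t * apply_val (cyl_val J (to_mat t)) K)"
proof -
  have "(\<lambda>t. bump t0 r t *\<^sub>R cyl_val J (to_mat t)) integrable_on UNIV"
    by (rule integrable_continuous_compact_support[where R = "norm t0 + r"])
       (auto intro!: continuous_intros continuous_on_bump continuous_on_cyl_val_to_mat
         simp: bump_eq_0_norm assms)
  from integral_linear[OF this bounded_linear_apply_val, of K] show ?thesis
    by (simp add: bump_val_def o_def)
qed

lemma continuous_on_bump_times_apply_cyl_val:
  "continuous_on S (\<lambda>t. bump t0 r t * apply_val (cyl_val J (to_mat t)) K)"
  by (intro continuous_intros continuous_on_bump
      bounded_linear.continuous_on[OF bounded_linear_apply_val] continuous_on_cyl_val_to_mat)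

text \<open>The substitution of \<open>T g\<close> for \<open>T\<close> moves the dependence on
  \<open>g\<close> from the valuation, where it is merely continuous in general, to the weight,
  where it is smooth.\<close>

lemma gl_act_bump_val:
  fixes J :: "'m::{finite,wellorder} set" and t0 :: "real^(('m \<times> 'n::finite) wo)"
  assumes g: "g \<in> GL" and r: "0 \<le> r"
  shows "gl_act g (bump_val J t0 r)
    = integral UNIV (\<lambda>t. (\<bar>det (matrix (rmul g :: real^(('m \<times> 'n) wo) \<Rightarrow> _))\<bar> * bump t0 r (rmul g t)) *\<^sub>R cyl_val J (to_mat t))"
proof (rule val_eqI)
  fix K
  let ?d = "\<bar>det (matrix (rmul g :: real^(('m \<times> 'n) wo) \<Rightarrow> _))\<bar>"
  let ?K = "body_image ((*v) (matrix_inv g)) K"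
  have "locally_bounded_support GL (\<lambda>g t. \<bar>det (matrix (rmul g :: real^(('m \<times> 'n) wo) \<Rightarrow> _))\<bar> * bump t0 r (rmul g t))"
    by (rule locally_bounded_support_rmul[where R = "norm t0 + r"]) (simp add: bump_eq_0_norm r)
  then obtain R where R: "\<And>t. R < norm t \<Longrightarrow> ?d * bump t0 r (rmul g t) = 0"
    using g unfolding locally_bounded_support_def by (metis centre_in_ball)
  have "continuous_on UNIV (\<lambda>t. bump t0 r (rmul g t))"
    by (rule continuous_on_compose2[OF continuous_on_bump[of UNIV]])
       (auto intro!: linear_continuous_on simp: linear_rmul linear_conv_bounded_linear[symmetric])
  then have int: "(\<lambda>t. (?d * bump t0 r (rmul g t)) *\<^sub>R cyl_val J (to_mat t)) integrable_on UNIV"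
    by (intro integrable_continuous_compact_support[where R = R] continuous_intros
        continuous_on_cyl_val_to_mat) (use R in auto)
  have "apply_val (gl_act g (bump_val J t0 r)) K
      = integral UNIV (\<lambda>t. bump t0 r t * apply_val (cyl_val J (to_mat t)) ?K)"
    by (simp add: apply_val_gl_act apply_bump_val r)
  also have "\<dots> = ?d * integral UNIV (\<lambda>t. bump t0 r (rmul g t) * apply_val (cyl_val J (to_mat (rmul g t))) ?K)"
  proof (rule integral_linear_substitution[where R = "norm t0 + r"])
    show "surj (rmul g :: real^(('m \<times> 'n) wo) \<Rightarrow> _)"
      by (rule surjI[of _ "rmul (matrix_inv g)"]) (rule rmul_matrix_inv[OF g])
  qed (simp_all add: continuous_on_bump_times_apply_cyl_val bump_eq_0_norm r linear_rmul)
  also have "\<dots> = integral UNIV (\<lambda>t. ?d * (bump t0 r (rmul g t) * apply_val (cyl_val J (to_mat t)) K))"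
  proof -
    \<comment> \<open>The factor \<open>g\<close> from the substitution cancels the inverse from the
      action.\<close>
    have "to_mat (rmul g t) ** matrix_inv g = to_mat t" for t :: "real^(('m \<times> 'n) wo)"
    proof -
      have "to_mat (rmul g t) ** matrix_inv g = to_mat (rmul (matrix_inv g) (rmul g t))"
        by (simp only: to_mat_rmul)
      then show ?thesis by (simp only: rmul_matrix_inv[OF g])
    qed
    then show ?thesis
      by (simp only: apply_cyl_val_matrix_image integral_mult_right)
  qed
  also have "\<dots> = apply_val (integral UNIV (\<lambda>t. (?d * bump t0 r (rmul g t)) *\<^sub>R cyl_val J (to_mat t))) K"
    using integral_linear[OF int bounded_linear_apply_val, of K] by (simp add: o_def mult.assoc)
  finally show "apply_val (gl_act g (bump_val J t0 r)) K
      = apply_val (integral UNIV (\<lambda>t. (?d * bump t0 r (rmul g t)) *\<^sub>R cyl_val J (to_mat t))) K" .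
qed

lemma bump_val_smooth:
  fixes J :: "'m::{finite,wellorder} set" and t0 :: "real^(('m \<times> 'n::finite) wo)"
  assumes r: "0 \<le> r"
  shows "bump_val J t0 r \<in> Val_smooth"
proof -
  let ?D = "\<lambda>g. det (matrix (rmul g :: real^(('m \<times> 'n) wo) \<Rightarrow> _))"
  \<comment> \<open>A dummy parameter in \<open>real^1\<close> lets continuity of families be
    applied to the Jacobian alone.\<close>
  have c: "continuous_on GL ?D"
  proof -
    have "continuous_on (GL \<times> UNIV) (\<lambda>(g, t :: real^1). ?D g)"
      by (rule smooth_family_continuous_on[OF smooth_family_det_rmul])
    moreover have "continuous_on GL (\<lambda>g :: real^'n^'n. (g, 0 :: real^1))"
      by (intro continuous_intros)
    ultimately have "continuous_on GL (\<lambda>g. case (g, 0 :: real^1) of (g, t) \<Rightarrow> ?D g)"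
      by (rule continuous_on_compose2) auto
    then show ?thesis by simp
  qed
  \<comment> \<open>The absolute Jacobian is written as the determinant times its sign, which is
    locally constant on \<open>GL\<close>.\<close>
  have "smooth_family GL (\<lambda>g t. ?D g * sgn (?D g) * bump t0 r (rmul g t))"
    by (intro smooth_family.mult smooth_family_det_rmul smooth_family.sgn c det_rmul_nonzero smooth_family_bump_rmul)
  then have u: "smooth_family GL (\<lambda>g t. \<bar>?D g\<bar> * bump t0 r (rmul g t))"
    by (simp add: abs_sgn)
  have "locally_bounded_support GL (\<lambda>g t. \<bar>?D g\<bar> * bump t0 r (rmul g t))"
    by (rule locally_bounded_support_rmul[where R = "norm t0 + r"]) (simp add: bump_eq_0_norm r)
  from smooth_on_integral_smooth_family[OF open_GL continuous_on_cyl_val_to_mat u this]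
  show ?thesis
    unfolding Val_smooth_def smooth_on_def
    by (simp add: times_differentiable_on_cong[OF open_GL gl_act_bump_val[OF _ r]])
qed

lemma bump_val_mem:
  fixes J :: "'m::{finite,wellorder} set" and t0 :: "real^(('m \<times> 'n::finite) wo)"
  assumes r: "0 \<le> r"
  shows "bump_val J t0 r \<in> Val_even_smooth (card J)"
proof -
  have scale: "apply_val (bump_val J t0 r) (body_image ((*\<^sub>R) s) K) = \<bar>s\<bar> ^ card J * apply_val (bump_val J t0 r) K"
    if "s \<noteq> 0" for s K
    by (simp add: apply_bump_val r apply_cyl_val_scaleR[OF that] mult.left_commute[of _ "\<bar>s\<bar> ^ card J"]
        del: mult_minus_left)
  have "homogeneous (card J) (bump_val J t0 r)"
    unfolding homogeneous_def using scale by simp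
  moreover have "even_val (bump_val J t0 r)"
  proof -
    have "(uminus :: real^'n \<Rightarrow> _) = (*\<^sub>R) (-1)" by (simp add: fun_eq_iff)
    then show ?thesis unfolding even_val_def using scale[of "-1"] by simp
  qed
  ultimately show ?thesis
    using bump_val_smooth[OF r] by (simp add: Val_even_smooth_def)
qed

lemma Val_even_smooth_add_scaleR:
  assumes "\<phi> \<in> Val_even_smooth k" "\<psi> \<in> Val_even_smooth k"
  shows "\<phi> + c *\<^sub>R \<psi> \<in> Val_even_smooth k"
proof -
  have "gl_act g (\<phi> + c *\<^sub>R \<psi>) = gl_act g \<phi> + c *\<^sub>R gl_act g \<psi>" for g
    by (rule val_eqI) (simp add: apply_val_gl_act)
  then show ?thesis
    using assms
    by (auto simp: Val_even_smooth_def Val_smooth_def smooth_on_def homogeneous_def even_val_def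
        algebra_simps intro!: times_differentiable_on_add_scaleR[OF open_GL])
qed

section \<open>Restrictions of the averages and detection of functions by bumps\<close>

lemma bump_val_frame:
  fixes E :: "(real^'n) set" and J :: "'m::{finite,wellorder} set" and t0 :: "real^(('m \<times> 'n) wo)"
  assumes \<beta>: "frame J \<beta> E" "bij_betw \<beta> J (SOME B. orthonormal_basis_of E B)" and r: "0 \<le> r"
  shows "restricts_to (bump_val J t0 r) E
    (\<lambda>A. integral UNIV (\<lambda>t. bump t0 r t * \<bar>det (frame_matrix J \<beta> (to_mat t))\<bar>) * measure (lborel_subspace E) A)"
  unfolding restricts_to_def
proof (intro allI impI)
  fix K assume "body_set K \<subseteq> E"
  then show "apply_val (bump_val J t0 r) K = integral UNIV (\<lambda>t. bump t0 r t * \<bar>det (frame_matrix J \<beta> (to_mat t))\<bar>)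
      * measure (lborel_subspace E) (body_set K)"
    by (simp add: apply_bump_val r apply_cyl_val_frame[OF \<beta>] mult.assoc[symmetric])
qed

lemma continuous_on_frame_matrix_det:
  "continuous_on S (\<lambda>t. det (frame_matrix J \<beta> (to_mat t)))"
proof -
  have "continuous_on S (\<lambda>t. frame_matrix J \<beta> (to_mat t) $ i $ j)" for i j
  proof (cases "i \<in> J \<and> j \<in> J")
    case True
    have "continuous_on S (\<lambda>t. to_mat t $ i)"
      by (intro bounded_linear.continuous_on[OF bounded_linear_vec_nth] linear_continuous_on)
         (simp add: linear_to_mat linear_conv_bounded_linear[symmetric])
    with True show ?thesis by (auto simp: frame_matrix_def intro!: continuous_intros)
  next
    case False
    then have "(\<lambda>t. frame_matrix J \<beta> (to_mat t) $ i $ j) = (\<lambda>t. if i = j then 1 else 0)"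
      by (auto simp: frame_matrix_def)
    then show ?thesis by (simp only: continuous_on_const)
  qed
  then show ?thesis
    unfolding det_def
    by (intro continuous_on_sum continuous_on_mult continuous_on_prod continuous_on_const)
qed

text \<open>If \<open>h t0\<close> were nonzero, \<open>h\<close> would keep its sign on a ball
  about \<open>t0\<close>; against a bump supported there its integral could not vanish.\<close>

lemma continuous_eq_0_if_bump_integrals_eq_0:
  fixes h :: "'a::euclidean_space \<Rightarrow> real"
  assumes h: "continuous_on UNIV h" and zero: "\<And>t0 r. 0 < r \<Longrightarrow> integral UNIV (\<lambda>t. bump t0 r t * h t) = 0"
  shows "h t0 = 0"
proof (rule ccontr)
  assume nz: "h t0 \<noteq> 0"
  have "open {t. 0 < h t0 * h t}"
    using h by (intro open_Collect_less continuous_intros) auto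
  moreover have "t0 \<in> {t. 0 < h t0 * h t}"
    using nz by (auto simp: zero_less_mult_iff)
  ultimately obtain r where r: "r > 0" "ball t0 r \<subseteq> {t. 0 < h t0 * h t}"
    by (rule openE)
  \<comment> \<open>The factor \<open>h t0\<close> makes the integrand nonnegative whatever the sign
    of \<open>h\<close>.\<close>
  let ?f = "\<lambda>t. h t0 * (bump t0 r t * h t)"
  have out: "bump t0 r t = 0" if "t \<notin> ball t0 r" for t
    using that r(1) by (intro bump_eq_0) (auto simp: dist_commute)
  obtain b where b: "cball 0 (norm t0 + r) \<subseteq> box (- b) (b :: 'a)"
    using bounded_subset_box_symmetric[OF bounded_cball] by blast
  have bsub: "ball t0 r \<subseteq> box (- b) b"
  proof
    fix t assume "t \<in> ball t0 r"
    then have "norm t \<le> norm t0 + r"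
      using norm_triangle_sub[of t t0] by (simp add: dist_norm norm_minus_commute)
    then show "t \<in> box (- b) b" using b by auto
  qed
  have "continuous_on (cbox (- b) b) ?f"
    by (intro continuous_intros continuous_on_bump continuous_on_subset[OF h]) auto
  moreover have "0 \<le> ?f t" for t
  proof (cases "t \<in> ball t0 r")
    case True
    then have "0 \<le> bump t0 r t * (h t0 * h t)"
      using r(2) by (intro mult_nonneg_nonneg[OF bump_nonneg]) auto
    then show ?thesis by (simp add: mult_ac)
  qed (simp add: out)
  moreover have "(?f has_integral 0) (cbox (- b) b)"
  proof -
    have "integral (cbox (- b) b) ?f = integral UNIV ?f"
      by (rule integral_eq_integral_cbox[symmetric])
        (use out bsub box_subset_cbox[of "- b" b] in \<open>auto simp: subset_iff\<close>)
    also have "\<dots> = 0" using zero[OF r(1), of t0] by (simp only: integral_mult_right)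
    finally have "integral (cbox (- b) b) ?f = 0" .
    moreover have "?f integrable_on cbox (- b) b" by (rule integrable_continuous) fact
    ultimately show ?thesis by (simp add: has_integral_integrable_integral)
  qed
  moreover have t0: "t0 \<in> box (- b) b" using bsub r(1) by auto
  ultimately have "?f t0 = 0"
    using has_integral_0_cbox_imp_0[of "- b" b ?f t0] box_subset_cbox[of "- b" b] by blast
  then show False using nz bump_pos[of r t0] r(1) by simp
qed


section \<open>Prescribing restrictions\<close>

text \<open>Finite-dimensional duality: a linear family annihilated by no nonzero functional attains
  all values on \<open>S\<close>. The induction adds one point at a time.\<close>

lemma separating_functions_interpolate:
  fixes P :: "('s \<Rightarrow> real) \<Rightarrow> bool"
  assumes "finite S" "P f0" and lin: "\<And>f g c. P f \<Longrightarrow> P g \<Longrightarrow> P (\<lambda>s. f s + c * g s)"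
    and "\<And>a. (\<And>f. P f \<Longrightarrow> (\<Sum>s\<in>S. a s * f s) = 0) \<Longrightarrow> \<forall>s\<in>S. a s = 0"
  shows "\<exists>f. P f \<and> (\<forall>s\<in>S. f s = c s)"
  using assms(1,4)
proof (induction S arbitrary: c)
  case empty
  then show ?case using assms(2) by auto
next
  case (insert s S)
  have IH: "\<exists>f. P f \<and> (\<forall>t\<in>S. f t = c t)" for c
  proof (rule insert.IH)
    fix a :: "'s \<Rightarrow> real" assume a: "\<And>f. P f \<Longrightarrow> (\<Sum>s\<in>S. a s * f s) = 0"
    have "\<forall>t\<in>insert s S. (a(s := 0)) t = 0"
    proof (rule insert.prems)
      fix f assume "P f"
      have "(\<Sum>t\<in>insert s S. (a(s := 0)) t * f t) = (\<Sum>t\<in>S. (a(s := 0)) t * f t)"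
        using insert.hyps by simp
      also have "\<dots> = (\<Sum>t\<in>S. a t * f t)"
        by (rule sum.cong) (use insert.hyps in auto)
      finally show "(\<Sum>t\<in>insert s S. (a(s := 0)) t * f t) = 0"
        using a[OF \<open>P f\<close>] by simp
    qed
    then show "\<forall>t\<in>S. a t = 0" using insert.hyps by (metis fun_upd_other insert_iff)
  qed
  \<comment> \<open>Dual functions for the points of \<open>S\<close>, supplied by the induction
    hypothesis.\<close>
  have "\<exists>f. P f \<and> (\<forall>t'\<in>S. f t' = (if t' = t then 1 else 0))" for t
    by (rule IH)
  then obtain w where w: "\<And>t. P (w t)" "\<And>t t'. t' \<in> S \<Longrightarrow> w t t' = (if t' = t then 1 else 0)"
    by metis
  \<comment> \<open>Otherwise the values on \<open>S\<close> would determine that at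
    \<open>s\<close>, and the coefficients \<open>1\<close> at \<open>s\<close> and
    \<open>- w t s\<close> at \<open>t\<close> would annihilate the family.\<close>
  have "\<exists>f. P f \<and> f s - (\<Sum>t\<in>S. w t s * f t) \<noteq> 0"
  proof (rule ccontr)
    assume none: "\<not> ?thesis"
    have "\<forall>t\<in>insert s S. (if t = s then 1 else - w t s) = 0"
    proof (rule insert.prems)
      fix f assume "P f"
      have "(\<Sum>t\<in>insert s S. (if t = s then 1 else - w t s) * f t)
          = f s + (\<Sum>t\<in>S. (if t = s then 1 else - w t s) * f t)"
        using insert.hyps by simp
      also have "(\<Sum>t\<in>S. (if t = s then 1 else - w t s) * f t) = (\<Sum>t\<in>S. - (w t s * f t))"
        by (rule sum.cong) (use insert.hyps in auto)
      finally show "(\<Sum>t\<in>insert s S. (if t = s then 1 else - w t s) * f t) = 0"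
        using none \<open>P f\<close> by (simp add: sum_negf)
    qed
    then show False by auto
  qed
  then obtain f where f: "P f" "f s - (\<Sum>t\<in>S. w t s * f t) \<noteq> 0" by blast
  have Psum: "P (\<lambda>s. g s + (\<Sum>t\<in>I. b t * w t s))" if "P g" for g b I
    using that
  proof (induction I rule: infinite_finite_induct)
    case (insert t I)
    from lin[OF insert.IH[OF insert.prems] w(1), of "b t" t] insert.hyps
    show ?case by (simp add: algebra_simps)
  qed simp_all
  \<comment> \<open>Subtracting the interpolation of \<open>f\<close> on \<open>S\<close> leaves a
    member that vanishes on \<open>S\<close> but not at \<open>s\<close>, with which the value at
    \<open>s\<close> can be corrected.\<close>
  define z where "z s = f s + (\<Sum>t\<in>S. - f t * w t s)" for s
  have z: "P z" unfolding z_def by (rule Psum[OF f(1)])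
  have z0: "z t = 0" if "t \<in> S" for t
  proof -
    have "(\<Sum>i\<in>S. - f i * w i t) = (\<Sum>i\<in>S. if i = t then - f t else 0)"
      by (rule sum.cong) (use that w(2) in auto)
    then show ?thesis using that insert.hyps by (simp add: z_def)
  qed
  have zs: "z s \<noteq> 0"
    using f(2) by (simp add: z_def sum_negf mult.commute)
  obtain g where g: "P g" "\<forall>t\<in>S. g t = c t" using IH by blast
  have "P (\<lambda>t. g t + (c s - g s) / z s * z t)" by (rule lin[OF g(1) z])
  moreover have "\<forall>t\<in>insert s S. g t + (c s - g s) / z s * z t = c t"
    using g(2) z0 zs by auto
  ultimately show ?case by (intro exI conjI)
qed

theorem proposition4p19:
  fixes k :: nat
    and S :: "(real^'n) set set"
    and \<mu> :: "(real^'n) set \<Rightarrow> (real^'n) set \<Rightarrow> real"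
  assumes "0 < k" and "k < CARD('n)"
    and "finite S" and "S \<subseteq> Gr k"
    and "\<And>E. E \<in> S \<Longrightarrow> \<mu> E \<in> Dens E"
  shows "\<exists>\<phi> \<in> Val_even_smooth k. \<forall>E\<in>S. restricts_to \<phi> E (\<mu> E)"
proof -
  obtain J :: "'n wo set" where J: "card J = k"
    using obtain_subset_with_card_n[of k "UNIV :: 'n wo set"] assms(2) by (auto simp: CARD_wo)
  have "\<forall>E\<in>S. \<exists>\<beta>. frame J \<beta> E \<and> bij_betw \<beta> J (SOME B. orthonormal_basis_of E B)"
    using frame_exists[of _ J] assms(4) J by blast
  from bchoice[OF this] obtain \<beta> where \<beta>: "\<And>E. E \<in> S \<Longrightarrow> frame J (\<beta> E) E"
    "\<And>E. E \<in> S \<Longrightarrow> bij_betw (\<beta> E) J (SOME B. orthonormal_basis_of E B)" by blast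
  define c where "c E t0 r = integral UNIV (\<lambda>t. bump t0 r t * \<bar>det (frame_matrix J (\<beta> E) (to_mat t))\<bar>)"
    for E r and t0 :: "real^(('n wo \<times> 'n) wo)"
  \<comment> \<open>Reduces the task to real coefficients: \<open>P f\<close> means that a single
    valuation realises all the densities with coefficients \<open>f E\<close>.\<close>
  define P where "P f \<longleftrightarrow> (\<exists>\<phi>\<in>Val_even_smooth k. \<forall>E\<in>S.
      restricts_to \<phi> E (\<lambda>A. f E * measure (lborel_subspace E) A))" for f :: "(real^'n) set \<Rightarrow> real"
  have Pc: "P (\<lambda>E. c E t0 r)" if "0 \<le> r" for t0 r
    unfolding P_def c_def
    using bump_val_mem[OF that, of J t0] bump_val_frame[OF \<beta> that, of _ t0] J by blast
  have "\<forall>E\<in>S. \<exists>x. \<mu> E = (\<lambda>A. x * measure (lborel_subspace E) A)"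
    using assms(5) by (simp add: Dens_def)
  from bchoice[OF this] obtain m where m: "\<And>E. E \<in> S \<Longrightarrow> \<mu> E = (\<lambda>A. m E * measure (lborel_subspace E) A)"
    by blast
  \<comment> \<open>The family is nonempty because it contains the average with radius zero, whose
    weight is identically zero.\<close>
  have "\<exists>f. P f \<and> (\<forall>E\<in>S. f E = m E)"
  proof (rule separating_functions_interpolate[where P = P, OF assms(3) Pc[OF order_refl, of 0]])
    fix f g :: "(real^'n) set \<Rightarrow> real" and x
    assume "P f" "P g"
    then obtain \<phi> \<psi> where "\<phi> \<in> Val_even_smooth k" "\<psi> \<in> Val_even_smooth k"
      "\<forall>E\<in>S. restricts_to \<phi> E (\<lambda>A. f E * measure (lborel_subspace E) A)"
      "\<forall>E\<in>S. restricts_to \<psi> E (\<lambda>A. g E * measure (lborel_subspace E) A)"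
      unfolding P_def by blast
    then show "P (\<lambda>E. f E + x * g E)"
      unfolding P_def
      by (intro bexI[of _ "\<phi> + x *\<^sub>R \<psi>"])
         (simp_all add: Val_even_smooth_add_scaleR restricts_to_def algebra_simps)
  next
    fix a assume a: "\<And>f. P f \<Longrightarrow> (\<Sum>E\<in>S. a E * f E) = 0"
    \<comment> \<open>An annihilating functional applied to all averages gives the bump integrals of
      \<open>h\<close>; their vanishing forces \<open>h\<close> to vanish everywhere.\<close>
    define h where "h t = (\<Sum>E\<in>S. a E * \<bar>det (frame_matrix J (\<beta> E) (to_mat t))\<bar>)"
      for t :: "real^(('n wo \<times> 'n) wo)"
    have cont: "continuous_on UNIV h"
      unfolding h_def by (intro continuous_intros continuous_on_frame_matrix_det)
    have "integral UNIV (\<lambda>t. bump t0 r t * h t) = 0" if r: "0 < r" for t0 r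
    proof -
      have int: "(\<lambda>t. bump t0 r t * \<bar>det (frame_matrix J (\<beta> E) (to_mat t))\<bar>) integrable_on UNIV" for E
        by (rule integrable_continuous_compact_support[where R = "norm t0 + r"])
          (use r in \<open>auto simp: bump_eq_0_norm intro!: continuous_intros continuous_on_bump continuous_on_frame_matrix_det\<close>)
      have "(\<lambda>t. bump t0 r t * h t)
          = (\<lambda>t. \<Sum>E\<in>S. a E * (bump t0 r t * \<bar>det (frame_matrix J (\<beta> E) (to_mat t))\<bar>))"
        by (simp add: h_def sum_distrib_left mult.left_commute)
      then have "integral UNIV (\<lambda>t. bump t0 r t * h t)
          = (\<Sum>E\<in>S. integral UNIV (\<lambda>t. a E * (bump t0 r t * \<bar>det (frame_matrix J (\<beta> E) (to_mat t))\<bar>)))"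
        using int by (simp add: integral_sum[OF assms(3)] integrable_on_mult_right)
      also have "\<dots> = (\<Sum>E\<in>S. a E * c E t0 r)"
        by (simp only: integral_mult_right c_def)
      also have "\<dots> = 0" using a[OF Pc] r by simp
      finally show ?thesis .
    qed
    from continuous_eq_0_if_bump_integrals_eq_0[OF cont this]
    have "h (of_mat T) = 0" for T .
    then have "(\<Sum>E\<in>S. a E * \<bar>det (frame_matrix J (\<beta> E) T)\<bar>) = 0" for T
      by (simp add: h_def)
    moreover have "J \<noteq> {}" using J assms(1) by auto
    ultimately show "\<forall>E\<in>S. a E = 0"
      using abs_det_frame_matrix_independent[OF assms(3), of J \<beta> a] assms(4) \<beta>(1) J by blast
  qed
  then obtain f \<phi> where "\<phi> \<in> Val_even_smooth k" and f: "\<forall>E\<in>S. f E = m E"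
    and \<phi>: "\<forall>E\<in>S. restricts_to \<phi> E (\<lambda>A. f E * measure (lborel_subspace E) A)"
    unfolding P_def by blast
  moreover have "\<forall>E\<in>S. restricts_to \<phi> E (\<mu> E)"
    using f m \<phi> by simp
  ultimately show ?thesis by blast
qed

end
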